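(* An edge-based scheme on a 1-periodic simplicial mesh of $\mathbb{R}^d$ (as defined in the context) has zero mean error on the second order polynomials, i.e. $$\sum_{j\in\mathcal{N}^1}|K_j|\,\epsilon_j(f,\Pi)=0\quad\text{for each } f\in(P_2)^n.$$
   Context: System: $\partial_t w+\boldsymbol{A}\cdot\nabla w=0$ in $\mathbb{R}^d$, $\boldsymbol{A}=(A_1,\dots,A_d)$ constant real $n\times n$ matrices, $\boldsymbol{A}\cdot\boldsymbol e=\sum_i e_iA_i$, $\boldsymbol{A}\cdot\nabla f=\sum_iA_i\partial f/\partial x_i$. $P_q$: polynomials in $d$ variables of degree at most $q$. Mesh: a conforming simplicial mesh of $\mathbb{R}^d$ invariant under translations by integer vectors, with finitely many nodes per unit cube; $\mathcal{N}$ is the set of nodes, $\boldsymbol r_j$ the radius-vector of node $j$, $\mathcal{N}^1$ the set of nodes modulo integer translations. Control volume (barycentric/median dual cell) of node $j$: $$K_j=\bigcup_{e\ni j}\Bigl\{\sum_{l\in e}\alpha_l\boldsymbol r_l:\ \alpha_l\in[0,1],\ \sum_{l\in e}\alpha_l=1,\ \alpha_j=\max_{l\in e}\alpha_l\Bigr\},$$ the union being over simplexes $e$ having $j$ as a vertex; $|K_j|=\frac1{d+1}\sum_{e\ni j}|e|$. $N(j)$ is the set of nodes connected to $j$ by an edge; $\boldsymbol n_{jk}=\int_{\partial K_j\cap\partial K_k}\boldsymbol n\,dS$ with $\boldsymbol n$ the unit normal pointing into $K_k$. $\Pi$ maps a continuous function to its values at the nodes. Edge-based scheme: a scheme $\frac{du_j}{dt}+\frac{1}{|K_j|}\sum_{k\in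 N(j)}F_{jk}[u]=0$, $j\in\mathcal{N}$, where the fluxes $F_{jk}[u]\in\mathbb{C}^n$ are linear in $u$, depend on finitely many $u_l$, are invariant with respect to translations preserving the mesh, satisfy $F_{jk}[u]=-F_{kj}[u]$, and are 1-exact at edge centers: for each $f\in(P_1)^n$, $j\in\mathcal{N}$, $k\in N(j)$, $$F_{jk}[\Pi f]=(\boldsymbol A\cdot\boldsymbol n_{jk})\,f\Bigl(\frac{\boldsymbol r_j+\boldsymbol r_k}{2}\Bigr).$$ Truncation error: $\epsilon_j(f,\Pi)=-(\boldsymbol A\cdot\nabla f)(\boldsymbol r_j)+\frac{1}{|K_j|}\sum_{k\in N(j)}F_{jk}[\Pi f]$. *)

theory Defs
  imports "HOL-Analysis.Analysis"
begin

text \<open>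
  A simplex is represented by its set of vertices, a mesh by the set of its simplexes (of full
  dimension), and a node by its radius-vector.  The space dimension is the cardinality of
  \<open>'d\<close>, the number of unknowns is the cardinality of \<open>'n\<close>.
\<close>

definition nodes :: "(real^'d) set set \<Rightarrow> (real^'d) set" where
  "nodes M = \<Union>M"

definition integer_vector :: "real^'d \<Rightarrow> bool" where
  "integer_vector z \<longleftrightarrow> (\<forall>i. z $ i \<in> \<int>)"

definition preserves_mesh :: "(real^'d) set set \<Rightarrow> real^'d \<Rightarrow> bool" where
  "preserves_mesh M z \<longleftrightarrow> (\<lambda>e. (\<lambda>x. x + z) ` e) ` M = M"

text \<open>
  The last condition (every node belongs to finitely many simplexes) is the usual local
  finiteness of a mesh; it is what makes \<open>N(j)\<close> and the union defining \<open>K\<^sub>j\<close> finite.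
\<close>

definition periodic_simplicial_mesh :: "(real^'d) set set \<Rightarrow> bool" where
  "periodic_simplicial_mesh M \<longleftrightarrow>
     (\<forall>e\<in>M. finite e \<and> card e = CARD('d) + 1 \<and> \<not> affine_dependent e) \<and>
     (\<Union>e\<in>M. convex hull e) = UNIV \<and>
     (\<forall>e\<in>M. \<forall>e'\<in>M. convex hull e \<inter> convex hull e' = convex hull (e \<inter> e')) \<and>
     (\<forall>z. integer_vector z \<longrightarrow> preserves_mesh M z) \<and>
     (\<forall>a. finite (nodes M \<inter> cbox a (a + 1))) \<and>
     (\<forall>j\<in>nodes M. finite {e \<in> M. j \<in> e})"

definition nodes_mod :: "(real^'d) set set \<Rightarrow> (real^'d) set set" where
  "nodes_mod M = nodes M // {(x, y). x \<in> nodes M \<and> y \<in> nodes M \<and> integer_vector (x - y)}"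

definition neighbours :: "(real^'d) set set \<Rightarrow> real^'d \<Rightarrow> (real^'d) set" where
  "neighbours M j = {k. k \<noteq> j \<and> (\<exists>e\<in>M. j \<in> e \<and> k \<in> e)}"

definition cell :: "(real^'d) set set \<Rightarrow> real^'d \<Rightarrow> (real^'d) set" where
  "cell M j = (\<Union>e\<in>{e \<in> M. j \<in> e}.
     {(\<Sum>l\<in>e. \<alpha> l *\<^sub>R l) | \<alpha> :: real^'d \<Rightarrow> real.
        (\<forall>l\<in>e. \<alpha> l \<in> {0..1}) \<and> (\<Sum>l\<in>e. \<alpha> l) = 1 \<and> \<alpha> j = Max (\<alpha> ` e)})"

definition cell_volume :: "(real^'d) set set \<Rightarrow> real^'d \<Rightarrow> real" where
  "cell_volume M j = measure lebesgue (cell M j)"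

text \<open>
  The surface \<open>\<partial>K\<^sub>j \<inter> \<partial>K\<^sub>k\<close> is polyhedral: within a simplex containing both \<open>j\<close> and \<open>k\<close> it is
  the flat piece \<open>\<alpha>\<^sub>j = \<alpha>\<^sub>k = max \<alpha>\<close> of codimension one, and distinct pieces meet in sets of
  surface measure zero.  The integral of the unit normal over it is therefore the sum over these
  pieces of area times unit normal.  The area of a subset of a hyperplane with unit normal \<open>\<nu>\<close> is
  the volume of the right prism of height one built on it (in dimension one, a point has area 1).
\<close>

definition flat_area :: "real^'d \<Rightarrow> (real^'d) set \<Rightarrow> real" where
  "flat_area \<nu> S = measure lebesgue {x + t *\<^sub>R \<nu> | x t. x \<in> S \<and> t \<in> {0..1}}"

definition unit_normal_into :: "(real^'d) set \<Rightarrow> (real^'d) set \<Rightarrow> real^'d" where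
  "unit_normal_into S K = (THE \<nu>. norm \<nu> = 1 \<and> (\<forall>x\<in>S. \<forall>y\<in>S. (x - y) \<bullet> \<nu> = 0) \<and>
     (\<forall>x\<in>rel_interior S. \<exists>\<delta>>0. \<forall>t. 0 < t \<and> t < \<delta> \<longrightarrow> x + t *\<^sub>R \<nu> \<in> K))"

definition interface_piece ::
    "(real^'d) set set \<Rightarrow> real^'d \<Rightarrow> real^'d \<Rightarrow> (real^'d) set \<Rightarrow> (real^'d) set" where
  "interface_piece M j k e = frontier (cell M j) \<inter> frontier (cell M k) \<inter> convex hull e"

definition interface_normal ::
    "(real^'d) set set \<Rightarrow> real^'d \<Rightarrow> real^'d \<Rightarrow> real^'d" where
  "interface_normal M j k = (\<Sum>e\<in>{e \<in> M. j \<in> e \<and> k \<in> e}.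
     let S = interface_piece M j k e; \<nu> = unit_normal_into S (cell M k)
     in flat_area \<nu> S *\<^sub>R \<nu>)"

text \<open>Polynomial functions of total degree at most \<open>q\<close>; \<open>m\<close> runs over the multi-indices.\<close>

definition poly_deg :: "nat \<Rightarrow> (real^'d \<Rightarrow> complex) set" where
  "poly_deg q = {f. \<exists>c :: ('d \<Rightarrow> nat) \<Rightarrow> complex.
     f = (\<lambda>x. \<Sum>m\<in>{m. (\<Sum>i\<in>UNIV. m i) \<le> q}. c m * (\<Prod>i\<in>UNIV. complex_of_real (x $ i) ^ m i))}"

definition vec_poly_deg :: "nat \<Rightarrow> (real^'d \<Rightarrow> complex^'n) set" where
  "vec_poly_deg q = {f. \<forall>i. (\<lambda>x. f x $ i) \<in> poly_deg q}"

text \<open>A real matrix acting on complex vectors.\<close>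

definition real_matrix_apply :: "real^'n^'n \<Rightarrow> complex^'n \<Rightarrow> complex^'n" where
  "real_matrix_apply B w = (\<chi> i j. complex_of_real (B $ i $ j)) *v w"

definition matrix_dot :: "('d::finite \<Rightarrow> real^'n^'n) \<Rightarrow> real^'d \<Rightarrow> real^'n^'n" where
  "matrix_dot A v = (\<Sum>i\<in>UNIV. v $ i *\<^sub>R A i)"

definition A_grad ::
    "('d::finite \<Rightarrow> real^'n^'n) \<Rightarrow> (real^'d \<Rightarrow> complex^'n) \<Rightarrow> real^'d \<Rightarrow> complex^'n" where
  "A_grad A f x = (\<Sum>i\<in>UNIV. real_matrix_apply (A i) (frechet_derivative f (at x) (axis i 1)))"

text \<open>
  A mesh function is a total function on the space of which only the values at the nodes
  matter: the finite dependence condition below makes the fluxes blind to the other values.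
\<close>

definition nodal_values ::
    "(real^'d) set set \<Rightarrow> (real^'d \<Rightarrow> complex^'n) \<Rightarrow> real^'d \<Rightarrow> complex^'n" where
  "nodal_values M f = (\<lambda>x. if x \<in> nodes M then f x else 0)"

type_synonym ('d, 'n) flux =
  "real^'d \<Rightarrow> real^'d \<Rightarrow> (real^'d \<Rightarrow> complex^'n) \<Rightarrow> complex^'n"

definition edge_based_scheme ::
    "(real^'d) set set \<Rightarrow> ('d \<Rightarrow> real^'n^'n) \<Rightarrow> ('d::finite, 'n::finite) flux \<Rightarrow> bool" where
  "edge_based_scheme M A F \<longleftrightarrow> (\<forall>j\<in>nodes M. \<forall>k\<in>neighbours M j.
     (\<forall>u v. F j k (\<lambda>l. u l + v l) = F j k u + F j k v) \<and>
     (\<forall>c u. F j k (\<lambda>l. c *s u l) = c *s F j k u) \<and>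
     (\<exists>L. finite L \<and> L \<subseteq> nodes M \<and>
        (\<forall>u v. (\<forall>l\<in>L. u l = v l) \<longrightarrow> F j k u = F j k v)) \<and>
     (\<forall>z u. preserves_mesh M z \<longrightarrow> F (j + z) (k + z) (\<lambda>l. u (l - z)) = F j k u) \<and>
     (\<forall>u. F j k u = - F k j u) \<and>
     (\<forall>f\<in>vec_poly_deg 1. F j k (nodal_values M f) =
        real_matrix_apply (matrix_dot A (interface_normal M j k)) (f ((1/2) *\<^sub>R (j + k)))))"

definition truncation_error ::
    "(real^'d) set set \<Rightarrow> ('d \<Rightarrow> real^'n^'n) \<Rightarrow> ('d::finite, 'n::finite) flux \<Rightarrow>
     (real^'d \<Rightarrow> complex^'n) \<Rightarrow> real^'d \<Rightarrow> complex^'n" where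
  "truncation_error M A F f j = - A_grad A f j +
     (1 / cell_volume M j) *\<^sub>R (\<Sum>k\<in>neighbours M j. F j k (nodal_values M f))"

end

theory Submission
  imports Defs
begin

text \<open>
  Write the quadratic function \<open>f\<close>, at a node \<open>j\<close>, as its tangent function plus the even
  quadratic form \<open>Q j x = B (x - j) (x - j)\<close>, where the bilinear \<open>B\<close> does not depend on \<open>j\<close>.
  The proof has two parts.

  The scheme is exact on the tangent function, which reproduces \<open>A_grad A f j\<close>.  As the fluxes
  of affine functions are prescribed at the edge midpoints, this is a pair of statements about the
  control volume: the interface normals \<open>n\<^sub>j\<^sub>k\<close> sum to zero over the neighbours, and the sum of
  \<open>n\<^sub>j\<^sub>k (k - j)\<^sup>T\<close> is twice the volume of the cell times the identity
  (\<open>sum_interface_normal_zero\<close> and \<open>sum_interface_normal_edge\<close>).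

  Hence \<open>|K\<^sub>j|\<close> times the truncation error is the sum over the neighbours of the vectors
  \<open>W j k\<close>, the flux from \<open>j\<close> to \<open>k\<close> of \<open>Q j\<close>.  The function \<open>Q j - Q k\<close> is affine and
  vanishes at the midpoint of the edge, because \<open>Q j\<close> and \<open>Q k\<close> come from the same even form and
  the midpoint has opposite positions relative to \<open>j\<close> and \<open>k\<close>.  So its flux is zero, and
  antisymmetry of the fluxes gives \<open>W k j = - W j k\<close>.  As \<open>W\<close> is also invariant under integer
  translations, its sum over all directed edges modulo translations cancels in pairs
  (\<open>sum_edges_mod_translation_zero\<close>).

  The geometric part rests on two computations.  In a simplex \<open>e\<close> with barycentric gradients \<open>g\<close>,
  the piece of the interface between \<open>j\<close> and \<open>k\<close> has area vector \<open>|e| / (d + 1) (g\<^sub>k - g\<^sub>j)\<close>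
  (\<open>interface_normal_eq\<close>).  Its direction is that of the gradient of the difference of the two
  coordinates.  Its area is read off from the volume of the cone over it with apex \<open>k\<close>: the simplex
  is tiled by \<open>d (d + 1)\<close> such cones, which are permuted by the symmetries of the simplex and
  therefore have equal volume.  The second computation is \<open>star_gradient_identity\<close>: integration by
  parts for the piecewise affine hat function of the node \<open>j\<close> against an affine function gives the
  required linear relations between the gradients \<open>g\<^sub>j\<close> in the simplexes around \<open>j\<close>.
\<close>

section \<open>Volumes of linear images over an arbitrary finite index type\<close>

text \<open>
  The determinant formula for the volume of a linear image concerns Cartesian spaces whose index
  type is well-ordered. This type is a well-ordered copy of an arbitrary finite index type, so
  that the formula can be transported by relabelling the coordinates.
\<close>

typedef (overloaded) ('d::finite) coord_index = "{..<CARD('d)}"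
  by (rule exI[of _ 0]) simp

instantiation coord_index :: (finite) "{finite, wellorder}"
begin
definition "(i :: 'a coord_index) \<le> j \<longleftrightarrow> Rep_coord_index i \<le> Rep_coord_index j"
definition "(i :: 'a coord_index) < j \<longleftrightarrow> Rep_coord_index i < Rep_coord_index j"
instance
proof
  fix x y z :: "'a coord_index"
  show "(x < y) = (x \<le> y \<and> \<not> y \<le> x)" "x \<le> x" "x \<le> y \<Longrightarrow> y \<le> z \<Longrightarrow> x \<le> z" "x \<le> y \<or> y \<le> x"
    by (auto simp: less_eq_coord_index_def less_coord_index_def)
  show "x \<le> y \<Longrightarrow> y \<le> x \<Longrightarrow> x = y"
    by (simp add: less_eq_coord_index_def Rep_coord_index_inject)
  have "inj_on Rep_coord_index (UNIV :: 'a coord_index set)" by (auto simp: inj_on_def Rep_coord_index_inject)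
  moreover have "finite (range (Rep_coord_index :: 'a coord_index \<Rightarrow> nat))"
    by (rule finite_subset[of _ "{..<CARD('a)}"]) (use Rep_coord_index in auto)
  ultimately show "finite (UNIV :: 'a coord_index set)" by (metis finite_imageD)
next
  fix P :: "'a coord_index \<Rightarrow> bool" and a
  assume P: "\<And>x. (\<And>y. y < x \<Longrightarrow> P y) \<Longrightarrow> P x"
  show "P a"
    by (induction a rule: measure_induct_rule[of Rep_coord_index]) (auto intro: P simp: less_coord_index_def)
qed
end

lemma ex_bij_coord_index: "\<exists>h :: 'd::finite coord_index \<Rightarrow> 'd. bij h"
proof -
  have "bij_betw Rep_coord_index (UNIV :: 'd coord_index set) {..<CARD('d)}"
    using type_definition.Rep_range[OF type_definition_coord_index]
    by (auto simp: bij_betw_def inj_on_def Rep_coord_index_inject)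
  then have "card (UNIV :: 'd coord_index set) = CARD('d)"
    using bij_betw_same_card by fastforce
  then show ?thesis using finite_same_card_bij[of "UNIV :: 'd coord_index set" "UNIV :: 'd set"] by auto
qed

text \<open>
  Relabelling of coordinates. For a bijection \<open>h\<close> this is an isometry that preserves
  volume.
\<close>

definition reindex :: "('e \<Rightarrow> 'd) \<Rightarrow> real^'d \<Rightarrow> real^'e" where
  "reindex h x = (\<chi> i. x $ h i)"

lemma linear_reindex: "linear (reindex h)"
  by (rule linearI) (auto simp: reindex_def vec_eq_iff)

lemma reindex_inverse: "bij h \<Longrightarrow> reindex (inv h) (reindex h x) = x" "bij h \<Longrightarrow> reindex h (reindex (inv h) y) = y"
  by (auto simp: reindex_def vec_eq_iff bij_is_inj bij_is_surj surj_f_inv_f)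

lemma inner_reindex: "bij h \<Longrightarrow> reindex h x \<bullet> reindex h y = x \<bullet> y"
  by (simp add: inner_vec_def reindex_def sum.reindex_bij_betw[of h UNIV UNIV "\<lambda>i. x $ i * y $ i"])

lemma borel_measurable_linear: "linear f \<Longrightarrow> f \<in> borel_measurable borel"
  for f :: "'a::euclidean_space \<Rightarrow> 'b::euclidean_space"
  by (intro borel_measurable_continuous_onI linear_continuous_on linear_conv_bounded_linear[THEN iffD1])

lemma prod_Basis_cart: "(\<Prod>b\<in>Basis. g b) = (\<Prod>i\<in>UNIV. g (axis i (1::real) :: real^'n))"
proof -
  have B: "(Basis :: (real^'n) set) = (\<lambda>i. axis i 1) ` UNIV" by (auto simp: Basis_vec_def)
  have "inj (\<lambda>i. axis i 1 :: real^'n)" by (auto simp: inj_on_def axis_eq_axis)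
  from prod.reindex[OF this, of g] show ?thesis unfolding B by (simp add: comp_def)
qed

lemma lborel_reindex:
  fixes h :: "'e::finite \<Rightarrow> 'd::finite"
  assumes h: "bij h"
  shows "distr lborel borel (reindex h) = lborel"
proof (rule lborel_eqI[symmetric])
  fix l u :: "real^'e"
  assume le: "\<And>b. b \<in> Basis \<Longrightarrow> l \<bullet> b \<le> u \<bullet> b"
  have ax: "l $ i \<le> u $ i" for i using le[of "axis i 1"] by (simp add: inner_axis)
  have vim: "reindex h -` box l u = box (reindex (inv h) l) (reindex (inv h) u)"
    using h by (auto simp: mem_box_cart reindex_def bij_is_inj) (metis bij_inv_eq_iff)+
  have "emeasure (distr lborel borel (reindex h)) (box l u) = emeasure lborel (reindex h -` box l u)"
    by (subst emeasure_distr) (auto intro: borel_measurable_linear linear_reindex)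
  also have "\<dots> = (\<Prod>b\<in>Basis. (reindex (inv h) u - reindex (inv h) l) \<bullet> b)"
    unfolding vim by (rule emeasure_lborel_box) (auto simp: Basis_vec_def inner_axis reindex_def ax)
  also have "(\<Prod>b\<in>Basis. (reindex (inv h) u - reindex (inv h) l) \<bullet> b) = (\<Prod>i\<in>UNIV. u $ inv h i - l $ inv h i)"
    by (simp add: prod_Basis_cart inner_axis reindex_def)
  also have "\<dots> = (\<Prod>i\<in>UNIV. u $ i - l $ i)"
    using prod.reindex_bij_betw[of "inv h" UNIV UNIV "\<lambda>i. u $ i - l $ i"] bij_imp_bij_inv[OF h] by simp
  also have "\<dots> = (\<Prod>b\<in>Basis. (u - l) \<bullet> b)"
    by (simp add: prod_Basis_cart inner_axis)
  finally show "emeasure (distr lborel borel (reindex h)) (box l u) = ennreal (\<Prod>b\<in>Basis. (u - l) \<bullet> b)" .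
qed simp

lemma reindex_image_vimage: "bij h \<Longrightarrow> reindex h ` S = reindex (inv h) -` S"
  using reindex_inverse[of h] by (auto simp: image_iff) metis

lemma sets_reindex: "bij h \<Longrightarrow> S \<in> sets borel \<Longrightarrow> reindex h ` S \<in> sets borel"
  using measurable_sets[OF borel_measurable_linear[OF linear_reindex[of "inv h"]], of S]
  by (simp add: reindex_image_vimage)

lemma measure_reindex:
  fixes h :: "'e::finite \<Rightarrow> 'd::finite"
  assumes h: "bij h" and S: "S \<in> sets borel"
  shows "measure lebesgue (reindex h ` S) = measure lebesgue S"
proof -
  have "measure lborel S = measure (distr lborel borel (reindex (inv h))) S"
    by (simp add: lborel_reindex h bij_imp_bij_inv)
  also have "\<dots> = measure lborel (reindex h ` S)"
    using S h by (subst measure_distr) (auto simp: reindex_image_vimage intro: borel_measurable_linear linear_reindex)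
  finally show ?thesis using S sets_reindex[OF h S] by (simp add: measure_completion)
qed

lemma bounded_borel_lmeasurable: "S \<in> sets borel \<Longrightarrow> bounded S \<Longrightarrow> S \<in> lmeasurable"
  by (simp add: bounded_set_imp_lmeasurable)

text \<open>
  The factor is the absolute determinant of the map read in well-ordered coordinates. Its value
  can be read off from any one set of positive volume whose image is known.
\<close>

lemma measure_linear_image_proportional:
  fixes T :: "real^'d \<Rightarrow> real^'d"
  assumes T: "linear T" and inj: "inj T"
  shows "\<exists>c. \<forall>S\<in>sets borel. bounded S \<longrightarrow> measure lebesgue (T ` S) = c * measure lebesgue S"
proof -
  obtain h :: "'d coord_index \<Rightarrow> 'd" where h: "bij h" using ex_bij_coord_index by blast
  define T' where "T' = reindex h \<circ> T \<circ> reindex (inv h)"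
  have linT': "linear T'" unfolding T'_def by (intro linear_compose T linear_reindex)
  have "measure lebesgue (T ` S) = \<bar>det (matrix T')\<bar> * measure lebesgue S" if S: "S \<in> sets borel" "bounded S" for S
  proof -
    have im: "T ` S \<in> sets borel"
    proof -
      obtain g where g: "linear g" "g \<circ> T = id" using linear_injective_left_inverse[OF T inj] by blast
      moreover from g T have "T \<circ> g = id" using linear_inverse_left by blast
      ultimately have "T ` S = g -` S" by (auto simp: image_iff fun_eq_iff) (metis)
      then show ?thesis using measurable_sets[OF borel_measurable_linear[OF g(1)] S(1)] by simp
    qed
    have "measure lebesgue (T ` S) = measure lebesgue (reindex h ` T ` S)"
      by (simp add: measure_reindex[OF h im])
    also have "reindex h ` T ` S = T' ` reindex h ` S"
      by (simp add: T'_def image_comp reindex_inverse[OF h] comp_def)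
    also have "measure lebesgue \<dots> = \<bar>det (matrix T')\<bar> * measure lebesgue (reindex h ` S)"
      by (intro measure_linear_image linT' bounded_borel_lmeasurable sets_reindex h S bounded_linear_image
          linear_conv_bounded_linear[THEN iffD1] linear_reindex)
    finally show ?thesis by (simp add: measure_reindex[OF h S(1)])
  qed
  then show ?thesis by blast
qed

section \<open>Prisms and cones over a flat base\<close>

text \<open>
  The map fixes the hyperplane orthogonal to \<open>\<nu>\<close> and sends \<open>\<nu>\<close>
  to \<open>w\<close>. A rotation taking a coordinate axis to \<open>\<nu>\<close> turns its
  matrix into the identity with one column replaced, and Cramer's rule gives the determinant of
  such a matrix.
\<close>

lemma det_rank_one_update:
  fixes \<nu> w :: "real^'d"
  assumes "norm \<nu> = 1"
  shows "\<bar>det (matrix (\<lambda>x. x + (\<nu> \<bullet> x) *\<^sub>R (w - \<nu>)))\<bar> = \<bar>\<nu> \<bullet> w\<bar>"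
proof -
  define T where "T = (\<lambda>x. x + (\<nu> \<bullet> x) *\<^sub>R (w - \<nu>))"
  obtain k :: 'd where True by auto
  have "norm (axis k 1 :: real^'d) = norm \<nu>" using assms by simp
  then obtain R :: "real^'d \<Rightarrow> real^'d" where R: "orthogonal_transformation R" "R (axis k 1) = \<nu>"
    using orthogonal_transformation_exists[of "axis k 1" \<nu>] by metis
  have linR: "linear R" using R(1) by (rule orthogonal_transformation_linear)
  obtain y where y: "R y = w"
    using orthogonal_transformation_surj[OF R(1)] by (metis surjD)
  define T' where "T' = (\<lambda>x::real^'d. x + (x $ k) *\<^sub>R (y - axis k 1))"
  have ip: "\<nu> \<bullet> R x = x $ k" for x
  proof -
    have "\<nu> \<bullet> R x = axis k 1 \<bullet> x"
      using R by (metis orthogonal_transformation_def)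
    then show ?thesis by (simp add: inner_axis')
  qed
  have linT: "linear T" unfolding T_def
    by (rule linearI) (auto simp: algebra_simps inner_add_right)
  have linT': "linear T'" unfolding T'_def
    by (rule linearI) (auto simp: algebra_simps)
  have "T \<circ> R = R \<circ> T'"
    by (rule ext) (simp add: T_def T'_def ip linear_add[OF linR] linear_scale[OF linR] linear_diff[OF linR] R(2) y)
  then have "matrix T ** matrix R = matrix R ** matrix T'"
    by (metis linR linT linT' matrix_compose)
  then have "det (matrix T) * det (matrix R) = det (matrix R) * det (matrix T')"
    by (metis det_mul)
  moreover have "det (matrix R) \<noteq> 0"
    using R(1) det_orthogonal_matrix orthogonal_transformation_matrix by fastforce
  ultimately have "det (matrix T) = det (matrix T')" by simp
  also have "matrix T' = (\<chi> i j. if j = k then (mat 1 *v y) $ i else (mat 1 :: real^'d^'d) $ i $ j)"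
    by (auto simp: matrix_def T'_def vec_eq_iff axis_def matrix_vector_mul_lid) (auto simp: mat_def)
  also have "det \<dots> = y $ k"
    using cramer_lemma[of k "mat 1 :: real^'d^'d" y] by simp
  also have "y $ k = \<nu> \<bullet> w" using ip[of y] y by simp
  finally show ?thesis by (simp add: T_def)
qed

text \<open>
  The body swept by \<open>S\<close> when it is translated along \<open>v\<close>. For a flat
  \<open>S\<close> and its unit normal the volume of this body is the area of \<open>S\<close>.
\<close>

definition prism :: "real^'d \<Rightarrow> (real^'d) set \<Rightarrow> (real^'d) set" where
  "prism v S = {x + t *\<^sub>R v | x t. x \<in> S \<and> t \<in> {0..1}}"

lemma linear_image_prism:
  assumes f: "linear f"
  shows "f ` prism w S = prism (f w) (f ` S)"
proof -
  have e: "f (x + t *\<^sub>R w) = f x + t *\<^sub>R f w" for x t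
    by (simp add: linear_add[OF f] linear_scale[OF f])
  show ?thesis
    unfolding prism_def by (intro equalityI subsetI; clarsimp simp: e image_iff; metis e)
qed

lemma compact_prism: "compact S \<Longrightarrow> compact (prism v S)"
proof -
  assume S: "compact S"
  have "prism v S = {x + y | x y. x \<in> S \<and> y \<in> (\<lambda>t. t *\<^sub>R v) ` {0..1}}"
    unfolding prism_def by blast
  moreover have "compact ((\<lambda>t. t *\<^sub>R v) ` {0..1::real})"
    by (intro compact_continuous_image continuous_intros compact_Icc)
  ultimately show ?thesis using compact_sums[OF S] by simp
qed

lemma measure_prism_wellorder:
  fixes \<nu> v :: "real^'d::{finite,wellorder}"
  assumes \<nu>: "norm \<nu> = 1" and S: "\<And>x. x \<in> S \<Longrightarrow> \<nu> \<bullet> x = c" and "compact S"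
  shows "measure lebesgue (prism v S) = \<bar>\<nu> \<bullet> v\<bar> * measure lebesgue (prism \<nu> S)"
proof -
  define T where "T = (\<lambda>x. x + (\<nu> \<bullet> x) *\<^sub>R (v - \<nu>))"
  have linT: "linear T" unfolding T_def
    by (rule linearI) (auto simp: algebra_simps inner_add_right)
  have \<nu>\<nu>: "\<nu> \<bullet> \<nu> = 1" using \<nu> by (simp add: dot_square_norm)
  have T: "x + t *\<^sub>R v = - c *\<^sub>R (v - \<nu>) + T (x + t *\<^sub>R \<nu>)" if "x \<in> S" for x t
    unfolding T_def by (simp add: inner_add_right S[OF that] \<nu>\<nu> algebra_simps)
  have "prism v S = (+) (- c *\<^sub>R (v - \<nu>)) ` T ` prism \<nu> S"
  proof (intro equalityI subsetI)
    fix y assume "y \<in> prism v S"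
    then obtain x t where "y = x + t *\<^sub>R v" "x \<in> S" "t \<in> {0..1}" unfolding prism_def by blast
    then show "y \<in> (+) (- c *\<^sub>R (v - \<nu>)) ` T ` prism \<nu> S"
      unfolding prism_def using T[of x t] by blast
  next
    fix y assume "y \<in> (+) (- c *\<^sub>R (v - \<nu>)) ` T ` prism \<nu> S"
    then obtain x t where "y = - c *\<^sub>R (v - \<nu>) + T (x + t *\<^sub>R \<nu>)" "x \<in> S" "t \<in> {0..1}"
      unfolding prism_def by blast
    then show "y \<in> prism v S" unfolding prism_def using T[of x t] by (auto intro!: exI[of _ x] exI[of _ t])
  qed
  then have "measure lebesgue (prism v S) = measure lebesgue (T ` prism \<nu> S)"
    by (simp only: measure_translation)
  also have "\<dots> = \<bar>det (matrix T)\<bar> * measure lebesgue (prism \<nu> S)"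
    by (intro measure_linear_image linT lmeasurable_compact compact_prism assms)
  finally show ?thesis using det_rank_one_update[OF \<nu>, of v] by (simp add: T_def)
qed

text \<open>
  The volume of a slanted prism is base area times height: the shear that fixes the hyperplane of
  \<open>S\<close> and moves \<open>\<nu>\<close> to \<open>v\<close> maps the right prism onto
  the slanted one.
\<close>

lemma measure_prism:
  fixes \<nu> v :: "real^'d"
  assumes \<nu>: "norm \<nu> = 1" and S: "\<And>x. x \<in> S \<Longrightarrow> \<nu> \<bullet> x = c" and cS: "compact S"
  shows "measure lebesgue (prism v S) = \<bar>\<nu> \<bullet> v\<bar> * measure lebesgue (prism \<nu> S)"
proof -
  obtain h :: "'d coord_index \<Rightarrow> 'd" where h: "bij h" using ex_bij_coord_index by blast
  have pr: "reindex h ` prism w S = prism (reindex h w) (reindex h ` S)" for w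
    by (rule linear_image_prism[OF linear_reindex])
  have m: "measure lebesgue (prism w S) = measure lebesgue (prism (reindex h w) (reindex h ` S))" for w
    using measure_reindex[OF h, of "prism w S"] compact_prism[OF cS, of w]
    by (simp add: pr borel_closed compact_imp_closed)
  have "norm (reindex h \<nu>) = 1" using \<nu> inner_reindex[OF h, of \<nu> \<nu>] by (simp add: norm_eq_sqrt_inner)
  moreover have "compact (reindex h ` S)"
    by (intro compact_continuous_image cS linear_continuous_on linear_conv_bounded_linear[THEN iffD1] linear_reindex)
  moreover have "reindex h \<nu> \<bullet> y = c" if "y \<in> reindex h ` S" for y
    using that S by (auto simp: inner_reindex[OF h])
  ultimately show ?thesis
    unfolding m using measure_prism_wellorder[of "reindex h \<nu>" "reindex h ` S" c "reindex h v"]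
    by (simp add: inner_reindex[OF h])
qed

lemma measure_prism_scaleR:
  fixes v :: "real^'d"
  assumes \<nu>: "norm \<nu> = 1" and S: "\<And>x. x \<in> S \<Longrightarrow> \<nu> \<bullet> x = c" and "compact S" "h \<ge> 0"
  shows "measure lebesgue (prism (h *\<^sub>R v) S) = h * measure lebesgue (prism v S)"
  using measure_prism[OF \<nu> S assms(3), of v] measure_prism[OF \<nu> S assms(3), of "h *\<^sub>R v"] assms(4)
  by (simp add: abs_mult)

lemma measure_scaleR_image:
  fixes S :: "(real^'d) set"
  assumes S: "S \<in> lmeasurable"
  shows "measure lebesgue ((\<lambda>x. c *\<^sub>R x) ` S) = \<bar>c\<bar> ^ CARD('d) * measure lebesgue S"
  using measure_lebesgue_affine[of c 0 S] by simp

definition cone_from_origin :: "(real^'d) set \<Rightarrow> (real^'d) set" where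
  "cone_from_origin S = {s *\<^sub>R y | s y. s \<in> {0..1} \<and> y \<in> S}"

lemma compact_cone_from_origin: "compact S \<Longrightarrow> compact (cone_from_origin S)"
proof -
  assume S: "compact S"
  have "cone_from_origin S = (\<lambda>(s,y). s *\<^sub>R y) ` ({0..1} \<times> S)"
    unfolding cone_from_origin_def by (auto simp: image_iff) blast
  then show ?thesis
    by (auto intro!: compact_continuous_image continuous_intros compact_Times S simp: split_def)
qed

text \<open>
  A cone has volume base times height divided by the dimension. The right-hand side is base times
  height because \<open>- s0\<close> leads from the base to the apex. The layer of the cone
  between the scale factors \<open>1 - h\<close> and \<open>1\<close> lies in a prism of height
  \<open>h\<close> over \<open>S\<close> and contains, up to translation, such a prism over the
  base shrunk by \<open>1 - h\<close> about \<open>s0\<close>. The volume of the layer is the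
  fraction \<open>1 - (1 - h) ^ d\<close> of the cone, and division by \<open>h\<close> followed
  by \<open>h \<rightarrow> 0\<close> produces the factor \<open>d\<close> as a derivative.
\<close>

lemma measure_cone_from_origin:
  fixes S :: "(real^'d) set"
  assumes \<nu>: "norm \<nu> = 1" and S: "\<And>x. x \<in> S \<Longrightarrow> \<nu> \<bullet> x = c" and cS: "compact S"
    and conv: "convex S" and c: "c \<noteq> 0" and s0: "s0 \<in> S"
  shows "real CARD('d) * measure lebesgue (cone_from_origin S) = measure lebesgue (prism (- s0) S)"
proof -
  let ?C = "cone_from_origin S" and ?d = "CARD('d)"
  define mC where "mC = measure lebesgue ?C"
  define mP where "mP = measure lebesgue (prism (- s0) S)"
  have Cm: "?C \<in> lmeasurable" by (intro lmeasurable_compact compact_cone_from_origin cS)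
  have Pm: "prism v S \<in> lmeasurable" for v by (intro lmeasurable_compact compact_prism cS)
  have sc: "measure lebesgue ((\<lambda>x. a *\<^sub>R x) ` ?C) = a ^ ?d * mC" if "a \<ge> 0" for a
    using measure_scaleR_image[OF Cm, of a] that by (simp add: mC_def)
  have scm: "(\<lambda>x. a *\<^sub>R x) ` ?C \<in> lmeasurable" for a
    by (intro lmeasurable_compact compact_scaling compact_cone_from_origin cS)
  \<comment> \<open>A point of the layer, moved parallel to \<open>- s0\<close>, meets the base by convexity.\<close>
  have up: "mC \<le> (1 - h) ^ ?d * mC + h * mP" if h: "0 < h" "h < 1" for h
  proof -
    have sub: "?C \<subseteq> (\<lambda>x. (1 - h) *\<^sub>R x) ` ?C \<union> prism (h *\<^sub>R - s0) S"
    proof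
      fix x assume "x \<in> ?C"
      then obtain s y where x: "x = s *\<^sub>R y" "s \<in> {0..1}" "y \<in> S" by (auto simp: cone_from_origin_def)
      show "x \<in> (\<lambda>x. (1 - h) *\<^sub>R x) ` ?C \<union> prism (h *\<^sub>R - s0) S"
      proof (cases "s \<le> 1 - h")
        case True
        then have "x = (1 - h) *\<^sub>R ((s / (1 - h)) *\<^sub>R y)" "s / (1 - h) \<in> {0..1}"
          using x h True by auto
        moreover from this have "(s / (1 - h)) *\<^sub>R y \<in> ?C" using x(3) unfolding cone_from_origin_def by blast
        ultimately show ?thesis by blast
      next
        case False
        have "s *\<^sub>R y + (1 - s) *\<^sub>R s0 \<in> S"
          using conv x s0 by (auto simp: convex_def)
        moreover have "x = (s *\<^sub>R y + (1 - s) *\<^sub>R s0) + ((1 - s) / h) *\<^sub>R (h *\<^sub>R - s0)"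
          using h x by simp
        moreover have "(1 - s) / h \<in> {0..1}" using False x h by auto
        ultimately show ?thesis unfolding prism_def by blast
      qed
    qed
    have "mC \<le> measure lebesgue ((\<lambda>x. (1 - h) *\<^sub>R x) ` ?C \<union> prism (h *\<^sub>R - s0) S)"
      unfolding mC_def by (rule measure_mono_fmeasurable[OF sub]) (use Cm scm Pm in auto)
    also have "\<dots> \<le> measure lebesgue ((\<lambda>x. (1 - h) *\<^sub>R x) ` ?C) + measure lebesgue (prism (h *\<^sub>R - s0) S)"
      by (rule measure_Un_le) (use Cm scm Pm in auto)
    also have "\<dots> = (1 - h) ^ ?d * mC + h * mP"
      using sc[of "1-h"] measure_prism_scaleR[OF \<nu> S cS, of h "- s0"] h by (simp add: mP_def)
    finally show ?thesis .
  qed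
  \<comment> \<open>A copy of the prism, shrunk by \<open>1 - h\<close> and then translated, fits into the layer.\<close>
  have low: "(1 - h) ^ ?d * mC + (1 - h) ^ ?d * (h / (1 - h) * mP) \<le> mC" if h: "0 < h" "h < 1" for h
  proof -
    let ?P = "prism ((h / (1 - h)) *\<^sub>R - s0) S"
    define Q where "Q = (+) (h *\<^sub>R s0) ` (\<lambda>x. (1 - h) *\<^sub>R x) ` ?P"
    have Qm: "Q \<in> lmeasurable" unfolding Q_def
      by (intro lmeasurable_compact compact_translation compact_scaling compact_prism cS)
    have mQ: "measure lebesgue Q = (1 - h) ^ ?d * (h / (1 - h) * mP)"
      unfolding Q_def measure_translation
      using measure_scaleR_image[OF Pm[of "(h / (1 - h)) *\<^sub>R - s0"], of "1 - h"]
        measure_prism_scaleR[OF \<nu> S cS, of "h / (1 - h)" "- s0"] h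
      by (simp add: mP_def)
    have Qel: "\<exists>y t. x = (1 - h) *\<^sub>R y + (h - t) *\<^sub>R s0 \<and> y \<in> S \<and> 0 \<le> t \<and> t \<le> h" if "x \<in> Q" for x
    proof -
      from that obtain y t where yt: "y \<in> S" "0 \<le> t" "t \<le> 1"
        "x = h *\<^sub>R s0 + (1 - h) *\<^sub>R (y + t *\<^sub>R ((h / (1 - h)) *\<^sub>R - s0))"
        by (auto simp: Q_def prism_def)
      have "x = (1 - h) *\<^sub>R y + (h - t * h) *\<^sub>R s0"
      proof -
        have "(1 - h) *\<^sub>R (t *\<^sub>R ((h / (1 - h)) *\<^sub>R - s0)) = - (t * h) *\<^sub>R s0"
          using h by simp
        then show ?thesis unfolding yt(4) by (simp only: scaleR_add_right) (simp add: scaleR_diff_left)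
      qed
      moreover have "0 \<le> t * h" "t * h \<le> h" using yt h by (auto simp: mult_le_cancel_right1)
      ultimately show ?thesis using yt by blast
    qed
    have QC: "Q \<subseteq> ?C"
    proof
      fix x assume "x \<in> Q"
      then obtain y t where yt: "x = (1 - h) *\<^sub>R y + (h - t) *\<^sub>R s0" "y \<in> S" "0 \<le> t" "t \<le> h"
        using Qel by blast
      define z where "z = ((1 - h) / (1 - t)) *\<^sub>R y + ((h - t) / (1 - t)) *\<^sub>R s0"
      have "((1 - h) / (1 - t)) + ((h - t) / (1 - t)) = 1" using yt h by (simp add: field_simps)
      then have "z \<in> S" unfolding z_def using conv yt s0 h by (intro convexD) auto
      moreover have "x = (1 - t) *\<^sub>R z" using yt h by (simp add: z_def scaleR_add_right)
      ultimately show "x \<in> ?C" using yt h unfolding cone_from_origin_def by (intro CollectI exI[of _ "1 - t"] exI[of _ z]) auto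
    qed
    have CC: "(\<lambda>x. (1 - h) *\<^sub>R x) ` ?C \<subseteq> ?C"
    proof
      fix x assume "x \<in> (\<lambda>x. (1 - h) *\<^sub>R x) ` ?C"
      then obtain s y where "x = ((1 - h) * s) *\<^sub>R y" "0 \<le> s" "s \<le> 1" "y \<in> S"
        by (auto simp: cone_from_origin_def)
      moreover from this have "(1 - h) * s \<le> 1" "0 \<le> (1 - h) * s" using h by (auto intro: mult_le_one)
      ultimately show "x \<in> ?C" unfolding cone_from_origin_def by (auto intro!: exI[of _ "(1 - h) * s"])
    qed
    have "Q \<inter> (\<lambda>x. (1 - h) *\<^sub>R x) ` ?C \<subseteq> {x. \<nu> \<bullet> x = (1 - h) * c}"
    proof
      fix x assume x: "x \<in> Q \<inter> (\<lambda>x. (1 - h) *\<^sub>R x) ` ?C"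
      then obtain s y where 1: "x = ((1 - h) * s) *\<^sub>R y" "0 \<le> s" "s \<le> 1" "y \<in> S"
        by (auto simp: cone_from_origin_def)
      obtain y' t where 2: "x = (1 - h) *\<^sub>R y' + (h - t) *\<^sub>R s0" "y' \<in> S" "0 \<le> t" "t \<le> h"
        using Qel x by blast
      have "(1 - h) * s * c = (1 - h) * c + (h - t) * c"
        using arg_cong[OF trans[OF 1(1)[symmetric] 2(1)], of "\<lambda>x. \<nu> \<bullet> x"] 1 2 S s0
        by (simp add: inner_add_right)
      then have "(1 - h) * s = (1 - h) + (h - t)" using c by (metis distrib_right mult_cancel_right)
      moreover have "(1 - h) * s \<le> 1 - h" using 1 h by (simp add: mult_left_le)
      ultimately have "t = h" using 2 by simp
      then show "x \<in> {x. \<nu> \<bullet> x = (1 - h) * c}" using 2 S by simp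
    qed
    moreover have "negligible {x. \<nu> \<bullet> x = (1 - h) * c}"
      using \<nu> by (intro negligible_hyperplane) auto
    ultimately have "negligible (Q \<inter> (\<lambda>x. (1 - h) *\<^sub>R x) ` ?C)"
      using negligible_subset by blast
    then have "measure lebesgue (Q \<union> (\<lambda>x. (1 - h) *\<^sub>R x) ` ?C)
        = measure lebesgue Q + measure lebesgue ((\<lambda>x. (1 - h) *\<^sub>R x) ` ?C)"
      by (simp add: measure_Un3 Qm scm negligible_imp_measure0)
    moreover have "measure lebesgue (Q \<union> (\<lambda>x. (1 - h) *\<^sub>R x) ` ?C) \<le> mC"
      unfolding mC_def by (rule measure_mono_fmeasurable) (use QC CC Cm Qm scm in auto)
    ultimately show ?thesis using mQ sc[of "1 - h"] h by simp
  qed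
  have nontriv: "eventually (\<lambda>h::real. 0 < h \<and> h < 1) (at_right 0)"
    by (intro eventually_at_rightI[of 0 1]) auto
  have "((\<lambda>h. (1 - h) ^ ?d) has_real_derivative - real ?d) (at 0)"
    by (auto intro!: derivative_eq_intros)
  then have lim: "((\<lambda>h::real. ((1 - h) ^ ?d - 1) / h) \<longlongrightarrow> - real ?d) (at_right 0)"
    by (auto simp: has_field_derivative_iff intro: filterlim_mono[OF _ order_refl at_le])
  have lim2: "((\<lambda>h. (1 - (1 - h) ^ ?d) / h * mC) \<longlongrightarrow> real ?d * mC) (at_right 0)"
    using tendsto_mult_right[OF tendsto_minus[OF lim], of mC] by (simp add: minus_divide_left)
  have "real ?d * mC \<le> mP"
  proof (rule tendsto_upperbound[OF lim2])
    show "eventually (\<lambda>h. (1 - (1 - h) ^ ?d) / h * mC \<le> mP) (at_right 0)"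
    proof (rule eventually_mono[OF nontriv])
      fix h :: real assume h: "0 < h \<and> h < 1"
      have "(1 - (1 - h) ^ ?d) * mC \<le> h * mP"
        using up[of h] h by (simp add: algebra_simps)
      then show "(1 - (1 - h) ^ ?d) / h * mC \<le> mP"
        using h by (simp add: pos_divide_le_eq mult.commute)
    qed
  qed simp
  moreover have "mP \<le> real ?d * mC"
  proof (rule tendsto_le[OF _ lim2])
    show "((\<lambda>h. (1 - h) ^ ?d / (1 - h) * mP) \<longlongrightarrow> mP) (at_right 0)"
      by (auto intro!: tendsto_eq_intros)
    show "eventually (\<lambda>h. (1 - h) ^ ?d / (1 - h) * mP \<le> (1 - (1 - h) ^ ?d) / h * mC) (at_right 0)"
    proof (rule eventually_mono[OF nontriv])
      fix h :: real assume h: "0 < h \<and> h < 1"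
      have "h * ((1 - h) ^ ?d / (1 - h) * mP) \<le> (1 - (1 - h) ^ ?d) * mC"
        using low[of h] h by (simp add: algebra_simps)
      then show "(1 - h) ^ ?d / (1 - h) * mP \<le> (1 - (1 - h) ^ ?d) / h * mC"
        using h by (simp add: pos_le_divide_eq mult.commute)
    qed
  qed simp
  ultimately show ?thesis by (simp add: mC_def mP_def)
qed

section \<open>Barycentric coordinates of a simplex\<close>

definition is_simplex :: "(real^'d) set \<Rightarrow> bool" where
  "is_simplex e \<longleftrightarrow> finite e \<and> card e = CARD('d) + 1 \<and> \<not> affine_dependent e"

text \<open>
  The gradient of the barycentric coordinate of the vertex \<open>l\<close>: this coordinate is
  affine, equal to 1 at \<open>l\<close> and to 0 at the other vertices, so it drops by 1 along
  every edge leaving \<open>l\<close>.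
\<close>

definition bary_grad :: "(real^'d) set \<Rightarrow> real^'d \<Rightarrow> real^'d" where
  "bary_grad e l = (SOME g. \<forall>m\<in>e - {l}. g \<bullet> (m - l) = - 1)"

text \<open>
  The barycentric coordinate of \<open>l\<close>, extended affinely to the whole space.
\<close>

definition bary :: "(real^'d) set \<Rightarrow> real^'d \<Rightarrow> real^'d \<Rightarrow> real" where
  "bary e l x = 1 + bary_grad e l \<bullet> (x - l)"

lemma simplex_finite: "is_simplex e \<Longrightarrow> finite e"
  by (simp add: is_simplex_def)

lemma bary_grad_edge:
  fixes e :: "(real^'d) set"
  assumes e: "is_simplex e" and "l \<in> e" "m \<in> e" "m \<noteq> l"
  shows "bary_grad e l \<bullet> (m - l) = - 1"
proof -
  have "independent ((\<lambda>x. - l + x) ` (e - {l}))"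
    using e affine_dependent_iff_dependent2[OF \<open>l \<in> e\<close>] by (simp add: is_simplex_def)
  then obtain f :: "real^'d \<Rightarrow> real" where f: "linear f" "\<forall>x\<in>(\<lambda>x. - l + x) ` (e - {l}). f x = - 1"
    using linear_independent_extend[of _ "\<lambda>_. - 1 :: real"] by blast
  have "adjoint f 1 \<bullet> x = f x" for x
    using adjoint_works[OF f(1), of x 1] by (simp add: inner_commute)
  then have "\<forall>m\<in>e - {l}. adjoint f 1 \<bullet> (m - l) = - 1"
    using f(2) by simp
  then have "\<forall>m\<in>e - {l}. bary_grad e l \<bullet> (m - l) = - 1"
    unfolding bary_grad_def by (rule someI)
  then show ?thesis using assms by blast
qed

lemma bary_vertex:
  assumes "is_simplex e" "l \<in> e" "m \<in> e"
  shows "bary e l m = (if m = l then 1 else 0)"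
  using bary_grad_edge[OF assms] by (simp add: bary_def)

lemma bary_add: "bary e l (x + w) = bary e l x + bary_grad e l \<bullet> w"
  by (simp add: bary_def algebra_simps inner_add_right)

lemma bary_line: "bary e l ((1 - s) *\<^sub>R x + s *\<^sub>R y) = (1 - s) * bary e l x + s * bary e l y"
  by (simp add: bary_def algebra_simps inner_add_right)

lemma bary_sum:
  assumes "finite A" "sum u A = 1"
  shows "bary e l (\<Sum>m\<in>A. u m *\<^sub>R f m) = (\<Sum>m\<in>A. u m * bary e l (f m))"
proof -
  have "(\<Sum>m\<in>A. u m * bary e l (f m)) = sum u A * (1 - bary_grad e l \<bullet> l) + (\<Sum>m\<in>A. u m * (bary_grad e l \<bullet> f m))"
    by (simp add: bary_def sum_distrib_right sum.distrib [symmetric] algebra_simps)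
  then show ?thesis using assms by (simp add: bary_def inner_sum_right algebra_simps)
qed

lemma bary_combination:
  assumes e: "is_simplex e" and "sum u e = 1" "l \<in> e"
  shows "bary e l (\<Sum>m\<in>e. u m *\<^sub>R m) = u l"
  using assms simplex_finite[OF e]
  by (simp add: bary_sum bary_vertex if_distrib[of "\<lambda>x. _ * x"] sum.delta cong: if_cong sum.cong)

lemma
  assumes e: "is_simplex e"
  shows sum_bary: "(\<Sum>l\<in>e. bary e l x) = 1" and sum_bary_scaleR: "(\<Sum>l\<in>e. bary e l x *\<^sub>R l) = x"
proof -
  have "affine hull e = UNIV"
    using e by (intro affine_independent_span_eq) (auto simp: is_simplex_def)
  then obtain u where u: "sum u e = 1" "(\<Sum>v\<in>e. u v *\<^sub>R v) = x"
    using affine_hull_finite[OF simplex_finite[OF e]] by blast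
  then have "bary e l x = u l" if "l \<in> e" for l using bary_combination[OF e u(1) that] by simp
  then show "(\<Sum>l\<in>e. bary e l x) = 1" "(\<Sum>l\<in>e. bary e l x *\<^sub>R l) = x"
    using u by simp_all
qed

text \<open>
  An affine function is determined by its values at the vertices.
\<close>

lemma bary_unique:
  assumes e: "is_simplex e" and f: "\<And>x. f x = c + g \<bullet> x"
  shows "f x = (\<Sum>l\<in>e. bary e l x * f l)"
proof -
  have "f x = c + g \<bullet> (\<Sum>l\<in>e. bary e l x *\<^sub>R l)" using sum_bary_scaleR[OF e] f by simp
  also have "\<dots> = (\<Sum>l\<in>e. bary e l x) * c + (\<Sum>l\<in>e. bary e l x * (g \<bullet> l))"
    by (simp add: sum_bary[OF e] inner_sum_right)
  also have "\<dots> = (\<Sum>l\<in>e. bary e l x * f l)"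
    by (simp add: f sum_distrib_right sum.distrib distrib_left)
  finally show ?thesis .
qed

lemma sum_bary_grad:
  assumes e: "is_simplex e"
  shows "(\<Sum>l\<in>e. bary_grad e l) = 0"
proof -
  have "(\<Sum>l\<in>e. bary_grad e l) \<bullet> w = 0" for w
    using sum_bary[OF e, of "0 + w"] sum_bary[OF e, of 0]
    unfolding bary_add by (simp add: sum.distrib inner_sum_left)
  then show ?thesis by (metis inner_eq_zero_iff)
qed

lemma sum_bary_grad_vertex:
  assumes e: "is_simplex e"
  shows "(\<Sum>l\<in>e. (bary_grad e l \<bullet> w) *\<^sub>R l) = w"
  using sum_bary_scaleR[OF e, of "0 + w"] sum_bary_scaleR[OF e, of 0]
  unfolding bary_add by (simp add: sum.distrib scaleR_add_left)

lemma continuous_on_bary [continuous_intros]: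
  "continuous_on S f \<Longrightarrow> continuous_on S (\<lambda>x. bary e l (f x))"
  unfolding bary_def by (intro continuous_intros)

lemma simplex_hull:
  assumes e: "is_simplex e"
  shows "convex hull e = {x. \<forall>l\<in>e. 0 \<le> bary e l x}"
proof (intro equalityI subsetI)
  fix x assume "x \<in> convex hull e"
  then obtain u where u: "\<forall>l\<in>e. 0 \<le> u l" "sum u e = 1" "(\<Sum>l\<in>e. u l *\<^sub>R l) = x"
    using convex_hull_finite[OF simplex_finite[OF e]] by blast
  then show "x \<in> {x. \<forall>l\<in>e. 0 \<le> bary e l x}"
    using bary_combination[OF e u(2)] by auto
next
  fix x assume "x \<in> {x. \<forall>l\<in>e. 0 \<le> bary e l x}"
  then show "x \<in> convex hull e"
    unfolding convex_hull_finite[OF simplex_finite[OF e]] using sum_bary[OF e, of x] sum_bary_scaleR[OF e, of x]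
    by (intro CollectI exI[of _ "\<lambda>l. bary e l x"]) auto
qed

lemma open_bary_pos: 
  assumes e: "is_simplex e"
  shows "open {x. \<forall>l\<in>e. 0 < bary e l x}"
proof -
  have "{x. \<forall>l\<in>e. 0 < bary e l x} = (\<Inter>l\<in>e. {x. 0 < bary e l x})" by auto
  then show ?thesis using simplex_finite[OF e]
    by (auto intro!: open_INT open_Collect_less continuous_intros)
qed

lemma bary_pos_interior:
  assumes e: "is_simplex e" and "\<And>l. l \<in> e \<Longrightarrow> 0 < bary e l x"
  shows "x \<in> interior (convex hull e)"
  using assms by (intro interiorI[OF open_bary_pos[OF e]]) (auto simp: simplex_hull[OF e] less_imp_le)

lemma compact_simplex: "is_simplex e \<Longrightarrow> compact (convex hull e)"
  by (simp add: simplex_finite finite_imp_compact_convex_hull)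

lemma simplex_nonempty: "is_simplex e \<Longrightarrow> e \<noteq> {}"
  by (auto simp: is_simplex_def)

definition barycenter :: "(real^'d) set \<Rightarrow> real^'d" where
  "barycenter e = (\<Sum>l\<in>e. (1 / card e) *\<^sub>R l)"

lemma bary_barycenter: "is_simplex e \<Longrightarrow> l \<in> e \<Longrightarrow> bary e l (barycenter e) = 1 / card e"
  unfolding barycenter_def
  by (rule bary_combination) (auto simp: is_simplex_def)

lemma measure_simplex_pos:
  assumes e: "is_simplex e"
  shows "measure lebesgue (convex hull e) > 0"
proof -
  have "card e > 0" using e by (auto simp: is_simplex_def)
  then have "barycenter e \<in> interior (convex hull e)"
    by (intro bary_pos_interior e) (simp add: bary_barycenter[OF e])
  then have "interior (convex hull e) \<noteq> {}" by blast
  moreover have "convex hull e \<in> lmeasurable" using compact_simplex[OF e] by (rule lmeasurable_compact)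
  ultimately show ?thesis
    using open_not_negligible[OF open_interior] negligible_subset[OF _ interior_subset] negligible_iff_measure
    by (metis measure_nonneg less_eq_real_def)
qed

section \<open>Symmetry of a simplex under permutations of its vertices\<close>

text \<open>
  The affine map that permutes the vertices according to \<open>\<sigma>\<close>.
\<close>

definition vertex_map :: "(real^'d) set \<Rightarrow> (real^'d \<Rightarrow> real^'d) \<Rightarrow> real^'d \<Rightarrow> real^'d" where
  "vertex_map e \<sigma> x = (\<Sum>l\<in>e. bary e l x *\<^sub>R \<sigma> l)"

lemma bary_vertex_map:
  assumes e: "is_simplex e" and \<sigma>: "bij_betw \<sigma> e e" and "l \<in> e"
  shows "bary e (\<sigma> l) (vertex_map e \<sigma> x) = bary e l x"
proof -
  have \<sigma>e: "\<sigma> m \<in> e" if "m \<in> e" for m using \<sigma> that by (auto simp: bij_betw_def)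
  have inj: "\<sigma> m = \<sigma> l \<longleftrightarrow> m = l" if "m \<in> e" for m
    using \<sigma> that \<open>l \<in> e\<close> by (auto simp: bij_betw_def inj_on_def)
  have "bary e (\<sigma> l) (vertex_map e \<sigma> x) = (\<Sum>m\<in>e. bary e m x * bary e (\<sigma> l) (\<sigma> m))"
    unfolding vertex_map_def by (rule bary_sum) (use e in \<open>auto simp: simplex_finite sum_bary\<close>)
  also have "\<dots> = (\<Sum>m\<in>e. if m = l then bary e m x else 0)"
    by (intro sum.cong refl) (simp add: bary_vertex[OF e \<sigma>e[OF \<open>l \<in> e\<close>] \<sigma>e] inj)
  also have "\<dots> = bary e l x" using \<open>l \<in> e\<close> simplex_finite[OF e] by simp
  finally show ?thesis .
qed

lemma vertex_map_inverse:
  assumes e: "is_simplex e" and \<sigma>: "bij_betw \<sigma> e e"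
  shows "vertex_map e (inv_into e \<sigma>) (vertex_map e \<sigma> x) = x"
proof -
  have "vertex_map e (inv_into e \<sigma>) (vertex_map e \<sigma> x)
      = (\<Sum>l\<in>e. bary e (\<sigma> l) (vertex_map e \<sigma> x) *\<^sub>R inv_into e \<sigma> (\<sigma> l))"
    unfolding vertex_map_def[of e "inv_into e \<sigma>"]
    by (rule sum.reindex_bij_betw[OF \<sigma>, symmetric])
  also have "\<dots> = (\<Sum>l\<in>e. bary e l x *\<^sub>R l)"
    using \<sigma> by (intro sum.cong refl) (simp add: bary_vertex_map[OF e \<sigma>] bij_betw_def inv_into_f_f)
  finally show ?thesis by (simp add: sum_bary_scaleR[OF e])
qed

lemma vertex_map_inverse':
  assumes e: "is_simplex e" and \<sigma>: "bij_betw \<sigma> e e"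
  shows "vertex_map e \<sigma> (vertex_map e (inv_into e \<sigma>) x) = x"
proof -
  have "vertex_map e \<sigma> y = vertex_map e (inv_into e (inv_into e \<sigma>)) y" for y
    unfolding vertex_map_def using \<sigma> by (intro sum.cong refl) (simp add: inv_into_inv_into_eq)
  then show ?thesis using vertex_map_inverse[OF e bij_betw_inv_into[OF \<sigma>]] by simp
qed

lemma vertex_map_affine:
  "vertex_map e \<sigma> x = vertex_map e \<sigma> 0 + (\<Sum>l\<in>e. (bary_grad e l \<bullet> x) *\<^sub>R \<sigma> l)"
  unfolding vertex_map_def using bary_add[of e _ 0 x]
  by (simp add: sum.distrib[symmetric] scaleR_add_left)

lemma continuous_vertex_map: "continuous_on S (vertex_map e \<sigma>)"
  unfolding vertex_map_def by (intro continuous_intros)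

lemma vertex_map_image:
  assumes e: "is_simplex e" and \<sigma>: "bij_betw \<sigma> e e"
  shows "vertex_map e \<sigma> ` S = vertex_map e (inv_into e \<sigma>) -` S"
proof -
  have "vertex_map e (inv_into e \<sigma>) y \<in> S \<Longrightarrow> y \<in> vertex_map e \<sigma> ` S" for y
    using vertex_map_inverse'[OF assms, of y] by (metis imageI)
  then show ?thesis by (auto simp: vertex_map_inverse[OF assms])
qed

lemma vertex_map_hull:
  assumes e: "is_simplex e" and \<sigma>: "bij_betw \<sigma> e e"
  shows "vertex_map e \<sigma> x \<in> convex hull e \<longleftrightarrow> x \<in> convex hull e"
proof -
  have "(\<forall>l\<in>e. 0 \<le> bary e l (vertex_map e \<sigma> x)) \<longleftrightarrow> (\<forall>l\<in>\<sigma> ` e. 0 \<le> bary e l (vertex_map e \<sigma> x))"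
    using \<sigma> by (simp add: bij_betw_def)
  also have "\<dots> \<longleftrightarrow> (\<forall>l\<in>e. 0 \<le> bary e l x)" by (simp add: bary_vertex_map[OF assms])
  finally show ?thesis by (simp add: simplex_hull[OF e])
qed

text \<open>
  An affine map multiplies all volumes by one factor. As the simplex is mapped onto itself and has
  positive volume, the factor is 1.
\<close>

lemma measure_vertex_map:
  assumes e: "is_simplex e" and \<sigma>: "bij_betw \<sigma> e e" and S: "S \<in> sets borel" "bounded S"
  shows "measure lebesgue (vertex_map e \<sigma> ` S) = measure lebesgue S"
proof -
  define L where "L x = (\<Sum>l\<in>e. (bary_grad e l \<bullet> x) *\<^sub>R \<sigma> l)" for x
  have L: "linear L" unfolding L_def
    by (rule linearI) (auto simp: inner_add_right scaleR_add_left sum.distrib scaleR_sum_right)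
  have V: "vertex_map e \<sigma> = (\<lambda>x. vertex_map e \<sigma> 0 + L x)"
    unfolding L_def by (rule ext, rule vertex_map_affine)
  have VL: "vertex_map e \<sigma> ` X = (+) (vertex_map e \<sigma> 0) ` L ` X" for X
    by (subst V) (simp only: image_image)
  have "inj (vertex_map e \<sigma>)" by (metis vertex_map_inverse[OF e \<sigma>] injI)
  then have "inj L" unfolding inj_on_def by (metis V)
  then obtain c where c: "\<And>X. X \<in> sets borel \<Longrightarrow> bounded X \<Longrightarrow> measure lebesgue (L ` X) = c * measure lebesgue X"
    using measure_linear_image_proportional[OF L] by blast
  have c': "measure lebesgue (vertex_map e \<sigma> ` X) = c * measure lebesgue X" if "X \<in> sets borel" "bounded X" for X
    unfolding VL measure_translation by (rule c[OF that])
  have "vertex_map e \<sigma> ` (convex hull e) = convex hull e"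
    unfolding vertex_map_image[OF e \<sigma>] using vertex_map_hull[OF e bij_betw_inv_into[OF \<sigma>]] by auto
  then have "measure lebesgue (convex hull e) = c * measure lebesgue (convex hull e)"
    using c'[of "convex hull e"] compact_simplex[OF e]
    by (simp add: borel_closed compact_imp_closed compact_imp_bounded)
  then have "c = 1" using measure_simplex_pos[OF e] by simp
  then show ?thesis using c'[OF S] by simp
qed

lemma lborel_vertex_map:
  assumes e: "is_simplex e" and \<sigma>: "bij_betw \<sigma> e e"
  shows "distr lborel borel (vertex_map e \<sigma>) = lborel"
proof (rule lborel_eqI[symmetric])
  fix l u :: "real^'a"
  assume le: "\<And>b. b \<in> Basis \<Longrightarrow> l \<bullet> b \<le> u \<bullet> b"
  have m: "vertex_map e \<sigma> \<in> borel_measurable borel" for \<sigma>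
    by (intro borel_measurable_continuous_onI continuous_vertex_map)
  have im: "vertex_map e \<sigma> -` box l u = vertex_map e (inv_into e \<sigma>) ` box l u"
  proof -
    have "vertex_map e \<sigma> y \<in> box l u \<Longrightarrow> y \<in> vertex_map e (inv_into e \<sigma>) ` box l u" for y
      using vertex_map_inverse[OF e \<sigma>, of y] by (metis imageI)
    then show ?thesis by (auto simp: vertex_map_inverse'[OF e \<sigma>])
  qed
  have B: "vertex_map e \<sigma> -` box l u \<in> sets borel" using measurable_sets[OF m, of "box l u"] by simp
  have bd: "bounded (vertex_map e \<sigma> -` box l u)"
  proof (rule bounded_subset)
    show "bounded (vertex_map e (inv_into e \<sigma>) ` cbox l u)"
      by (intro compact_imp_bounded compact_continuous_image continuous_vertex_map compact_cbox)
    show "vertex_map e \<sigma> -` box l u \<subseteq> vertex_map e (inv_into e \<sigma>) ` cbox l u"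
      unfolding im using box_subset_cbox by blast
  qed
  have "emeasure (distr lborel borel (vertex_map e \<sigma>)) (box l u) = emeasure lborel (vertex_map e \<sigma> -` box l u)"
    by (subst emeasure_distr) (auto intro: m)
  also have "\<dots> = measure lebesgue (vertex_map e \<sigma> -` box l u)"
    using B emeasure_bounded_finite[OF bd] by (simp add: measure_completion emeasure_eq_ennreal_measure less_top[symmetric])
  also have "\<dots> = measure lebesgue (box l u)"
    unfolding im using measure_vertex_map[OF e bij_betw_inv_into[OF \<sigma>], of "box l u"] by simp
  also have "\<dots> = emeasure lborel (box l u)"
    using emeasure_bounded_finite[OF bounded_box, of l u]
    by (simp add: measure_completion emeasure_eq_ennreal_measure less_top[symmetric] del: emeasure_lborel_box_eq)
  also have "\<dots> = (\<Prod>b\<in>Basis. (u - l) \<bullet> b)"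
    using le by (rule emeasure_lborel_box)
  finally show "emeasure (distr lborel borel (vertex_map e \<sigma>)) (box l u) = ennreal (\<Prod>b\<in>Basis. (u - l) \<bullet> b)" .
qed simp

lemma integrable_simplex:
  fixes f :: "real^'d \<Rightarrow> real"
  assumes "is_simplex e" "continuous_on UNIV f"
  shows "integrable lborel (\<lambda>x. indicator (convex hull e) x * f x)"
  using borel_integrable_compact[OF compact_simplex[OF assms(1)] continuous_on_subset[OF assms(2) subset_UNIV]]
  by (simp add: indicator_scaleR_eq_if if_distrib cong: if_cong)

text \<open>
  All barycentric coordinates have the same integral, since transpositions of vertices preserve
  volume, and they sum to 1.
\<close>

lemma integral_bary:
  assumes e: "is_simplex e" and k: "k \<in> e"
  shows "(\<integral>x. indicator (convex hull e) x * bary e k x \<partial>lborel) = measure lebesgue (convex hull e) / card e"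
proof -
  let ?I = "\<lambda>k. (\<integral>x. indicator (convex hull e) x * bary e k x \<partial>lborel)"
  have eq: "?I l = ?I k" if l: "l \<in> e" for l
  proof -
    define \<sigma> where "\<sigma> = Transposition.transpose k l"
    have \<sigma>: "bij_betw \<sigma> e e" unfolding \<sigma>_def
      using k l by (auto simp: bij_betw_def Transposition.transpose_def inj_on_def image_iff split: if_splits)
    have meas: "(\<lambda>x. indicator (convex hull e) x * bary e l x) \<in> borel_measurable borel"
      using compact_simplex[OF e] 
      by (intro borel_measurable_times borel_measurable_indicator borel_measurable_continuous_onI continuous_intros)
        (auto simp: borel_closed compact_imp_closed)
    have "?I l = (\<integral>x. indicator (convex hull e) x * bary e l x \<partial>distr lborel borel (vertex_map e \<sigma>))"
      by (simp add: lborel_vertex_map[OF e \<sigma>])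
    also have "\<dots> = (\<integral>x. indicator (convex hull e) (vertex_map e \<sigma> x) * bary e l (vertex_map e \<sigma> x) \<partial>lborel)"
      by (rule integral_distr) (auto intro!: borel_measurable_continuous_onI continuous_vertex_map meas)
    also have "\<dots> = ?I k"
    proof -
      have "\<sigma> k = l" by (simp add: \<sigma>_def)
      then show ?thesis using bary_vertex_map[OF e \<sigma> k] by (simp add: indicator_def vertex_map_hull[OF e \<sigma>])
    qed
    finally show ?thesis .
  qed
  have "card e * ?I k = (\<Sum>l\<in>e. ?I l)" using eq by simp
  also have "\<dots> = (\<integral>x. (\<Sum>l\<in>e. indicator (convex hull e) x * bary e l x) \<partial>lborel)"
    by (rule Bochner_Integration.integral_sum[symmetric]) (intro integrable_simplex e continuous_intros)
  also have "\<dots> = (\<integral>x. indicator (convex hull e) x \<partial>lborel)"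
    by (simp add: sum_distrib_left[symmetric] sum_bary[OF e])
  also have "\<dots> = measure lebesgue (convex hull e)"
    using compact_simplex[OF e] by (simp add: measure_completion borel_closed compact_imp_closed)
  finally show ?thesis using e by (simp add: is_simplex_def field_simps)
qed

lemma integral_affine_simplex:
  fixes f :: "real^'d \<Rightarrow> real"
  assumes e: "is_simplex e" and f: "\<And>x. f x = c + g \<bullet> x"
  shows "(\<integral>x. indicator (convex hull e) x * f x \<partial>lborel) = measure lebesgue (convex hull e) / card e * (\<Sum>l\<in>e. f l)"
proof -
  have "indicator (convex hull e) x * f x = (\<Sum>l\<in>e. f l * (indicator (convex hull e) x * bary e l x))" for x
    using bary_unique[where f=f, OF e f, of x] by (simp add: sum_distrib_left algebra_simps)
  then have "(\<integral>x. indicator (convex hull e) x * f x \<partial>lborel)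
     = (\<Sum>l\<in>e. (\<integral>x. f l * (indicator (convex hull e) x * bary e l x) \<partial>lborel))"
    by (simp only:) (intro Bochner_Integration.integral_sum integrable_mult_right integrable_simplex e continuous_intros)
  also have "\<dots> = (\<Sum>l\<in>e. f l * (measure lebesgue (convex hull e) / card e))"
    using e by (intro sum.cong refl) (simp add: integral_bary)
  finally show ?thesis by (simp add: sum_distrib_left sum_distrib_right sum_divide_distrib mult.commute)
qed

section \<open>Decomposition of a simplex into cones over its interface pieces\<close>

text \<open>
  The points where \<open>k\<close> carries the largest coordinate and \<open>l\<close> the second
  largest.
\<close>

definition wedge :: "(real^'d) set \<Rightarrow> real^'d \<Rightarrow> real^'d \<Rightarrow> (real^'d) set" where
  "wedge e k l = {x. (\<forall>m\<in>e. 0 \<le> bary e m x) \<and> bary e l x \<le> bary e k x \<and> (\<forall>m\<in>e - {k}. bary e m x \<le> bary e l x)}"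

text \<open>
  The part of the control volume of \<open>k\<close> that lies in the simplex \<open>e\<close>.
\<close>

definition dominant :: "(real^'d) set \<Rightarrow> real^'d \<Rightarrow> (real^'d) set" where
  "dominant e k = {x. \<forall>m\<in>e. 0 \<le> bary e m x \<and> bary e m x \<le> bary e k x}"

text \<open>
  The part in \<open>e\<close> of the interface between the control volumes of \<open>j\<close>
  and \<open>k\<close>.
\<close>

definition ridge :: "(real^'d) set \<Rightarrow> real^'d \<Rightarrow> real^'d \<Rightarrow> (real^'d) set" where
  "ridge e j k = {x. (\<forall>m\<in>e. 0 \<le> bary e m x \<and> bary e m x \<le> bary e j x) \<and> bary e j x = bary e k x}"

lemma bary_grad_diff:
  assumes "is_simplex e" "a \<in> e" "b \<in> e" "a \<noteq> b"
  shows "(bary_grad e a - bary_grad e b) \<bullet> (a - b) = 2"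
  using bary_grad_edge[of e a b] bary_grad_edge[of e b a] assms
  by (simp add: inner_diff_left inner_diff_right)

lemma negligible_bary_eq:
  assumes "is_simplex e" "a \<in> e" "b \<in> e" "a \<noteq> b"
  shows "negligible {x. bary e a x = bary e b x}"
proof -
  have "{x. bary e a x = bary e b x} = {x. (bary_grad e a - bary_grad e b) \<bullet> x = bary_grad e a \<bullet> a - bary_grad e b \<bullet> b}"
    by (auto simp: bary_def inner_diff_left inner_diff_right)
  moreover have "bary_grad e a - bary_grad e b \<noteq> 0"
    using bary_grad_diff[OF assms] by auto
  ultimately show ?thesis by (simp add: negligible_hyperplane)
qed

lemma closed_bary_conditions:
  "closed {x. bary e a x \<le> bary e b x}" "closed {x. 0 \<le> bary e a x}" "closed {x. bary e a x = bary e b x}"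
  by (intro closed_Collect_le closed_Collect_eq continuous_intros)+

lemma compact_wedge:
  assumes e: "is_simplex e"
  shows "compact (wedge e k l)"
proof -
  have "wedge e k l = convex hull e \<inter> ({x. bary e l x \<le> bary e k x} \<inter> (\<Inter>m\<in>e - {k}. {x. bary e m x \<le> bary e l x}))"
    unfolding simplex_hull[OF e] wedge_def by blast
  also have "compact \<dots>"
    by (intro compact_Int_closed compact_simplex e closed_Int closed_INT ballI closed_bary_conditions)
  finally show ?thesis .
qed

lemma compact_dominant:
  assumes e: "is_simplex e"
  shows "compact (dominant e k)"
proof -
  have "dominant e k = convex hull e \<inter> (\<Inter>m\<in>e. {x. bary e m x \<le> bary e k x})"
    unfolding simplex_hull[OF e] dominant_def by blast
  also have "compact \<dots>"
    by (intro compact_Int_closed compact_simplex e closed_INT ballI closed_bary_conditions)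
  finally show ?thesis .
qed

lemma compact_ridge:
  assumes e: "is_simplex e"
  shows "compact (ridge e j k)"
proof -
  have "ridge e j k = dominant e j \<inter> {x. bary e j x = bary e k x}"
    unfolding ridge_def dominant_def by blast
  also have "compact \<dots>"
    by (intro compact_Int_closed compact_dominant e closed_bary_conditions)
  finally show ?thesis .
qed

lemma convex_ridge: "convex (ridge e j k)"
proof (rule convexI)
  fix x y :: "real^'a" and u v :: real
  assume x: "x \<in> ridge e j k" and y: "y \<in> ridge e j k" and uv: "0 \<le> u" "0 \<le> v" "u + v = 1"
  have b: "bary e m (u *\<^sub>R x + v *\<^sub>R y) = u * bary e m x + v * bary e m y" for m
  proof -
    have u: "u = 1 - v" using uv(3) by simp
    show ?thesis unfolding u by (rule bary_line)
  qed
  have "bary e j (u *\<^sub>R x + v *\<^sub>R y) = bary e k (u *\<^sub>R x + v *\<^sub>R y)"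
    using x y by (simp add: b ridge_def)
  moreover have "0 \<le> bary e m (u *\<^sub>R x + v *\<^sub>R y)" if "m \<in> e" for m
    unfolding b using that x y uv by (intro add_nonneg_nonneg mult_nonneg_nonneg) (auto simp: ridge_def)
  moreover have "bary e m (u *\<^sub>R x + v *\<^sub>R y) \<le> bary e j (u *\<^sub>R x + v *\<^sub>R y)" if "m \<in> e" for m
    unfolding b using that x y uv by (intro add_mono mult_left_mono) (auto simp: ridge_def)
  ultimately show "u *\<^sub>R x + v *\<^sub>R y \<in> ridge e j k"
    unfolding ridge_def by blast
qed

lemma equal_summand_eq_sum_div_card:
  assumes "finite I" "i \<in> I" "\<And>a b. a \<in> I \<Longrightarrow> b \<in> I \<Longrightarrow> f a = (f b :: real)" "(\<Sum>a\<in>I. f a) = t"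
  shows "f i = t / card I"
proof -
  have "(\<Sum>a\<in>I. f a) = (\<Sum>a\<in>I. f i)" by (intro sum.cong refl assms(3) assms(2))
  moreover have "card I \<noteq> 0" using assms(1,2) by auto
  ultimately show ?thesis using assms(4) by (simp add: field_simps)
qed

lemma wedge_vertex_map:
  assumes e: "is_simplex e" and \<sigma>: "bij_betw \<sigma> e e" and kl: "k \<in> e" "l \<in> e"
  shows "vertex_map e \<sigma> x \<in> wedge e (\<sigma> k) (\<sigma> l) \<longleftrightarrow> x \<in> wedge e k l"
proof -
  have im': "\<sigma> ` (e - {k}) = e - {\<sigma> k}"
    using \<sigma> kl by (auto simp: bij_betw_def inj_on_def)
  have 1: "(\<forall>m\<in>e. 0 \<le> bary e m (vertex_map e \<sigma> x)) \<longleftrightarrow> (\<forall>m\<in>e. 0 \<le> bary e m x)"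
    using vertex_map_hull[OF e \<sigma>, of x] by (simp add: simplex_hull[OF e])
  have "(\<forall>m\<in>e - {\<sigma> k}. bary e m (vertex_map e \<sigma> x) \<le> bary e l x) \<longleftrightarrow> (\<forall>m\<in>e - {k}. bary e m x \<le> bary e l x)"
    unfolding im'[symmetric] using bary_vertex_map[OF e \<sigma>] by simp
  then show ?thesis unfolding wedge_def by (simp add: 1 bary_vertex_map[OF e \<sigma>] kl)
qed

lemma ex_permutation_of_pair:
  assumes "a \<in> e" "b \<in> e" "a \<noteq> b" "c \<in> e" "d \<in> e" "c \<noteq> d"
  shows "\<exists>\<sigma>. bij_betw \<sigma> e e \<and> \<sigma> a = c \<and> \<sigma> b = d"
proof -
  define t where "t = Transposition.transpose a c"
  define \<sigma> where "\<sigma> = Transposition.transpose (t b) d \<circ> t"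
  have tr: "bij_betw (Transposition.transpose p q) e e" if "p \<in> e" "q \<in> e" for p q
    using that by (auto simp: bij_betw_def Transposition.transpose_def inj_on_def image_iff split: if_splits)
  have tb: "t b \<in> e" "t b \<noteq> c" using assms by (auto simp: t_def Transposition.transpose_def)
  have "bij_betw \<sigma> e e" unfolding \<sigma>_def t_def
    by (rule bij_betw_trans[OF tr tr]) (use assms tb t_def in auto)
  moreover have "\<sigma> a = c" "\<sigma> b = d"
    using assms tb by (auto simp: \<sigma>_def t_def Transposition.transpose_def)
  ultimately show ?thesis by blast
qed

lemma measure_wedge_eq:
  assumes e: "is_simplex e" and "a \<in> e" "b \<in> e" "a \<noteq> b" "c \<in> e" "d \<in> e" "c \<noteq> d"
  shows "measure lebesgue (wedge e c d) = measure lebesgue (wedge e a b)"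
proof -
  obtain \<sigma> where \<sigma>: "bij_betw \<sigma> e e" "\<sigma> a = c" "\<sigma> b = d"
    using ex_permutation_of_pair assms by metis
  have "vertex_map e \<sigma> ` wedge e a b = wedge e c d"
  proof -
    have "x \<in> vertex_map e \<sigma> ` wedge e a b" if "x \<in> wedge e c d" for x
      using that vertex_map_inverse'[OF e \<sigma>(1), of x] wedge_vertex_map[OF e \<sigma>(1), of a b] assms \<sigma>
      by (metis imageI)
    then show ?thesis using wedge_vertex_map[OF e \<sigma>(1), of a b] assms \<sigma> by auto
  qed
  then show ?thesis
    using measure_vertex_map[OF e \<sigma>(1), of "wedge e a b"] compact_wedge[OF e, of a b]
    by (simp add: borel_closed compact_imp_closed compact_imp_bounded)
qed

lemma simplex_other_vertex:
  fixes e :: "(real^'d) set"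
  assumes "is_simplex e"
  shows "e - {k} \<noteq> {}"
proof
  assume "e - {k} = {}"
  then have "e \<subseteq> {k}" by blast
  then have "card e \<le> 1" using card_mono[of "{k}" e] by simp
  then show False using assms by (simp add: is_simplex_def)
qed

lemma dominant_eq_Union_wedge:
  assumes e: "is_simplex e" and k: "k \<in> e"
  shows "dominant e k = (\<Union>l\<in>e - {k}. wedge e k l)"
proof (intro equalityI subsetI)
  fix x assume x: "x \<in> dominant e k"
  obtain l where l: "l \<in> e - {k}" "\<And>m. m \<in> e - {k} \<Longrightarrow> bary e m x \<le> bary e l x"
  proof -
    have f: "finite ((\<lambda>m. bary e m x) ` (e - {k}))" "(\<lambda>m. bary e m x) ` (e - {k}) \<noteq> {}"
      using e simplex_other_vertex[OF e] by (auto simp: simplex_finite)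
    from Max_in[OF f] obtain l where "l \<in> e - {k}" "Max ((\<lambda>m. bary e m x) ` (e - {k})) = bary e l x" by auto
    then show ?thesis using that[of l] Max_ge[OF f(1)] by auto
  qed
  then show "x \<in> (\<Union>l\<in>e - {k}. wedge e k l)"
    using x by (auto simp: dominant_def wedge_def intro!: bexI[of _ l])
next
  fix x assume "x \<in> (\<Union>l\<in>e - {k}. wedge e k l)"
  then obtain l where "l \<in> e - {k}" "x \<in> wedge e k l" by blast
  then show "x \<in> dominant e k"
    unfolding dominant_def wedge_def using k by (auto intro: order_trans)
qed

lemma negligible_wedge_Int:
  assumes e: "is_simplex e" and "k \<in> e" "l \<in> e" "k \<noteq> l" "k' \<in> e" "l' \<in> e" "k' \<noteq> l'" "(k, l) \<noteq> (k', l')"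
  shows "negligible (wedge e k l \<inter> wedge e k' l')"
proof (cases "k = k'")
  case True
  then have "wedge e k l \<inter> wedge e k' l' \<subseteq> {x. bary e l x = bary e l' x}"
    using assms by (auto simp: wedge_def intro: antisym)
  then show ?thesis using True assms by (metis negligible_bary_eq negligible_subset)
next
  case False
  have le: "bary e m x \<le> bary e a x" if "x \<in> wedge e a b" "m \<in> e" for a b m x
    using that by (cases "m = a") (auto simp: wedge_def intro: order_trans)
  have "wedge e k l \<inter> wedge e k' l' \<subseteq> {x. bary e k x = bary e k' x}"
    using assms le by (auto intro!: antisym)
  then show ?thesis using False assms by (metis negligible_bary_eq negligible_subset)
qed

text \<open>
  The wedges of the ordered pairs of distinct vertices tile the simplex, and permutations of the
  vertices act transitively on them; there are \<open>d (d + 1)\<close> such pairs.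
\<close>

lemma measure_wedge:
  fixes e :: "(real^'d) set"
  assumes e: "is_simplex e" and kl: "k \<in> e" "l \<in> e" "k \<noteq> l"
  shows "measure lebesgue (wedge e k l) = measure lebesgue (convex hull e) / (real CARD('d) * (real CARD('d) + 1))"
proof -
  define I where "I = (SIGMA k:e. e - {k})"
  have fI: "finite I" using simplex_finite[OF e] by (simp add: I_def)
  have cI: "card I = (CARD('d) + 1) * CARD('d)"
  proof -
    have "card I = (\<Sum>k\<in>e. card (e - {k}))"
      unfolding I_def using simplex_finite[OF e] by (intro card_SigmaI) auto
    also have "\<dots> = (\<Sum>k\<in>e. CARD('d))" using e by (intro sum.cong) (auto simp: is_simplex_def)
    finally show ?thesis using e by (simp add: is_simplex_def)
  qed
  have un: "convex hull e = (\<Union>(k,l)\<in>I. wedge e k l)"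
  proof -
    have "convex hull e = (\<Union>k\<in>e. dominant e k)"
    proof (intro equalityI subsetI)
      fix x assume x: "x \<in> convex hull e"
      have f: "finite ((\<lambda>m. bary e m x) ` e)" "(\<lambda>m. bary e m x) ` e \<noteq> {}"
        using e simplex_nonempty[OF e] by (auto simp: simplex_finite)
      from Max_in[OF f] obtain k where "k \<in> e" "Max ((\<lambda>m. bary e m x) ` e) = bary e k x" by auto
      then show "x \<in> (\<Union>k\<in>e. dominant e k)"
        using x Max_ge[OF f(1)] by (auto simp: simplex_hull[OF e] dominant_def)
    next
      fix x assume "x \<in> (\<Union>k\<in>e. dominant e k)"
      then show "x \<in> convex hull e" by (auto simp: simplex_hull[OF e] dominant_def)
    qed
    also have "\<dots> = (\<Union>(k,l)\<in>I. wedge e k l)"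
      using dominant_eq_Union_wedge[OF e] by (auto simp: I_def)
    finally show ?thesis .
  qed
  define \<mu> where "\<mu> p = measure lebesgue (wedge e (fst p) (snd p))" for p
  have "(\<Sum>p\<in>I. \<mu> p) = measure lebesgue (convex hull e)"
    unfolding un \<mu>_def
  proof (subst measure_negligible_finite_Union_image[symmetric])
    show "pairwise (\<lambda>x y. negligible (wedge e (fst x) (snd x) \<inter> wedge e (fst y) (snd y))) I"
      proof (rule pairwiseI)
      fix p q assume "p \<in> I" "q \<in> I" "p \<noteq> q"
      then show "negligible (wedge e (fst p) (snd p) \<inter> wedge e (fst q) (snd q))"
        by (intro negligible_wedge_Int e) (auto simp: I_def prod_eq_iff)
    qed
  qed (auto simp: fI split_def intro: lmeasurable_compact compact_wedge e)
  moreover have "\<And>p q. p \<in> I \<Longrightarrow> q \<in> I \<Longrightarrow> \<mu> p = \<mu> q"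
    unfolding \<mu>_def by (intro measure_wedge_eq e) (auto simp: I_def)
  moreover have "(k, l) \<in> I" using kl by (auto simp: I_def)
  ultimately have "\<mu> (k, l) = measure lebesgue (convex hull e) / card I"
    using equal_summand_eq_sum_div_card[OF fI, of "(k, l)" \<mu>] by blast
  then show ?thesis by (simp add: \<mu>_def cI algebra_simps)
qed

lemma measure_dominant:
  fixes e :: "(real^'d) set"
  assumes e: "is_simplex e" and k: "k \<in> e"
  shows "measure lebesgue (dominant e k) = measure lebesgue (convex hull e) / (real CARD('d) + 1)"
proof -
  have "measure lebesgue (dominant e k) = (\<Sum>l\<in>e - {k}. measure lebesgue (wedge e k l))"
    unfolding dominant_eq_Union_wedge[OF e k]
    by (rule measure_negligible_finite_Union_image)
      (use e k in \<open>auto simp: simplex_finite pairwise_def intro!: lmeasurable_compact compact_wedge negligible_wedge_Int\<close>)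
  also have "\<dots> = (\<Sum>l\<in>e - {k}. measure lebesgue (convex hull e) / (real CARD('d) * (real CARD('d) + 1)))"
    by (intro sum.cong refl measure_wedge e k) auto
  also have "\<dots> = measure lebesgue (convex hull e) / (real CARD('d) + 1)"
    using e k by (simp add: is_simplex_def)
  finally show ?thesis .
qed

lemma prism_translate: "prism v ((+) a ` S) = (+) a ` prism v S"
  unfolding prism_def by (auto simp: image_iff add.assoc) (metis add.assoc)+

lemma bary_midpoint:
  assumes e: "is_simplex e" and jk: "j \<in> e" "k \<in> e" "j \<noteq> k" and "m \<in> e"
  shows "bary e m ((1/2) *\<^sub>R (j + k)) = (if m = j \<or> m = k then 1/2 else 0)"
  using bary_line[of e m "1/2" j k] bary_vertex[OF e \<open>m \<in> e\<close> jk(1)] bary_vertex[OF e \<open>m \<in> e\<close> jk(2)] jk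
  by (auto simp: scaleR_add_right)

lemma midpoint_in_ridge:
  assumes "is_simplex e" "j \<in> e" "k \<in> e" "j \<noteq> k"
  shows "(1/2) *\<^sub>R (j + k) \<in> ridge e j k"
  unfolding ridge_def using assms by (auto simp: bary_midpoint)

text \<open>
  Lowering the largest coordinate \<open>k\<close> towards the second largest \<open>j\<close>,
  along the ray from \<open>k\<close>, ends where the two agree. So the wedge is the cone with
  apex \<open>k\<close> over the interface piece.
\<close>

lemma wedge_eq_cone:
  assumes e: "is_simplex e" and jk: "j \<in> e" "k \<in> e" "j \<noteq> k"
  shows "wedge e k j = (+) k ` cone_from_origin ((+) (- k) ` ridge e j k)"
proof (intro equalityI subsetI)
  fix x assume x: "x \<in> wedge e k j"
  \<comment> \<open>Scaling from \<open>k\<close> by \<open>1 / s\<close> is what equalizes the coordinates of \<open>j\<close> and \<open>k\<close>.\<close>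
  define s where "s = 1 - bary e k x + bary e j x"
  have nn: "0 \<le> bary e m x" if "m \<in> e" for m using x that by (auto simp: wedge_def)
  have ord: "bary e j x \<le> bary e k x" "\<And>m. m \<in> e - {k} \<Longrightarrow> bary e m x \<le> bary e j x"
    using x by (auto simp: wedge_def)
  have total: "(\<Sum>m\<in>e - {k}. bary e m x) + bary e k x = 1"
    using sum_bary[OF e, of x] jk simplex_finite[OF e] by (simp add: sum.remove[of e k])
  have part: "0 \<le> (\<Sum>m\<in>e - {k}. bary e m x)" using nn by (intro sum_nonneg) auto
  have s01: "0 \<le> s" "s \<le> 1" using total part nn[of j] ord jk by (auto simp: s_def)
  show "x \<in> (+) k ` cone_from_origin ((+) (- k) ` ridge e j k)"
  proof (cases "s = 0")
    case True
    then have z: "bary e k x = 1" "(\<Sum>m\<in>e - {k}. bary e m x) = 0"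
      using total part nn[of j] jk by (auto simp: s_def)
    then have "\<forall>m\<in>e - {k}. bary e m x = 0"
      using nn simplex_finite[OF e] by (subst (asm) sum_nonneg_eq_0_iff) auto
    then have "bary e m x *\<^sub>R m = (if m = k then k else 0)" if "m \<in> e" for m
      using z that by auto
    then have "(\<Sum>m\<in>e. bary e m x *\<^sub>R m) = (\<Sum>m\<in>e. if m = k then k else 0)"
      by (rule sum.cong[OF refl])
    then have "x = k" using sum_bary_scaleR[OF e, of x] jk simplex_finite[OF e] by simp
    moreover have "0 \<in> cone_from_origin ((+) (- k) ` ridge e j k)"
      unfolding cone_from_origin_def using midpoint_in_ridge[OF e jk]
      by (intro CollectI exI[of _ 0] exI[of _ "- k + (1/2) *\<^sub>R (j + k)"]) auto
    ultimately show ?thesis by (auto simp: image_iff intro!: bexI[of _ 0])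
  next
    case False
    define y where "y = k + (1 / s) *\<^sub>R (x - k)"
    have sp: "s > 0" using False s01 by simp
    have bary_y: "bary e m y = (if m = k then (bary e k x - 1 + s) / s else bary e m x / s)" if "m \<in> e" for m
    proof -
      have "y = (1 - 1 / s) *\<^sub>R k + (1 / s) *\<^sub>R x" by (simp add: y_def algebra_simps)
      then have "bary e m y = (1 - 1 / s) * bary e m k + (1 / s) * bary e m x" by (simp only: bary_line)
      then show ?thesis
        using bary_vertex[OF e that jk(2)] sp by (auto simp: field_simps)
    qed
    have "bary e k x - 1 + s = bary e j x" by (simp add: s_def)
    then have "y \<in> ridge e j k"
      unfolding ridge_def using nn ord sp jk by (auto simp: bary_y divide_right_mono)
    moreover have "x = k + s *\<^sub>R (- k + y)" using sp by (simp add: y_def)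
    ultimately show ?thesis
      unfolding cone_from_origin_def using s01
      by (intro image_eqI[of _ _ "s *\<^sub>R (- k + y)"] CollectI exI[of _ s] exI[of _ "- k + y"]) auto
  qed
next
  fix x assume "x \<in> (+) k ` cone_from_origin ((+) (- k) ` ridge e j k)"
  then obtain s y where y: "y \<in> ridge e j k" "0 \<le> s" "s \<le> 1" and x: "x = (1 - s) *\<^sub>R k + s *\<^sub>R y"
    by (auto simp: cone_from_origin_def algebra_simps)
  have b: "bary e m x = (1 - s) * (if m = k then 1 else 0) + s * bary e m y" if "m \<in> e" for m
    unfolding x bary_line using bary_vertex[OF e that jk(2)] by auto
  show "x \<in> wedge e k j"
    using y jk unfolding wedge_def ridge_def by (auto simp: b intro: mult_left_mono)
qed

lemma ridge_hyperplane:
  assumes e: "is_simplex e" and jk: "j \<in> e" "k \<in> e" "j \<noteq> k" and x: "bary e j x = bary e k x"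
  shows "(bary_grad e k - bary_grad e j) \<bullet> (x - k) = - 1"
proof -
  have "bary_grad e j \<bullet> (k - j) = - 1" using bary_grad_edge[OF e jk(1,2)] jk by simp
  then show ?thesis using x by (simp add: bary_def inner_diff_left inner_diff_right)
qed

text \<open>
  The area vector of an interface piece. Its area follows from the volume of the cone over it with
  apex \<open>k\<close>, which is a wedge of known volume. With respect to the midpoint of the
  edge, the apex has height \<open>1 / norm G\<close>, so the length of \<open>G\<close> enters
  the area and the product with the unit normal is proportional to \<open>G\<close>.
\<close>

lemma measure_prism_ridge:
  fixes e :: "(real^'d) set"
  assumes e: "is_simplex e" and jk: "j \<in> e" "k \<in> e" "j \<noteq> k"
  defines "G \<equiv> bary_grad e k - bary_grad e j"
  shows "measure lebesgue (prism (G /\<^sub>R norm G) (ridge e j k)) *\<^sub>R (G /\<^sub>R norm G)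
       = (measure lebesgue (convex hull e) / (real CARD('d) + 1)) *\<^sub>R G"
proof -
  define \<nu> where "\<nu> = G /\<^sub>R norm G"
  define S where "S = (+) (- k) ` ridge e j k"
  define s0 where "s0 = - k + (1/2) *\<^sub>R (j + k)"
  have G2: "G \<bullet> (k - j) = 2" unfolding G_def using bary_grad_diff[OF e jk(2,1)] jk by simp
  then have nG: "norm G > 0" by auto
  have \<nu>: "norm \<nu> = 1" using nG by (simp add: \<nu>_def)
  have hyp: "\<nu> \<bullet> x = - 1 / norm G" if x: "x \<in> S" for x
  proof -
    obtain y where "y \<in> ridge e j k" "x = - k + y" using x unfolding S_def by blast
    then have "G \<bullet> x = - 1" using ridge_hyperplane[OF e jk, of y] by (simp add: G_def ridge_def)
    then show ?thesis by (simp add: \<nu>_def inverse_eq_divide)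
  qed
  have cS: "compact S" unfolding S_def by (intro compact_translation compact_ridge e)
  have convS: "convex S" unfolding S_def by (intro convex_translation convex_ridge)
  have s0: "s0 \<in> S" unfolding S_def s0_def using midpoint_in_ridge[OF e jk] by blast
  have s0': "- s0 = (1/2) *\<^sub>R (k - j)"
    by (simp add: s0_def vec_eq_iff field_simps)
  have "measure lebesgue (wedge e k j) = measure lebesgue (cone_from_origin S)"
    unfolding wedge_eq_cone[OF e jk] measure_translation S_def ..
  then have "measure lebesgue (cone_from_origin S) = measure lebesgue (convex hull e) / (real CARD('d) * (real CARD('d) + 1))"
    using measure_wedge[OF e jk(2,1)] jk by simp
  then have "measure lebesgue (convex hull e) / (real CARD('d) + 1) = real CARD('d) * measure lebesgue (cone_from_origin S)"
    by simp
  also have "\<dots> = measure lebesgue (prism (- s0) S)"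
    using nG by (intro measure_cone_from_origin[OF \<nu> hyp cS convS _ s0]) auto
  also have "\<dots> = \<bar>\<nu> \<bullet> - s0\<bar> * measure lebesgue (prism \<nu> S)"
    by (rule measure_prism[OF \<nu> hyp cS])
  also have "\<nu> \<bullet> - s0 = 1 / norm G"
    unfolding s0' \<nu>_def using G2 by (simp add: inverse_eq_divide del: scaleR_right_diff_distrib)
  also have "measure lebesgue (prism \<nu> S) = measure lebesgue (prism \<nu> (ridge e j k))"
    unfolding S_def prism_translate by (rule measure_translation)
  finally have "measure lebesgue (convex hull e) / (real CARD('d) + 1)
     = measure lebesgue (prism \<nu> (ridge e j k)) / norm G"
    by simp
  then show ?thesis using nG unfolding \<nu>_def[symmetric] by (simp add: \<nu>_def field_simps)
qed

section \<open>Control volumes and interfaces in the mesh\<close>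

lemma bary_grad_edge_diff:
  assumes e: "is_simplex e" and "m \<in> e" "a \<in> e" "b \<in> e"
  shows "bary_grad e m \<bullet> (a - b) = (if m = a then 1 else 0) - (if m = b then 1 else 0)"
  using bary_add[of e m b "a - b"] bary_vertex[OF e \<open>m \<in> e\<close> \<open>a \<in> e\<close>] bary_vertex[OF e \<open>m \<in> e\<close> \<open>b \<in> e\<close>]
  by auto

lemma open_line_segment:
  fixes x w :: "real^'d"
  assumes "open U" "x \<in> U"
  shows "\<exists>\<delta>>0. \<forall>t. \<bar>t\<bar> < \<delta> \<longrightarrow> x + t *\<^sub>R w \<in> U"
proof -
  obtain \<epsilon> where \<epsilon>: "\<epsilon> > 0" "ball x \<epsilon> \<subseteq> U" using assms open_contains_ball by blast
  have "x + t *\<^sub>R w \<in> U" if t: "\<bar>t\<bar> < \<epsilon> / (norm w + 1)" for t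
  proof -
    have "norm w + 1 > 0" by (simp add: add_nonneg_pos)
    then have "\<bar>t\<bar> * (norm w + 1) < \<epsilon>" using t by (simp add: pos_less_divide_eq)
    moreover have "\<bar>t\<bar> * norm w \<le> \<bar>t\<bar> * (norm w + 1)" by (intro mult_left_mono) auto
    ultimately have "x + t *\<^sub>R w \<in> ball x \<epsilon>" by (simp add: dist_norm)
    then show ?thesis using \<epsilon> by blast
  qed
  moreover have "\<epsilon> / (norm w + 1) > 0" using \<epsilon> by (simp add: add_nonneg_pos)
  ultimately show ?thesis by blast
qed

lemma dominant_pos:
  assumes e: "is_simplex e" and j: "j \<in> e" and x: "x \<in> dominant e j"
  shows "0 < bary e j x"
proof (rule ccontr)
  assume "\<not> 0 < bary e j x"
  then have "bary e m x = 0" if "m \<in> e" for m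
    using x that j by (force simp: dominant_def intro: antisym)
  then show False using sum_bary[OF e, of x] by simp
qed

lemma bary_le_1:
  assumes e: "is_simplex e" and "\<And>m. m \<in> e \<Longrightarrow> 0 \<le> bary e m x" "l \<in> e"
  shows "bary e l x \<le> 1"
  using member_le_sum[of l e "\<lambda>m. bary e m x"] assms sum_bary[OF e, of x] simplex_finite[OF e] by auto

lemma dominant_eq:
  assumes e: "is_simplex e" and j: "j \<in> e"
  shows "{(\<Sum>l\<in>e. \<alpha> l *\<^sub>R l) | \<alpha> :: real^'d \<Rightarrow> real.
        (\<forall>l\<in>e. \<alpha> l \<in> {0..1}) \<and> (\<Sum>l\<in>e. \<alpha> l) = 1 \<and> \<alpha> j = Max (\<alpha> ` e)} = dominant e j"
proof (intro equalityI subsetI)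
  fix x :: "real^'d" assume "x \<in> {(\<Sum>l\<in>e. \<alpha> l *\<^sub>R l) | \<alpha> :: real^'d \<Rightarrow> real.
        (\<forall>l\<in>e. \<alpha> l \<in> {0..1}) \<and> (\<Sum>l\<in>e. \<alpha> l) = 1 \<and> \<alpha> j = Max (\<alpha> ` e)}"
  then obtain \<alpha> where \<alpha>: "x = (\<Sum>l\<in>e. \<alpha> l *\<^sub>R l)" "\<forall>l\<in>e. \<alpha> l \<in> {0..1}" "(\<Sum>l\<in>e. \<alpha> l) = 1" "\<alpha> j = Max (\<alpha> ` e)"
    by blast
  have "\<alpha> l \<le> \<alpha> j" if "l \<in> e" for l using \<alpha>(4) that simplex_finite[OF e] by simp
  then show "x \<in> dominant e j"
    using \<alpha>(2) bary_combination[OF e \<alpha>(3)] j unfolding dominant_def \<alpha>(1) by auto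
next
  fix x assume x: "x \<in> dominant e j"
  have "bary e j x = Max ((\<lambda>l. bary e l x) ` e)"
    using x j simplex_finite[OF e] by (intro Max_eqI[symmetric]) (auto simp: dominant_def)
  moreover have "\<forall>l\<in>e. bary e l x \<in> {0..1}"
    using x bary_le_1[OF e, of x] by (auto simp: dominant_def)
  ultimately show "x \<in> {(\<Sum>l\<in>e. \<alpha> l *\<^sub>R l) | \<alpha> :: real^'d \<Rightarrow> real.
        (\<forall>l\<in>e. \<alpha> l \<in> {0..1}) \<and> (\<Sum>l\<in>e. \<alpha> l) = 1 \<and> \<alpha> j = Max (\<alpha> ` e)}"
    using sum_bary[OF e, of x] sum_bary_scaleR[OF e, of x]
    by (intro CollectI exI[of _ "\<lambda>l. bary e l x"]) auto
qed

locale periodic_mesh =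
  fixes M :: "(real^'d) set set"
  assumes periodic: "periodic_simplicial_mesh M"
begin

lemma simplex: "e \<in> M \<Longrightarrow> is_simplex e"
  using periodic by (simp add: periodic_simplicial_mesh_def is_simplex_def)

lemma conforming: "e \<in> M \<Longrightarrow> e' \<in> M \<Longrightarrow> convex hull e \<inter> convex hull e' = convex hull (e \<inter> e')"
  using periodic by (simp add: periodic_simplicial_mesh_def)

lemma covering: "\<exists>e\<in>M. x \<in> convex hull e"
  using periodic by (auto simp: periodic_simplicial_mesh_def)

lemma finite_star: "finite {e \<in> M. j \<in> e}"
proof (cases "j \<in> nodes M")
  case True
  then show ?thesis using periodic by (simp add: periodic_simplicial_mesh_def)
next
  case False
  then have "{e \<in> M. j \<in> e} = {}" by (auto simp: nodes_def)
  then show ?thesis by (simp only: finite.emptyI)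
qed

text \<open>
  Conformity makes the barycentric coordinates of a common point independent of the simplex: the
  point lies in the hull of the common vertices, and the coordinates are unique.
\<close>

lemma bary_common:
  assumes e: "e \<in> M" "e' \<in> M" and x: "x \<in> convex hull e" "x \<in> convex hull e'" and l: "l \<in> e"
  shows "bary e l x = (if l \<in> e' then bary e' l x else 0)"
proof -
  have fin: "finite (e \<inter> e')" using simplex_finite simplex e by blast
  obtain u where u: "sum u (e \<inter> e') = 1" "(\<Sum>l\<in>e \<inter> e'. u l *\<^sub>R l) = x"
    using conforming[OF e] x convex_hull_finite[OF fin] by blast
  define v where "v l = (if l \<in> e \<inter> e' then u l else 0)" for l
  have "bary e'' l x = v l" if e'': "e'' \<in> M" "e \<inter> e' \<subseteq> e''" and l: "l \<in> e''" for e'' l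
  proof -
    have f: "finite e''" using simplex_finite simplex e'' by blast
    have "sum v e'' = sum v (e \<inter> e')" "(\<Sum>l\<in>e''. v l *\<^sub>R l) = (\<Sum>l\<in>e \<inter> e'. v l *\<^sub>R l)"
      by (rule sum.mono_neutral_right[OF f e''(2)]; auto simp: v_def)+
    then have "sum v e'' = 1" "(\<Sum>l\<in>e''. v l *\<^sub>R l) = x"
      using u by (simp_all add: v_def)
    then show ?thesis using bary_combination[OF simplex[OF e''(1)] _ l] by blast
  qed
  then show ?thesis using e l by (auto simp: v_def)
qed

lemma cell_eq: "cell M j = (\<Union>e\<in>{e \<in> M. j \<in> e}. dominant e j)"
  unfolding cell_def using dominant_eq simplex by (intro SUP_cong) auto

text \<open>
  A control volume is defined by all simplexes around \<open>j\<close>, but inside one of them no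
  other simplex contributes, because barycentric coordinates agree on common points.
\<close>

lemma cell_Int_hull:
  assumes e: "e \<in> M" and j: "j \<in> e"
  shows "cell M j \<inter> convex hull e = dominant e j"
proof (intro equalityI subsetI)
  fix x assume "x \<in> dominant e j"
  then show "x \<in> cell M j \<inter> convex hull e"
    using e j simplex_hull[OF simplex[OF e]] by (auto simp: cell_eq) (auto simp: dominant_def)
next
  fix x assume "x \<in> cell M j \<inter> convex hull e"
  then obtain e' where e': "e' \<in> M" "j \<in> e'" "x \<in> dominant e' j" and x: "x \<in> convex hull e"
    by (auto simp: cell_eq)
  have x': "x \<in> convex hull e'"
    using e' simplex_hull[OF simplex[OF e'(1)]] by (auto simp: dominant_def)
  have "bary e m x \<le> bary e j x" if m: "m \<in> e" for m
    using bary_common[OF e e'(1) x x' m] bary_common[OF e e'(1) x x' j] e'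
    by (auto simp: dominant_def)
  then show "x \<in> dominant e j"
    using x by (auto simp: dominant_def simplex_hull[OF simplex[OF e]])
qed

lemma closed_cell: "closed (cell M j)"
  unfolding cell_eq
  by (intro closed_UN finite_star ballI compact_imp_closed compact_dominant simplex) simp

lemma negligible_hull_Int:
  assumes e: "e \<in> M" "e' \<in> M" "e \<noteq> e'"
  shows "negligible (convex hull e \<inter> convex hull e')"
proof -
  have "card e = card e'" "finite e'" using simplex e by (auto simp: is_simplex_def)
  then have "\<not> e \<subseteq> e'" using e card_subset_eq[of e' e] by blast
  then obtain l where l: "l \<in> e" "l \<notin> e'" by blast
  obtain m where m: "m \<in> e" "m \<noteq> l" using simplex_other_vertex[OF simplex[OF e(1)], of l] by blast
  have "bary_grad e l \<noteq> 0" using bary_grad_edge[OF simplex[OF e(1)] l(1) m] by auto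
  then have "negligible {x. bary_grad e l \<bullet> x = bary_grad e l \<bullet> l - 1}"
    by (simp add: negligible_hyperplane)
  moreover have "convex hull e \<inter> convex hull e' \<subseteq> {x. bary_grad e l \<bullet> x = bary_grad e l \<bullet> l - 1}"
  proof
    fix x assume "x \<in> convex hull e \<inter> convex hull e'"
    then have "bary e l x = 0" using bary_common[OF e(1,2) _ _ l(1), of x] l by simp
    then show "x \<in> {x. bary_grad e l \<bullet> x = bary_grad e l \<bullet> l - 1}" by (simp add: bary_def inner_diff_right)
  qed
  ultimately show ?thesis using negligible_subset by blast
qed

lemma dominant_subset_hull: "e \<in> M \<Longrightarrow> dominant e j \<subseteq> convex hull e"
  by (auto simp: dominant_def simplex_hull[OF simplex])

lemma cell_volume_eq: "cell_volume M j = (\<Sum>e\<in>{e \<in> M. j \<in> e}. measure lebesgue (convex hull e) / (real CARD('d) + 1))"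
proof -
  have "cell_volume M j = (\<Sum>e\<in>{e \<in> M. j \<in> e}. measure lebesgue (dominant e j))"
    unfolding cell_volume_def cell_eq
  proof (rule measure_negligible_finite_Union_image[OF finite_star])
    show "pairwise (\<lambda>x y. negligible (dominant x j \<inter> dominant y j)) {e \<in> M. j \<in> e}"
    proof (rule pairwiseI)
      fix e e' assume "e \<in> {e \<in> M. j \<in> e}" "e' \<in> {e \<in> M. j \<in> e}" "e \<noteq> e'"
      then have e: "e \<in> M" "e' \<in> M" "e \<noteq> e'" by auto
      show "negligible (dominant e j \<inter> dominant e' j)"
        by (rule negligible_subset[OF negligible_hull_Int[OF e]]) (intro Int_mono dominant_subset_hull e)
    qed
  qed (auto intro!: lmeasurable_compact compact_dominant simplex)
  also have "\<dots> = (\<Sum>e\<in>{e \<in> M. j \<in> e}. measure lebesgue (convex hull e) / (real CARD('d) + 1))"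
    by (intro sum.cong refl measure_dominant) (auto intro: simplex)
  finally show ?thesis .
qed

lemma cell_volume_pos: "j \<in> nodes M \<Longrightarrow> 0 < cell_volume M j"
  unfolding cell_volume_eq
  by (intro sum_pos finite_star divide_pos_pos measure_simplex_pos) (auto simp: nodes_def intro: simplex)

lemma ridge_subset: "ridge e j k \<subseteq> dominant e j" "k \<in> e \<Longrightarrow> ridge e j k \<subseteq> dominant e k"
  by (auto simp: ridge_def dominant_def)

lemma ridge_sym: "j \<in> e \<Longrightarrow> k \<in> e \<Longrightarrow> ridge e j k = ridge e k j"
  by (auto simp: ridge_def)

text \<open>
  From a point of the interface piece a small step from \<open>j\<close> towards \<open>k\<close>
  stays in the simplex, as the coordinate of \<open>j\<close> is positive, and makes the
  coordinate of \<open>k\<close> strictly larger.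
\<close>

lemma ridge_frontier:
  assumes e: "e \<in> M" and jk: "j \<in> e" "k \<in> e" "j \<noteq> k"
  shows "ridge e j k \<subseteq> frontier (cell M j)"
proof
  fix x assume x: "x \<in> ridge e j k"
  note s = simplex[OF e]
  have xj: "x \<in> dominant e j" using x ridge_subset by blast
  have "x \<notin> interior (cell M j)"
  proof
    assume "x \<in> interior (cell M j)"
    then obtain \<delta> where \<delta>: "\<delta> > 0" "\<And>t. \<bar>t\<bar> < \<delta> \<Longrightarrow> x + t *\<^sub>R (k - j) \<in> interior (cell M j)"
      using open_line_segment[OF open_interior] by blast
    \<comment> \<open>The second bound keeps the coordinate of \<open>j\<close> nonnegative, hence the point in \<open>e\<close>.\<close>
    define t where "t = min (\<delta> / 2) (bary e j x)"
    have t: "0 < t" "t < \<delta>" "t \<le> bary e j x"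
      using \<delta>(1) dominant_pos[OF s jk(1) xj] by (auto simp: t_def)
    define y where "y = x + t *\<^sub>R (k - j)"
    have b: "bary e m y = bary e m x + t * ((if m = k then 1 else 0) - (if m = j then 1 else 0))" if "m \<in> e" for m
      using bary_grad_edge_diff[OF s that jk(2,1)] by (simp add: y_def bary_add)
    have "y \<in> convex hull e"
      using xj t jk by (auto simp: simplex_hull[OF s] b dominant_def)
    moreover have "y \<in> cell M j" using \<delta>(2)[of t] t interior_subset by (auto simp: y_def)
    ultimately have "y \<in> dominant e j" using cell_Int_hull[OF e jk(1)] by blast
    then have "bary e k y \<le> bary e j y" using jk by (auto simp: dominant_def)
    then show False using x t jk by (auto simp: b ridge_def)
  qed
  moreover have "x \<in> cell M j" using xj e jk by (auto simp: cell_eq)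
  ultimately show "x \<in> frontier (cell M j)"
    unfolding frontier_def using closure_subset by blast
qed

lemma interface_piece_eq:
  assumes e: "e \<in> M" and jk: "j \<in> e" "k \<in> e" "j \<noteq> k"
  shows "interface_piece M j k e = ridge e j k"
proof (intro equalityI subsetI)
  fix x assume "x \<in> interface_piece M j k e"
  then have "x \<in> cell M j" "x \<in> cell M k" "x \<in> convex hull e"
    using frontier_subset_closed[OF closed_cell] by (auto simp: interface_piece_def)
  then have "x \<in> dominant e j" "x \<in> dominant e k"
    using cell_Int_hull[OF e] jk by blast+
  then show "x \<in> ridge e j k" using jk by (auto simp: ridge_def dominant_def intro: antisym)
next
  fix x assume x: "x \<in> ridge e j k"
  then have "x \<in> convex hull e" using ridge_subset dominant_subset_hull[OF e] by blast
  then show "x \<in> interface_piece M j k e"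
    using x ridge_frontier[OF e jk] ridge_frontier[OF e jk(2,1)] ridge_sym[OF jk(1,2)] jk
    by (auto simp: interface_piece_def)
qed

text \<open>
  A point of the relative interior can be prolonged slightly beyond itself along a segment from
  any point of the piece. Prolonging from the barycenter shows that a coordinate is not 0, and
  prolonging from the midpoint of the edge shows that it does not reach the maximum.
\<close>

lemma rel_interior_ridge:
  assumes e: "is_simplex e" and jk: "j \<in> e" "k \<in> e" "j \<noteq> k"
    and x: "x \<in> rel_interior (ridge e j k)" and m: "m \<in> e" "m \<noteq> j" "m \<noteq> k"
  shows "0 < bary e m x" "bary e m x < bary e j x"
proof -
  have ne: "ridge e j k \<noteq> {}" using midpoint_in_ridge[OF e jk] by blast
  have ex: "\<exists>\<epsilon>>1. (1 - \<epsilon>) *\<^sub>R z + \<epsilon> *\<^sub>R x \<in> ridge e j k" if "z \<in> ridge e j k" for z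
    using x that unfolding convex_rel_interior_iff[OF convex_ridge ne] by blast
  have card: "card e > 0" using e by (simp add: is_simplex_def)
  have "barycenter e \<in> ridge e j k"
    using jk by (auto simp: ridge_def bary_barycenter[OF e])
  then obtain \<epsilon> where \<epsilon>: "\<epsilon> > 1" "(1 - \<epsilon>) *\<^sub>R barycenter e + \<epsilon> *\<^sub>R x \<in> ridge e j k"
    using ex by blast
  then have "0 \<le> (1 - \<epsilon>) / card e + \<epsilon> * bary e m x"
    using m by (auto simp: ridge_def bary_line bary_barycenter[OF e])
  moreover have "(1 - \<epsilon>) / card e < 0" using \<epsilon> card by (simp add: divide_neg_pos)
  ultimately have "0 < \<epsilon> * bary e m x" by linarith
  then show "0 < bary e m x" using \<epsilon> by (simp add: zero_less_mult_iff)
  obtain \<epsilon> where \<epsilon>: "\<epsilon> > 1" "(1 - \<epsilon>) *\<^sub>R ((1/2) *\<^sub>R (j + k)) + \<epsilon> *\<^sub>R x \<in> ridge e j k"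
    using ex midpoint_in_ridge[OF e jk] by blast
  have "\<epsilon> * bary e m x \<le> (1 - \<epsilon>) * (1/2) + \<epsilon> * bary e j x"
  proof -
    let ?p = "(1 - \<epsilon>) *\<^sub>R ((1/2) *\<^sub>R (j + k)) + \<epsilon> *\<^sub>R x"
    have "bary e m ?p \<le> bary e j ?p" using \<epsilon>(2) m(1) unfolding ridge_def by blast
    then show ?thesis unfolding bary_line using m jk by (simp add: bary_midpoint[OF e jk])
  qed
  moreover have "(1 - \<epsilon>) * (1/2) < 0" using \<epsilon> by simp
  ultimately have "\<epsilon> * bary e m x < \<epsilon> * bary e j x" by linarith
  then show "bary e m x < bary e j x" using \<epsilon>(1) by (simp only: mult_less_cancel_left_pos)
qed

text \<open>
  Points of the relative interior lie in the interior of the simplex, away from all further ties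
  between coordinates. Near such a point the interface piece is the full hyperplane where the two
  coordinates agree, which determines the normal up to sign, and the side where \<open>k\<close>
  wins determines the sign.
\<close>

lemma unit_normal_ridge:
  assumes e: "e \<in> M" and jk: "j \<in> e" "k \<in> e" "j \<noteq> k"
  defines "G \<equiv> bary_grad e k - bary_grad e j"
  shows "unit_normal_into (ridge e j k) (cell M k) = G /\<^sub>R norm G"
proof -
  note s = simplex[OF e]
  define U where "U = {x. \<forall>m\<in>e. 0 < bary e m x} \<inter> (\<Inter>m\<in>e - {j, k}. {x. bary e m x < bary e j x} \<inter> {x. bary e m x < bary e k x})"
  have openU: "open U"
    unfolding U_def using simplex_finite[OF s]
    by (intro open_Int open_INT open_bary_pos s ballI open_Collect_less continuous_intros) auto
  have relU: "x \<in> U" if x: "x \<in> rel_interior (ridge e j k)" for x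
  proof -
    have xr: "x \<in> ridge e j k" using x rel_interior_subset by blast
    then have "x \<in> dominant e j" and eq: "bary e j x = bary e k x" using ridge_subset by (auto simp: ridge_def)
    then have "0 < bary e j x" using dominant_pos[OF s jk(1)] by blast
    then show ?thesis
      using rel_interior_ridge[OF s jk x] eq unfolding U_def by fastforce
  qed
  have diff: "bary e k (x + w) - bary e j (x + w) = bary e k x - bary e j x + G \<bullet> w" for x w
    by (simp add: bary_add G_def inner_diff_left)
  have G2: "G \<bullet> (k - j) = 2" unfolding G_def using bary_grad_diff[OF s jk(2,1)] jk by simp
  then have nG: "norm G > 0" by auto
  have GG: "G \<bullet> G = norm G * norm G" by (simp add: dot_square_norm power2_eq_square)
  have "ridge e j k \<noteq> {}" using midpoint_in_ridge[OF s jk] by blast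
  then obtain x0 where x0: "x0 \<in> rel_interior (ridge e j k)"
    using rel_interior_eq_empty[OF convex_ridge] by blast
  have x0r: "x0 \<in> ridge e j k" using x0 rel_interior_subset by blast
  show ?thesis unfolding unit_normal_into_def
  proof (rule the_equality)
    have "\<exists>\<delta>>0. \<forall>t. 0 < t \<and> t < \<delta> \<longrightarrow> x + t *\<^sub>R (G /\<^sub>R norm G) \<in> cell M k"
      if x: "x \<in> rel_interior (ridge e j k)" for x
    proof -
      obtain \<delta> where \<delta>: "\<delta> > 0" "\<And>t. \<bar>t\<bar> < \<delta> \<Longrightarrow> x + t *\<^sub>R (G /\<^sub>R norm G) \<in> U"
        using open_line_segment[OF openU relU[OF x]] by blast
      have "x + t *\<^sub>R (G /\<^sub>R norm G) \<in> cell M k" if t: "0 < t" "t < \<delta>" for t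
      proof -
        let ?y = "x + t *\<^sub>R (G /\<^sub>R norm G)"
        have "bary e j x = bary e k x" using x rel_interior_subset by (fastforce simp: ridge_def)
        then have "bary e k ?y - bary e j ?y = t * norm G"
          using diff[of x "t *\<^sub>R (G /\<^sub>R norm G)"] nG by (simp add: GG)
        then have "bary e j ?y < bary e k ?y" using t nG by (smt (verit) mult_pos_pos)
        moreover have yU: "?y \<in> U" using t by (intro \<delta>(2)) simp
        ultimately have "bary e m ?y \<le> bary e k ?y" if "m \<in> e" for m
          using that by (cases "m = j \<or> m = k") (auto simp: U_def intro: less_imp_le)
        then have "?y \<in> dominant e k"
          using yU unfolding U_def dominant_def by (auto intro: less_imp_le)
        then show ?thesis using e jk by (auto simp: cell_eq)
      qed
      then show ?thesis using \<delta>(1) by blast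
    qed
    moreover have "(x - y) \<bullet> (G /\<^sub>R norm G) = 0" if "x \<in> ridge e j k" "y \<in> ridge e j k" for x y
    proof -
      have "G \<bullet> (x - k) = - 1" "G \<bullet> (y - k) = - 1"
        using that ridge_hyperplane[OF s jk] by (auto simp: G_def ridge_def)
      then have "G \<bullet> (x - y) = 0" by (simp add: inner_diff_right)
      then show ?thesis by (simp add: inner_commute)
    qed
    ultimately show "norm (G /\<^sub>R norm G) = 1 \<and>
      (\<forall>x\<in>ridge e j k. \<forall>y\<in>ridge e j k. (x - y) \<bullet> (G /\<^sub>R norm G) = 0) \<and>
      (\<forall>x\<in>rel_interior (ridge e j k). \<exists>\<delta>>0. \<forall>t. 0 < t \<and> t < \<delta> \<longrightarrow> x + t *\<^sub>R (G /\<^sub>R norm G) \<in> cell M k)"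
      using nG by simp
  next
    fix \<nu> assume \<nu>: "norm \<nu> = 1 \<and>
      (\<forall>x\<in>ridge e j k. \<forall>y\<in>ridge e j k. (x - y) \<bullet> \<nu> = 0) \<and>
      (\<forall>x\<in>rel_interior (ridge e j k). \<exists>\<delta>>0. \<forall>t. 0 < t \<and> t < \<delta> \<longrightarrow> x + t *\<^sub>R \<nu> \<in> cell M k)"
    have orth: "w \<bullet> \<nu> = 0" if w: "G \<bullet> w = 0" for w
    proof -
      obtain \<delta> where \<delta>: "\<delta> > 0" "\<And>t. \<bar>t\<bar> < \<delta> \<Longrightarrow> x0 + t *\<^sub>R w \<in> U"
        using open_line_segment[OF openU relU[OF x0]] by blast
      let ?y = "x0 + (\<delta> / 2) *\<^sub>R w"
      have yU: "?y \<in> U" using \<delta>(1) by (intro \<delta>(2)) simp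
      moreover have "bary e j ?y = bary e k ?y"
        using diff[of x0 "(\<delta> / 2) *\<^sub>R w"] w x0r by (simp add: ridge_def)
      moreover from this have "bary e m ?y \<le> bary e j ?y" if "m \<in> e" for m
        using that yU by (cases "m = j \<or> m = k") (auto simp: U_def intro: less_imp_le)
      ultimately have "?y \<in> ridge e j k"
        using yU unfolding U_def ridge_def by (auto intro: less_imp_le)
      then have "(?y - x0) \<bullet> \<nu> = 0" using \<nu> x0r by blast
      then show ?thesis using \<delta>(1) by simp
    qed
    \<comment> \<open>The component of \<open>\<nu>\<close> orthogonal to \<open>G\<close> lies in the plane of the piece, so it is orthogonal to itself.\<close>
    define c where "c = (G \<bullet> \<nu>) / (G \<bullet> G)"
    define w where "w = \<nu> - c *\<^sub>R G"
    have Gw: "G \<bullet> w = 0" using nG by (simp add: w_def c_def inner_diff_right)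
    have "w \<bullet> w = w \<bullet> \<nu> - c * (w \<bullet> G)" by (simp add: w_def inner_diff_right)
    then have "w = 0" using Gw orth[OF Gw] by (simp add: inner_commute)
    then have \<nu>c: "\<nu> = c *\<^sub>R G" by (simp add: w_def)
    have "\<not> c < 0"
    proof
      assume c: "c < 0"
      obtain \<delta> where \<delta>: "\<delta> > 0" "\<And>t. \<bar>t\<bar> < \<delta> \<Longrightarrow> x0 + t *\<^sub>R \<nu> \<in> U"
        using open_line_segment[OF openU relU[OF x0]] by blast
      obtain \<delta>' where \<delta>': "\<delta>' > 0" "\<And>t. 0 < t \<Longrightarrow> t < \<delta>' \<Longrightarrow> x0 + t *\<^sub>R \<nu> \<in> cell M k"
        using \<nu> x0 by blast
      define t where "t = min \<delta> \<delta>' / 2"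
      have t: "0 < t" "t < \<delta>" "t < \<delta>'" using \<delta>(1) \<delta>'(1) by (auto simp: t_def)
      let ?y = "x0 + t *\<^sub>R \<nu>"
      have "?y \<in> convex hull e"
        using \<delta>(2)[of t] t by (auto simp: U_def simplex_hull[OF s] less_imp_le)
      then have "?y \<in> dominant e k" using \<delta>'(2)[of t] t cell_Int_hull[OF e jk(2)] by blast
      then have "bary e j ?y \<le> bary e k ?y" using jk by (auto simp: dominant_def)
      moreover have "bary e k ?y - bary e j ?y = t * (c * (G \<bullet> G))"
        using diff[of x0 "t *\<^sub>R \<nu>"] x0r by (simp add: ridge_def \<nu>c)
      moreover have "t * (c * (G \<bullet> G)) < 0"
        using t c nG by (simp add: mult_pos_neg mult_neg_pos)
      ultimately show False by linarith
    qed
    moreover have "\<bar>c\<bar> * norm G = 1" using \<nu> \<nu>c by (metis norm_scaleR)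
    ultimately have "c = inverse (norm G)" using nG by (simp add: field_simps)
    then show "\<nu> = G /\<^sub>R norm G" using \<nu>c by simp
  qed
qed

lemma interface_normal_eq:
  assumes "j \<noteq> k"
  shows "interface_normal M j k = (\<Sum>e\<in>{e \<in> M. j \<in> e \<and> k \<in> e}.
      (measure lebesgue (convex hull e) / (real CARD('d) + 1)) *\<^sub>R (bary_grad e k - bary_grad e j))"
  unfolding interface_normal_def
proof (rule sum.cong[OF refl])
  fix e assume e: "e \<in> {e \<in> M. j \<in> e \<and> k \<in> e}"
  then show "(let S = interface_piece M j k e; \<nu> = unit_normal_into S (cell M k) in flat_area \<nu> S *\<^sub>R \<nu>)
     = (measure lebesgue (convex hull e) / (real CARD('d) + 1)) *\<^sub>R (bary_grad e k - bary_grad e j)"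
    using measure_prism_ridge[of e j k] simplex[of e] assms
    by (simp add: Let_def interface_piece_eq unit_normal_ridge flat_area_def prism_def)
qed

end

section \<open>Integration by parts against an affine function\<close>

text \<open>
  Translation invariance of the Lebesgue integral gives the formula for difference quotients in
  place of \<open>D\<close>, and the Lipschitz bound and the compact support justify the passage
  to the limit by dominated convergence.
\<close>

lemma integral_by_parts_affine:
  fixes \<phi> D :: "real^'d \<Rightarrow> real" and g u :: "real^'d"
  assumes lip: "\<And>x y. \<bar>\<phi> x - \<phi> y\<bar> \<le> L * norm (x - y)"
    and supp: "\<And>x. r < norm x \<Longrightarrow> \<phi> x = 0"
    and deriv: "AE x in lborel. ((\<lambda>t. \<phi> (x + t *\<^sub>R u)) has_real_derivative D x) (at 0)"
    and D: "D \<in> borel_measurable borel"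
  shows "(\<integral>x. D x * (c + g \<bullet> x) \<partial>lborel) = - (g \<bullet> u) * (\<integral>x. \<phi> x \<partial>lborel)"
proof -
  define aff where "aff x = c + g \<bullet> x" for x
  define h where "h n = 1 / real (Suc n)" for n
  have h: "0 < h n" "h n \<le> 1" for n by (auto simp: h_def)
  have L: "L \<ge> 0"
    using lip[of "axis undefined 1" 0] by (simp add: order_trans[OF abs_ge_zero])
  have cont: "continuous_on UNIV \<phi>"
    by (rule lipschitz_on_continuous_on[of L], rule lipschitz_onI) (use lip L in \<open>auto simp: dist_norm\<close>)
  have cont_aff: "continuous_on S aff" for S unfolding aff_def by (intro continuous_intros)
  have int: "integrable lborel (\<lambda>x. \<phi> x * w x)" if w: "continuous_on UNIV w" for w :: "real^'d \<Rightarrow> real"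
  proof -
    have "integrable lborel (\<lambda>x. indicator (cball 0 r) x *\<^sub>R (\<phi> x * w x))"
      by (intro borel_integrable_compact compact_cball continuous_intros
          continuous_on_subset[OF cont] continuous_on_subset[OF w]) auto
    moreover have "indicator (cball 0 r) x *\<^sub>R (\<phi> x * w x) = \<phi> x * w x" for x
      using supp[of x] by (auto simp: indicator_def)
    ultimately show ?thesis by (simp only:)
  qed
  have int\<phi>: "integrable lborel \<phi>" using int[of "\<lambda>_. 1"] by simp
  have shift: "integrable lborel (\<lambda>x. f (w + x))" "(\<integral>x. f (w + x) \<partial>lborel) = (\<integral>x. f x \<partial>lborel)"
    if f: "integrable lborel f" for f :: "real^'d \<Rightarrow> real" and w
  proof -
    have m: "f \<in> borel_measurable borel" using f by simp
    have "integrable (distr lborel borel ((+) w)) f" using f by (simp add: lborel_distr_plus)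
    then show "integrable lborel (\<lambda>x. f (w + x))" using m by (subst (asm) integrable_distr_eq) auto
    have "(\<integral>x. f x \<partial>lborel) = (\<integral>x. f x \<partial>distr lborel borel ((+) w))" by (simp add: lborel_distr_plus)
    also have "\<dots> = (\<integral>x. f (w + x) \<partial>lborel)" using m by (subst integral_distr) auto
    finally show "(\<integral>x. f (w + x) \<partial>lborel) = (\<integral>x. f x \<partial>lborel)" ..
  qed
  define s where "s n x = (\<phi> (x + h n *\<^sub>R u) - \<phi> x) / h n * aff x" for n x
  have s_int: "(\<integral>x. s n x \<partial>lborel) = - (g \<bullet> u) * (\<integral>x. \<phi> x \<partial>lborel)" for n
  proof -
    let ?w = "h n *\<^sub>R u"
    let ?f = "\<lambda>x. \<phi> x * aff (x - ?w)"
    have f: "integrable lborel ?f"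
      by (rule int) (auto simp: aff_def intro!: continuous_intros)
    have "s n x = (?f (?w + x) - \<phi> x * aff x) / h n" for x
      by (simp add: s_def field_simps add.commute)
    then have "(\<integral>x. s n x \<partial>lborel) = ((\<integral>x. ?f (?w + x) \<partial>lborel) - (\<integral>x. \<phi> x * aff x \<partial>lborel)) / h n"
      using shift(1)[OF f, of ?w] int[OF cont_aff] by simp
    also have "\<dots> = ((\<integral>x. ?f x \<partial>lborel) - (\<integral>x. \<phi> x * aff x \<partial>lborel)) / h n"
      by (simp only: shift(2)[OF f])
    also have "\<dots> = (\<integral>x. (?f x - \<phi> x * aff x) / h n \<partial>lborel)"
      using f int[OF cont_aff] by simp
    also have "\<dots> = (\<integral>x. - (g \<bullet> u) * \<phi> x \<partial>lborel)"
    proof (rule Bochner_Integration.integral_cong[OF refl])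
      fix x
      \<comment> \<open>The shift by \<open>h n *\<^sub>R u\<close> has been transferred from \<open>\<phi>\<close> to the affine factor.\<close>
      have "?f x - \<phi> x * aff x = h n * (- (g \<bullet> u) * \<phi> x)"
        by (simp add: aff_def inner_diff_right algebra_simps)
      then show "(?f x - \<phi> x * aff x) / h n = - (g \<bullet> u) * \<phi> x" using h(1)[of n] by simp
    qed
    finally show ?thesis by simp
  qed
  define R where "R = r + norm u"
  obtain B where B: "\<And>x. x \<in> cball 0 R \<Longrightarrow> \<bar>aff x\<bar> \<le> B"
    using compact_imp_bounded[OF compact_continuous_image[OF cont_aff compact_cball, of 0 R]]
    unfolding bounded_iff by (metis imageI real_norm_def)
  have "(\<lambda>n. \<integral>x. s n x \<partial>lborel) \<longlonglongrightarrow> (\<integral>x. D x * aff x \<partial>lborel)"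
  proof (rule integral_dominated_convergence)
    show "(\<lambda>x. D x * aff x) \<in> borel_measurable lborel"
      using D borel_measurable_continuous_onI[OF cont_aff] by simp
    show "s n \<in> borel_measurable lborel" for n
      unfolding s_def using h(1)[of n] by (auto intro!: borel_measurable_continuous_onI continuous_intros cont_aff
        continuous_on_compose2[OF cont])
    have "integrable lborel (\<lambda>x. indicator (cball 0 R) x *\<^sub>R (L * norm u * B))"
      by (intro borel_integrable_compact compact_cball continuous_intros)
    then show "integrable lborel (\<lambda>x. indicator (cball 0 R) x * (L * norm u * B))" by simp
    show "AE x in lborel. norm (s n x) \<le> indicator (cball 0 R) x * (L * norm u * B)" for n
    proof (rule AE_I2)
      fix x
      show "norm (s n x) \<le> indicator (cball 0 R) x * (L * norm u * B)"
      proof (cases "x \<in> cball 0 R")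
        case True
        have "\<bar>\<phi> (x + h n *\<^sub>R u) - \<phi> x\<bar> \<le> L * (h n * norm u)"
          using lip[of "x + h n *\<^sub>R u" x] h(1)[of n] by simp
        then have "\<bar>(\<phi> (x + h n *\<^sub>R u) - \<phi> x) / h n\<bar> \<le> L * norm u"
          using h(1)[of n] by (simp add: pos_divide_le_eq algebra_simps)
        then have "\<bar>s n x\<bar> \<le> (L * norm u) * B"
          unfolding s_def abs_mult using B[OF True] L by (intro mult_mono) auto
        then show ?thesis using True by simp
      next
        case False
        then have x: "norm x > r + norm u" by (simp add: R_def)
        have "norm (h n *\<^sub>R u) \<le> norm u" using h[of n] by (simp add: mult_left_le_one_le)
        then have "norm (x + h n *\<^sub>R u) > r" using x norm_triangle_ineq4[of "x + h n *\<^sub>R u" "h n *\<^sub>R u"] by simp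
        moreover have "norm x > r" using x norm_ge_zero[of u] by linarith
        ultimately show ?thesis using False by (simp add: s_def supp)
      qed
    qed
    show "AE x in lborel. (\<lambda>n. s n x) \<longlonglongrightarrow> D x * aff x"
      using deriv
    proof (rule AE_mp, intro AE_I2 impI)
      fix x assume "((\<lambda>t. \<phi> (x + t *\<^sub>R u)) has_real_derivative D x) (at 0)"
      then have "(\<lambda>t. (\<phi> (x + t *\<^sub>R u) - \<phi> x) / t) \<midarrow>0\<rightarrow> D x"
        by (simp add: has_field_derivative_iff)
      moreover have "filterlim h (at 0) sequentially"
      proof (rule filterlim_atI)
        show "h \<longlonglongrightarrow> 0" unfolding h_def by (rule LIMSEQ_Suc[OF lim_1_over_n])
        show "\<forall>\<^sub>F n in sequentially. h n \<noteq> 0" using h(1) by (simp add: less_imp_neq[symmetric])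
      qed
      ultimately have "(\<lambda>n. (\<phi> (x + h n *\<^sub>R u) - \<phi> x) / h n) \<longlonglongrightarrow> D x"
        by (rule filterlim_compose)
      then show "(\<lambda>n. s n x) \<longlonglongrightarrow> D x * aff x" unfolding s_def by (rule tendsto_mult_right)
    qed
  qed
  then have "(\<integral>x. D x * aff x \<partial>lborel) = - (g \<bullet> u) * (\<integral>x. \<phi> x \<partial>lborel)"
    unfolding s_int by (simp add: LIMSEQ_const_iff)
  then show ?thesis by (simp add: aff_def)
qed

context periodic_mesh
begin

lemma closed_hull: "e \<in> M \<Longrightarrow> closed (convex hull e)"
  by (intro compact_imp_closed compact_simplex simplex)

lemma borel_hull: "e \<in> M \<Longrightarrow> convex hull e \<in> sets borel"
  by (intro borel_closed closed_hull)

lemma translate_simplex: "integer_vector z \<Longrightarrow> e \<in> M \<Longrightarrow> (\<lambda>x. x + z) ` e \<in> M"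
  using periodic unfolding periodic_simplicial_mesh_def preserves_mesh_def by blast

lemma finite_nodes_cball: "finite (nodes M \<inter> cball 0 r)"
proof -
  \<comment> \<open>Boxes of side one centred at \<open>x\<close>; finitely many cover the ball, and each contains finitely many nodes.\<close>
  define B where "B x = box (x - (1/2) *\<^sub>R 1) (x + (1/2) *\<^sub>R (1::real^'d))" for x
  have half: "x - (1/2) *\<^sub>R 1 + 1 = x + (1/2) *\<^sub>R (1::real^'d)" for x by (simp add: vec_eq_iff)
  have "cball 0 r \<subseteq> (\<Union>x\<in>cball 0 r. B x)"
    unfolding B_def by (auto intro!: bexI simp: mem_box_cart)
  moreover have "open (B x)" for x unfolding B_def by (rule open_box)
  ultimately obtain C where C: "C \<subseteq> cball 0 r" "finite C" "cball 0 r \<subseteq> (\<Union>x\<in>C. B x)"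
    using compactE_image[OF compact_cball, of "cball 0 r" B 0 r] by metis
  have fin: "finite (nodes M \<inter> B x)" for x
  proof -
    have "finite (nodes M \<inter> cbox (x - (1/2) *\<^sub>R 1) (x - (1/2) *\<^sub>R 1 + 1))"
      using periodic unfolding periodic_simplicial_mesh_def by blast
    then show ?thesis unfolding half B_def by (rule finite_subset[rotated]) (use box_subset_cbox in blast)
  qed
  have "nodes M \<inter> cball 0 r \<subseteq> (\<Union>x\<in>C. nodes M \<inter> B x)" using C by blast
  then show ?thesis by (rule finite_subset) (use C fin in blast)
qed

text \<open>
  Every simplex has an integer translate with a vertex in the unit cube, and only finitely many
  simplexes have a vertex there.
\<close>

lemma simplex_diameter_bound: "\<exists>R. \<forall>e\<in>M. \<forall>m\<in>e. convex hull e \<subseteq> cball m R"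
proof -
  define E where "E = (\<Union>m\<in>nodes M \<inter> cbox 0 1. {e \<in> M. m \<in> e})"
  have "finite (nodes M \<inter> cbox 0 (0 + 1))"
    using periodic unfolding periodic_simplicial_mesh_def by blast
  then have "finite E" unfolding E_def using finite_star by simp
  then have "finite (\<Union>E)" using simplex simplex_finite by (auto simp: E_def)
  then have bd: "bounded (\<Union>E)" by (rule finite_imp_bounded)
  have "convex hull e \<subseteq> cball m (diameter (\<Union>E))" if e: "e \<in> M" and m: "m \<in> e" for e m
  proof -
    \<comment> \<open>Translation by \<open>z\<close> moves \<open>m\<close> into the unit cube.\<close>
    define z :: "real^'d" where "z = (\<chi> i. - of_int \<lfloor>m $ i\<rfloor>)"
    have z: "integer_vector z" by (simp add: z_def integer_vector_def)
    have e': "(\<lambda>x. x + z) ` e \<in> M" using translate_simplex[OF z e] .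
    have "m + z \<in> cbox 0 1"
      unfolding mem_box_cart
    proof
      fix i
      have "0 \<le> m $ i - of_int \<lfloor>m $ i\<rfloor>" "m $ i - of_int \<lfloor>m $ i\<rfloor> \<le> 1" by linarith+
      then show "(0 :: real^'d) $ i \<le> (m + z) $ i \<and> (m + z) $ i \<le> (1 :: real^'d) $ i" by (simp add: z_def)
    qed
    then have "(\<lambda>x. x + z) ` e \<in> E" unfolding E_def using m e' by (auto simp: nodes_def)
    then have sub: "(\<lambda>x. x + z) ` e \<subseteq> \<Union>E" by blast
    have "e \<subseteq> cball m (diameter (\<Union>E))"
    proof
      fix a assume a: "a \<in> e"
      have "dist (m + z) (a + z) \<le> diameter (\<Union>E)"
        by (rule diameter_bounded_bound[OF bd]) (use sub a m in auto)
      then show "a \<in> cball m (diameter (\<Union>E))" by simp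
    qed
    then show ?thesis by (intro hull_minimal convex_cball)
  qed
  then show ?thesis by blast
qed

lemma locally_finite: "finite {e \<in> M. convex hull e \<inter> cball 0 r \<noteq> {}}"
proof -
  obtain R where R: "\<And>e m. e \<in> M \<Longrightarrow> m \<in> e \<Longrightarrow> convex hull e \<subseteq> cball m R"
    using simplex_diameter_bound by blast
  have "{e \<in> M. convex hull e \<inter> cball 0 r \<noteq> {}} \<subseteq> (\<Union>m\<in>nodes M \<inter> cball 0 (r + R). {e \<in> M. m \<in> e})"
  proof
    fix e assume "e \<in> {e \<in> M. convex hull e \<inter> cball 0 r \<noteq> {}}"
    then obtain x where e: "e \<in> M" and x: "x \<in> convex hull e" "norm x \<le> r" by auto
    obtain m where m: "m \<in> e" using simplex_nonempty[OF simplex[OF e]] by blast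
    have "dist m x \<le> R" using R[OF e m] x by auto
    then have "norm m \<le> r + R" using x(2) norm_triangle_ineq[of x "m - x"] by (simp add: dist_norm)
    then show "e \<in> (\<Union>m\<in>nodes M \<inter> cball 0 (r + R). {e \<in> M. m \<in> e})"
      using e m by (auto simp: nodes_def)
  qed
  then show ?thesis by (rule finite_subset) (intro finite_UN_I finite_nodes_cball finite_star)
qed

lemma countable_mesh: "countable M"
proof -
  have "M \<subseteq> (\<Union>n. {e \<in> M. convex hull e \<inter> cball 0 (real n) \<noteq> {}})"
  proof
    fix e assume e: "e \<in> M"
    obtain m where m: "m \<in> e" using simplex_nonempty[OF simplex[OF e]] by blast
    obtain n where "norm m \<le> real n" using real_arch_simple by blast
    then have "m \<in> convex hull e \<inter> cball 0 (real n)" using m by (simp add: hull_inc)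
    then show "e \<in> (\<Union>n. {e \<in> M. convex hull e \<inter> cball 0 (real n) \<noteq> {}})" using e by blast
  qed
  moreover have "countable (\<Union>n. {e \<in> M. convex hull e \<inter> cball 0 (real n) \<noteq> {}})"
    using locally_finite by (intro countable_UN) (auto intro: countable_finite)
  ultimately show ?thesis by (rule countable_subset)
qed

text \<open>
  The continuous function that is affine on each simplex, equal to 1 at the node \<open>j\<close>
  and to 0 at all other nodes.
\<close>

definition hat :: "real^'d \<Rightarrow> real^'d \<Rightarrow> real" where
  "hat j x = (let e = SOME e. e \<in> M \<and> x \<in> convex hull e in if j \<in> e then bary e j x else 0)"

lemma hat_eq:
  assumes e: "e \<in> M" "x \<in> convex hull e"
  shows "hat j x = (if j \<in> e then bary e j x else 0)"
proof -
  define e0 where "e0 = (SOME e. e \<in> M \<and> x \<in> convex hull e)"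
  have "e0 \<in> M \<and> x \<in> convex hull e0" unfolding e0_def by (rule someI_ex) (use e in blast)
  then show ?thesis
    unfolding hat_def e0_def[symmetric] Let_def
    using bary_common[of e e0 x j] bary_common[of e0 e x j] e by auto
qed

text \<open>
  Near a point only finitely many simplexes matter, and within each of them the zeros form a
  closed set.
\<close>

lemma closed_hat_zero: "closed {x. hat j x = 0}"
proof -
  let ?Z = "{x. hat j x = 0}"
  have "open (- ?Z)"
  proof (subst open_subopen, intro ballI)
    fix x assume x: "x \<in> - ?Z"
    define F where "F = {e \<in> M. convex hull e \<inter> cball 0 (norm x + 1) \<noteq> {}}"
    define C where "C = (\<Union>e\<in>F. {y \<in> convex hull e. j \<in> e \<longrightarrow> bary e j y = 0})"
    have "closed {y \<in> convex hull e. j \<in> e \<longrightarrow> bary e j y = 0}" if "e \<in> F" for e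
    proof -
      have "closed (convex hull e)" using that closed_hull by (simp add: F_def)
      moreover have "closed {y. bary e j y = 0}" by (intro closed_Collect_eq continuous_intros)
      ultimately show ?thesis by (cases "j \<in> e") (auto simp: Collect_conj_eq intro: closed_Int)
    qed
    then have "closed C" unfolding C_def F_def using locally_finite by (intro closed_UN) auto
    have CZ: "C \<subseteq> ?Z"
    proof
      fix y assume "y \<in> C"
      then obtain e where "e \<in> M" "y \<in> convex hull e" "j \<in> e \<longrightarrow> bary e j y = 0"
        by (auto simp: C_def F_def)
      then show "y \<in> ?Z" using hat_eq[of e y j] by simp
    qed
    have ZC: "?Z \<inter> ball 0 (norm x + 1) \<subseteq> C"
    proof
      fix y assume y: "y \<in> ?Z \<inter> ball 0 (norm x + 1)"
      obtain e where e: "e \<in> M" "y \<in> convex hull e" using covering by blast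
      then have "e \<in> F" using y unfolding F_def by (auto intro!: exI[of _ y])
      then show "y \<in> C" unfolding C_def using hat_eq[OF e, of j] e y by auto
    qed
    have "open (ball 0 (norm x + 1) - C)" using \<open>closed C\<close> by (intro open_Diff open_ball)
    moreover have "x \<in> ball 0 (norm x + 1) - C" using x CZ by auto
    moreover have "ball 0 (norm x + 1) - C \<subseteq> - ?Z" using ZC by blast
    ultimately show "\<exists>T. open T \<and> x \<in> T \<and> T \<subseteq> - ?Z" by blast
  qed
  then show ?thesis by (simp add: closed_open)
qed

text \<open>
  On a segment between two points the function is Lipschitz on each of finitely many closed pieces
  that cover the segment: the simplexes around \<open>j\<close> and the zero set.
\<close>

lemma hat_lipschitz: "\<exists>L. \<forall>x y. \<bar>hat j x - hat j y\<bar> \<le> L * norm (x - y)"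
proof -
  define St where "St = {e \<in> M. j \<in> e}"
  define L where "L = (\<Sum>e\<in>St. norm (bary_grad e j))"
  have fin: "finite St" unfolding St_def by (rule finite_star)
  have L: "norm (bary_grad e j) \<le> L" if "e \<in> St" for e
    unfolding L_def using that fin by (intro member_le_sum) auto
  have L0: "0 \<le> L" unfolding L_def by (intro sum_nonneg) auto
  define P where "P = insert {x. hat j x = 0} ((\<lambda>e. convex hull e) ` St)"
  have piece: "\<bar>hat j x - hat j y\<bar> \<le> L * norm (x - y)" if S: "S \<in> P" "x \<in> S" "y \<in> S" for S x y
  proof (cases "S = {x. hat j x = 0}")
    case True
    then show ?thesis using S L0 by simp
  next
    case False
    then obtain e where e: "e \<in> St" "S = convex hull e" using S by (auto simp: P_def)
    then have "hat j x - hat j y = bary_grad e j \<bullet> (x - y)"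
      using S hat_eq[of e] by (simp add: St_def bary_def inner_diff_right)
    also have "\<bar>\<dots>\<bar> \<le> norm (bary_grad e j) * norm (x - y)" by (rule Cauchy_Schwarz_ineq2)
    also have "\<dots> \<le> L * norm (x - y)" using L[OF e(1)] by (intro mult_right_mono) auto
    finally show ?thesis .
  qed
  have closedP: "closed S" if "S \<in> P" for S
    using that closed_hat_zero closed_hull by (auto simp: P_def St_def)
  have cover: "\<exists>S\<in>P. x \<in> S" for x
  proof -
    obtain e where e: "e \<in> M" "x \<in> convex hull e" using covering by blast
    show ?thesis
    proof (cases "j \<in> e")
      case True then show ?thesis using e by (auto simp: P_def St_def)
    next
      case False then show ?thesis using hat_eq[OF e, of j] by (auto simp: P_def)
    qed
  qed
  have "\<bar>hat j x - hat j y\<bar> \<le> L * norm (x - y)" for x y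
  proof -
    define p where "p t = x + t *\<^sub>R (y - x)" for t
    have "(L * norm (x - y))-lipschitz_on {0..1} (\<lambda>t. hat j (p t))"
    proof (rule lipschitz_on_closed_Union)
      fix S assume S: "S \<in> P"
      show "(L * norm (x - y))-lipschitz_on (p -` S) (\<lambda>t. hat j (p t))"
      proof (rule lipschitz_onI)
        fix s t assume "s \<in> p -` S" "t \<in> p -` S"
        then have "\<bar>hat j (p s) - hat j (p t)\<bar> \<le> L * norm (p s - p t)" using piece[OF S] by simp
        also have "p s - p t = (s - t) *\<^sub>R (y - x)" by (simp add: p_def algebra_simps)
        also have "norm \<dots> = norm (x - y) * dist s t"
          by (simp add: dist_real_def norm_minus_commute)
        finally show "dist (hat j (p s)) (hat j (p t)) \<le> L * norm (x - y) * dist s t"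
          by (simp add: dist_real_def mult.assoc)
      qed (simp add: L0)
      have "continuous_on UNIV p" unfolding p_def by (intro continuous_intros)
      then show "closed (p -` S)" using closedP[OF S] by (simp add: continuous_on_closed_vimage)
    qed (use fin cover L0 in \<open>auto simp: P_def\<close>)
    from lipschitz_onD[OF this, of 0 1] show ?thesis by (simp add: p_def dist_real_def)
  qed
  then show ?thesis by blast
qed

text \<open>
  The derivative of the hat function in direction \<open>u\<close>, valid in the interiors of the
  simplexes.
\<close>

definition hat_deriv :: "real^'d \<Rightarrow> real^'d \<Rightarrow> real^'d \<Rightarrow> real" where
  "hat_deriv j u x = (\<Sum>e\<in>{e \<in> M. j \<in> e}. indicator (convex hull e) x * (bary_grad e j \<bullet> u))"

lemma AE_interior_of_unique_simplex:
  "AE x in lborel. \<exists>e\<in>M. x \<in> interior (convex hull e) \<and> (\<forall>e'\<in>M. x \<in> convex hull e' \<longrightarrow> e' = e)"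
proof -
  define N where "N = (\<Union>e\<in>M. frontier (convex hull e)) \<union> (\<Union>p\<in>{p \<in> M \<times> M. fst p \<noteq> snd p}. convex hull (fst p) \<inter> convex hull (snd p))"
  have "negligible N" unfolding N_def
  proof (intro negligible_Un)
    show "negligible (\<Union>e\<in>M. frontier (convex hull e))"
      by (intro negligible_countable_Union countable_image countable_mesh)
        (auto intro: negligible_convex_frontier)
    show "negligible (\<Union>p\<in>{p \<in> M \<times> M. fst p \<noteq> snd p}. convex hull (fst p) \<inter> convex hull (snd p))"
      by (intro negligible_countable_Union countable_image countable_subset[OF _ countable_SIGMA[OF countable_mesh countable_mesh]])
        (auto intro: negligible_hull_Int)
  qed
  then have "AE x in lebesgue. x \<notin> N" by (simp add: negligible_iff_null_sets AE_not_in)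
  then have "AE x in lebesgue. \<exists>e\<in>M. x \<in> interior (convex hull e) \<and> (\<forall>e'\<in>M. x \<in> convex hull e' \<longrightarrow> e' = e)"
  proof (rule AE_mp, intro AE_I2 impI)
    fix x assume x: "x \<notin> N"
    obtain e where e: "e \<in> M" "x \<in> convex hull e" using covering by blast
    have "x \<in> interior (convex hull e)"
      using x e closure_subset by (fastforce simp: N_def frontier_def)
    moreover have "e' = e" if "e' \<in> M" "x \<in> convex hull e'" for e'
    proof (rule ccontr)
      assume "e' \<noteq> e"
      then have "x \<in> N" unfolding N_def using e that by (intro UnI2 UN_I[of "(e', e)"]) auto
      then show False using x by blast
    qed
    ultimately show "\<exists>e\<in>M. x \<in> interior (convex hull e) \<and> (\<forall>e'\<in>M. x \<in> convex hull e' \<longrightarrow> e' = e)"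
      using e by blast
  qed
  then show ?thesis by (simp add: AE_completion_iff)
qed

lemma sum_star_indicator:
  assumes e: "e \<in> M" "x \<in> convex hull e" and unique: "\<forall>e'\<in>M. x \<in> convex hull e' \<longrightarrow> e' = e"
  shows "(\<Sum>e\<in>{e \<in> M. j \<in> e}. indicator (convex hull e) x * f e) = (if j \<in> e then f e else (0::real))"
proof -
  have "(\<Sum>e\<in>{e \<in> M. j \<in> e}. indicator (convex hull e) x * f e) = (\<Sum>e'\<in>{e \<in> M. j \<in> e}. if e' = e then f e else 0)"
  proof (rule sum.cong[OF refl])
    fix e' assume "e' \<in> {e \<in> M. j \<in> e}"
    then have "x \<in> convex hull e' \<longleftrightarrow> e' = e" using unique e by blast
    then show "indicator (convex hull e') x * f e' = (if e' = e then f e else 0)" by (auto simp: indicator_def)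
  qed
  also have "\<dots> = (if j \<in> e then f e else 0)"
    using e finite_star[of j] by (subst sum.delta) auto
  finally show ?thesis .
qed

lemma hat_deriv_AE:
  "AE x in lborel. ((\<lambda>t. hat j (x + t *\<^sub>R u)) has_real_derivative hat_deriv j u x) (at 0)"
  using AE_interior_of_unique_simplex
proof (rule AE_mp, intro AE_I2 impI)
  fix x assume "\<exists>e\<in>M. x \<in> interior (convex hull e) \<and> (\<forall>e'\<in>M. x \<in> convex hull e' \<longrightarrow> e' = e)"
  then obtain e where e: "e \<in> M" "x \<in> interior (convex hull e)" "\<forall>e'\<in>M. x \<in> convex hull e' \<longrightarrow> e' = e"
    by blast
  have D: "hat_deriv j u x = (if j \<in> e then bary_grad e j \<bullet> u else 0)"
    unfolding hat_deriv_def using e interior_subset by (intro sum_star_indicator) auto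
  obtain \<delta> where \<delta>: "\<delta> > 0" "\<And>t. \<bar>t\<bar> < \<delta> \<Longrightarrow> x + t *\<^sub>R u \<in> interior (convex hull e)"
    using open_line_segment[OF open_interior e(2)] by blast
  define f where "f t = (if j \<in> e then bary e j x + t * (bary_grad e j \<bullet> u) else 0)" for t
  have "(f has_real_derivative hat_deriv j u x) (at 0)"
    unfolding D f_def by (cases "j \<in> e") (auto intro!: derivative_eq_intros)
  then show "((\<lambda>t. hat j (x + t *\<^sub>R u)) has_real_derivative hat_deriv j u x) (at 0)"
  proof (rule has_field_derivative_transform_within[OF _ \<delta>(1)])
    fix t :: real assume "t \<in> UNIV" "dist t 0 < \<delta>"
    then have "x + t *\<^sub>R u \<in> convex hull e" using \<delta>(2)[of t] interior_subset by auto
    from hat_eq[OF e(1) this, of j] show "f t = hat j (x + t *\<^sub>R u)" by (simp add: f_def bary_add)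
  qed simp
qed

lemma integral_hat: "(\<integral>x. hat j x \<partial>lborel) = cell_volume M j"
proof -
  have "(\<integral>x. hat j x \<partial>lborel) = (\<integral>x. (\<Sum>e\<in>{e \<in> M. j \<in> e}. indicator (convex hull e) x * bary e j x) \<partial>lborel)"
  proof (rule integral_cong_AE)
    obtain L where L: "\<And>x y. \<bar>hat j x - hat j y\<bar> \<le> L * norm (x - y)" using hat_lipschitz by blast
    then have "L \<ge> 0" using L[of "axis undefined 1" 0] by (simp add: order_trans[OF abs_ge_zero])
    then have "continuous_on UNIV (hat j)"
      by (intro lipschitz_on_continuous_on[of L] lipschitz_onI) (use L in \<open>auto simp: dist_norm\<close>)
    then show "hat j \<in> borel_measurable lborel" by (simp add: borel_measurable_continuous_onI)
    show "(\<lambda>x. \<Sum>e\<in>{e \<in> M. j \<in> e}. indicator (convex hull e) x * bary e j x) \<in> borel_measurable lborel"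
    proof (rule borel_measurable_sum)
      fix e assume "e \<in> {e \<in> M. j \<in> e}"
      then have "indicator (convex hull e) \<in> borel_measurable lborel" using borel_hull by simp
      moreover have "bary e j \<in> borel_measurable lborel"
        by (simp add: borel_measurable_continuous_onI continuous_on_bary[OF continuous_on_id])
      ultimately show "(\<lambda>x. indicator (convex hull e) x * bary e j x) \<in> borel_measurable lborel"
        by (rule borel_measurable_times)
    qed
    show "AE x in lborel. hat j x = (\<Sum>e\<in>{e \<in> M. j \<in> e}. indicator (convex hull e) x * bary e j x)"
      using AE_interior_of_unique_simplex
    proof (rule AE_mp, intro AE_I2 impI)
      fix x assume "\<exists>e\<in>M. x \<in> interior (convex hull e) \<and> (\<forall>e'\<in>M. x \<in> convex hull e' \<longrightarrow> e' = e)"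
      then obtain e where e: "e \<in> M" "x \<in> convex hull e" "\<forall>e'\<in>M. x \<in> convex hull e' \<longrightarrow> e' = e"
        using interior_subset by blast
      show "hat j x = (\<Sum>e\<in>{e \<in> M. j \<in> e}. indicator (convex hull e) x * bary e j x)"
        unfolding hat_eq[OF e(1,2)] using sum_star_indicator[OF e, where f="\<lambda>e. bary e j x"] by simp
    qed
  qed
  also have "\<dots> = (\<Sum>e\<in>{e \<in> M. j \<in> e}. (\<integral>x. indicator (convex hull e) x * bary e j x \<partial>lborel))"
    by (intro Bochner_Integration.integral_sum integrable_simplex continuous_intros) (auto intro: simplex)
  also have "\<dots> = cell_volume M j"
    unfolding cell_volume_eq
  proof (intro sum.cong refl)
    fix e assume "e \<in> {e \<in> M. j \<in> e}"
    then have s: "is_simplex e" "j \<in> e" using simplex by auto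
    then show "(\<integral>x. indicator (convex hull e) x * bary e j x \<partial>lborel) = measure lebesgue (convex hull e) / (real CARD('d) + 1)"
      using integral_bary[OF s] s(1) by (simp add: is_simplex_def add.commute)
  qed
  finally show ?thesis .
qed

text \<open>
  Integration by parts for the hat function against the affine function \<open>c + g \<bullet>
  x\<close>. Both integrands are evaluated simplex by simplex: the integral of an affine function
  is the volume times the mean of the vertex values.
\<close>

lemma star_gradient_identity:
  fixes c :: real and g u :: "real^'d"
  shows "(\<Sum>e\<in>{e \<in> M. j \<in> e}. measure lebesgue (convex hull e) / (real CARD('d) + 1) *
            ((bary_grad e j \<bullet> u) * (\<Sum>l\<in>e. c + g \<bullet> l))) = - (g \<bullet> u) * cell_volume M j"
proof -
  obtain L where L: "\<And>x y. \<bar>hat j x - hat j y\<bar> \<le> L * norm (x - y)" using hat_lipschitz by blast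
  have "bounded (\<Union>e\<in>{e \<in> M. j \<in> e}. convex hull e)"
    by (intro bounded_UN finite_star ballI compact_imp_bounded compact_simplex) (auto intro: simplex)
  then obtain r where r: "\<And>x e. e \<in> M \<Longrightarrow> j \<in> e \<Longrightarrow> x \<in> convex hull e \<Longrightarrow> norm x \<le> r"
    unfolding bounded_iff by blast
  have supp: "hat j x = 0" if x: "r < norm x" for x
  proof -
    obtain e where e: "e \<in> M" "x \<in> convex hull e" using covering by blast
    then have "j \<notin> e" using r[of e x] x by auto
    then show ?thesis using hat_eq[OF e, of j] by simp
  qed
  have meas: "hat_deriv j u \<in> borel_measurable borel"
    unfolding hat_deriv_def by (intro borel_measurable_sum borel_measurable_times borel_measurable_indicator) (auto intro: borel_hull)
  have "- (g \<bullet> u) * cell_volume M j = (\<integral>x. hat_deriv j u x * (c + g \<bullet> x) \<partial>lborel)"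
    unfolding integral_hat[symmetric]
    by (rule integral_by_parts_affine[OF L supp hat_deriv_AE meas, symmetric])
  also have "\<dots> = (\<integral>x. (\<Sum>e\<in>{e \<in> M. j \<in> e}. (bary_grad e j \<bullet> u) * (indicator (convex hull e) x * (c + g \<bullet> x))) \<partial>lborel)"
    by (simp add: hat_deriv_def sum_distrib_right sum_distrib_left mult_ac)
  also have "\<dots> = (\<Sum>e\<in>{e \<in> M. j \<in> e}. (\<integral>x. (bary_grad e j \<bullet> u) * (indicator (convex hull e) x * (c + g \<bullet> x)) \<partial>lborel))"
    by (intro Bochner_Integration.integral_sum integrable_mult_right integrable_simplex continuous_intros) (auto intro: simplex)
  also have "\<dots> = (\<Sum>e\<in>{e \<in> M. j \<in> e}. measure lebesgue (convex hull e) / (real CARD('d) + 1) *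
            ((bary_grad e j \<bullet> u) * (\<Sum>l\<in>e. c + g \<bullet> l)))"
  proof (intro sum.cong refl)
    fix e assume "e \<in> {e \<in> M. j \<in> e}"
    then have s: "is_simplex e" using simplex by auto
    have "(\<integral>x. (bary_grad e j \<bullet> u) * (indicator (convex hull e) x * (c + g \<bullet> x)) \<partial>lborel)
      = (bary_grad e j \<bullet> u) * (\<integral>x. indicator (convex hull e) x * (c + g \<bullet> x) \<partial>lborel)"
      by (rule integral_mult_right_zero)
    also have "(\<integral>x. indicator (convex hull e) x * (c + g \<bullet> x) \<partial>lborel) = measure lebesgue (convex hull e) / card e * (\<Sum>l\<in>e. c + g \<bullet> l)"
      by (rule integral_affine_simplex[OF s]) simp
    also have "real (card e) = real CARD('d) + 1" using s by (simp add: is_simplex_def)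
    finally show "(\<integral>x. (bary_grad e j \<bullet> u) * (indicator (convex hull e) x * (c + g \<bullet> x)) \<partial>lborel) =
      measure lebesgue (convex hull e) / (real CARD('d) + 1) * ((bary_grad e j \<bullet> u) * (\<Sum>l\<in>e. c + g \<bullet> l))"
      by (simp only: mult_ac)
  qed
  finally show ?thesis by simp
qed

lemma finite_neighbours: "finite (neighbours M j)"
proof -
  have "neighbours M j \<subseteq> \<Union>{e \<in> M. j \<in> e}" by (auto simp: neighbours_def)
  then show ?thesis
    by (rule finite_subset) (intro finite_Union finite_star; auto intro: simplex_finite simplex)
qed

text \<open>
  The sum over the neighbours, each normal being a sum over simplexes, is reordered into a sum
  over the simplexes around \<open>j\<close>. The term \<open>k = j\<close> on the right is zero.
\<close>

lemma sum_interface_normal: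
  fixes a :: "real^'d \<Rightarrow> real"
  shows "(\<Sum>k\<in>neighbours M j. (interface_normal M j k \<bullet> u) * a k) =
    (\<Sum>e\<in>{e \<in> M. j \<in> e}. measure lebesgue (convex hull e) / (real CARD('d) + 1) *
       (\<Sum>k\<in>e. ((bary_grad e k - bary_grad e j) \<bullet> u) * a k))"
proof -
  let ?w = "\<lambda>e. measure lebesgue (convex hull e) / (real CARD('d) + 1)"
  let ?t = "\<lambda>e k. ?w e * (((bary_grad e k - bary_grad e j) \<bullet> u) * a k)"
  have "(\<Sum>k\<in>neighbours M j. (interface_normal M j k \<bullet> u) * a k)
      = (\<Sum>k\<in>neighbours M j. \<Sum>e | e \<in> {e \<in> M. j \<in> e} \<and> k \<in> e. ?t e k)"
  proof (intro sum.cong refl)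
    fix k assume "k \<in> neighbours M j"
    then have "j \<noteq> k" by (auto simp: neighbours_def)
    then show "(interface_normal M j k \<bullet> u) * a k = (\<Sum>e | e \<in> {e \<in> M. j \<in> e} \<and> k \<in> e. ?t e k)"
      by (simp add: interface_normal_eq inner_sum_left sum_distrib_right conj_assoc mult.assoc)
  qed
  also have "\<dots> = (\<Sum>e\<in>{e \<in> M. j \<in> e}. \<Sum>k | k \<in> neighbours M j \<and> k \<in> e. ?t e k)"
    by (rule sum.swap_restrict[OF finite_neighbours finite_star])
  also have "\<dots> = (\<Sum>e\<in>{e \<in> M. j \<in> e}. \<Sum>k\<in>e. ?t e k)"
  proof (rule sum.cong[OF refl])
    fix e assume e: "e \<in> {e \<in> M. j \<in> e}"
    have "finite e" using e simplex simplex_finite by blast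
    moreover have "{k. k \<in> neighbours M j \<and> k \<in> e} = e - {j}" using e by (auto simp: neighbours_def)
    ultimately show "(\<Sum>k | k \<in> neighbours M j \<and> k \<in> e. ?t e k) = (\<Sum>k\<in>e. ?t e k)"
      using e by (simp add: sum.remove[of e j])
  qed
  finally show ?thesis by (simp add: sum_distrib_left)
qed

text \<open>
  The control volume has a closed boundary. In terms of gradients, the volume-weighted gradients
  of the hat function cancel around \<open>j\<close>.
\<close>

lemma sum_interface_normal_zero: "(\<Sum>k\<in>neighbours M j. interface_normal M j k \<bullet> u) = 0"
proof -
  have "(\<Sum>k\<in>neighbours M j. (interface_normal M j k \<bullet> u) * 1) =
    (\<Sum>e\<in>{e \<in> M. j \<in> e}. measure lebesgue (convex hull e) / (real CARD('d) + 1) *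
       (\<Sum>k\<in>e. ((bary_grad e k - bary_grad e j) \<bullet> u) * 1))"
    by (rule sum_interface_normal)
  also have "\<dots> = - (\<Sum>e\<in>{e \<in> M. j \<in> e}. measure lebesgue (convex hull e) / (real CARD('d) + 1) *
            ((bary_grad e j \<bullet> u) * (\<Sum>l\<in>e. 1 + 0 \<bullet> l)))"
    unfolding sum_negf[symmetric]
  proof (intro sum.cong refl)
    fix e assume "e \<in> {e \<in> M. j \<in> e}"
    then have s: "is_simplex e" using simplex by auto
    have "(\<Sum>k\<in>e. bary_grad e k \<bullet> u) = 0" using sum_bary_grad[OF s] by (metis inner_sum_left inner_zero_left)
    then show "measure lebesgue (convex hull e) / (real CARD('d) + 1) * (\<Sum>k\<in>e. ((bary_grad e k - bary_grad e j) \<bullet> u) * 1)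
      = - (measure lebesgue (convex hull e) / (real CARD('d) + 1) * ((bary_grad e j \<bullet> u) * (\<Sum>l\<in>e. 1 + 0 \<bullet> l)))"
      by (simp add: inner_diff_left sum_subtractf)
  qed
  also have "\<dots> = 0" unfolding star_gradient_identity by simp
  finally show ?thesis by simp
qed

text \<open>
  This is the identity behind exactness on linear functions: half of the right-hand side comes
  from \<open>sum_bary_grad_vertex\<close> in each simplex, the other half from integration by
  parts with an affine function that vanishes at \<open>j\<close>.
\<close>

lemma sum_interface_normal_edge:
  "(\<Sum>k\<in>neighbours M j. (interface_normal M j k \<bullet> u) * ((k - j) \<bullet> v)) = 2 * cell_volume M j * (u \<bullet> v)"
proof -
  let ?w = "\<lambda>e. measure lebesgue (convex hull e) / (real CARD('d) + 1)"
  have "(\<Sum>k\<in>neighbours M j. (interface_normal M j k \<bullet> u) * ((k - j) \<bullet> v)) =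
    (\<Sum>e\<in>{e \<in> M. j \<in> e}. ?w e * (\<Sum>k\<in>e. ((bary_grad e k - bary_grad e j) \<bullet> u) * ((k - j) \<bullet> v)))"
    by (rule sum_interface_normal)
  also have "\<dots> = (\<Sum>e\<in>{e \<in> M. j \<in> e}. ?w e * (u \<bullet> v) - ?w e * ((bary_grad e j \<bullet> u) * (\<Sum>l\<in>e. - (v \<bullet> j) + v \<bullet> l)))"
  proof (intro sum.cong refl)
    fix e assume "e \<in> {e \<in> M. j \<in> e}"
    then have s: "is_simplex e" using simplex by auto
    have 0: "(\<Sum>k\<in>e. bary_grad e k \<bullet> u) = 0" using sum_bary_grad[OF s] by (metis inner_sum_left inner_zero_left)
    have "(\<Sum>k\<in>e. (bary_grad e k \<bullet> u) * (k \<bullet> v)) = u \<bullet> v"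
      using arg_cong[OF sum_bary_grad_vertex[OF s, of u], of "\<lambda>x. x \<bullet> v"] by (simp add: inner_sum_left)
    moreover have "(\<Sum>k\<in>e. (bary_grad e k \<bullet> u) * (j \<bullet> v)) = 0" using 0 by (simp add: sum_distrib_right[symmetric])
    ultimately have "(\<Sum>k\<in>e. ((bary_grad e k - bary_grad e j) \<bullet> u) * ((k - j) \<bullet> v))
       = u \<bullet> v - (\<Sum>k\<in>e. (bary_grad e j \<bullet> u) * ((k - j) \<bullet> v))"
      by (simp add: inner_diff_left left_diff_distrib right_diff_distrib sum_subtractf)
    also have "(\<Sum>k\<in>e. (bary_grad e j \<bullet> u) * ((k - j) \<bullet> v)) = (bary_grad e j \<bullet> u) * (\<Sum>l\<in>e. - (v \<bullet> j) + v \<bullet> l)"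
      by (simp add: sum_distrib_left inner_diff_left inner_commute algebra_simps)
    finally show "?w e * (\<Sum>k\<in>e. ((bary_grad e k - bary_grad e j) \<bullet> u) * ((k - j) \<bullet> v))
      = ?w e * (u \<bullet> v) - ?w e * ((bary_grad e j \<bullet> u) * (\<Sum>l\<in>e. - (v \<bullet> j) + v \<bullet> l))"
      by (simp add: right_diff_distrib)
  qed
  also have "\<dots> = cell_volume M j * (u \<bullet> v) + (v \<bullet> u) * cell_volume M j"
    unfolding sum_subtractf star_gradient_identity by (simp add: cell_volume_eq sum_distrib_right)
  finally show ?thesis by (simp add: inner_commute)
qed

end

section \<open>Real matrices acting on complex vectors\<close>

lemma real_matrix_apply_nth: "real_matrix_apply B w $ i = (\<Sum>j\<in>UNIV. complex_of_real (B $ i $ j) * w $ j)"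
  by (simp add: real_matrix_apply_def matrix_vector_mult_def)

lemma real_matrix_apply_add: "real_matrix_apply B (v + w) = real_matrix_apply B v + real_matrix_apply B w"
  by (simp add: vec_eq_iff real_matrix_apply_nth distrib_left sum.distrib)

lemma real_matrix_apply_scaleR: "real_matrix_apply B (c *\<^sub>R w) = c *\<^sub>R real_matrix_apply B w"
  by (simp add: vec_eq_iff real_matrix_apply_nth scaleR_sum_right)

lemma linear_real_matrix_apply: "linear (real_matrix_apply B)"
  by (rule linearI) (auto simp: real_matrix_apply_add real_matrix_apply_scaleR)

lemma real_matrix_apply_matrix_dot:
  "real_matrix_apply (matrix_dot A v) w = (\<Sum>i\<in>UNIV. v $ i *\<^sub>R real_matrix_apply (A i) w)"
proof (subst vec_eq_iff, rule allI)
  fix r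
  have "real_matrix_apply (matrix_dot A v) w $ r
      = (\<Sum>s\<in>UNIV. \<Sum>i\<in>UNIV. complex_of_real (v $ i) * (complex_of_real (A i $ r $ s) * w $ s))"
    by (simp add: real_matrix_apply_nth matrix_dot_def sum_distrib_right mult.assoc)
  also have "\<dots> = (\<Sum>i\<in>UNIV. \<Sum>s\<in>UNIV. complex_of_real (v $ i) * (complex_of_real (A i $ r $ s) * w $ s))"
    by (rule sum.swap)
  also have "\<dots> = (\<Sum>i\<in>UNIV. v $ i *\<^sub>R real_matrix_apply (A i) w) $ r"
    by (simp add: real_matrix_apply_nth) (simp add: scaleR_conv_of_real sum_distrib_left)
  finally show "real_matrix_apply (matrix_dot A v) w $ r = (\<Sum>i\<in>UNIV. v $ i *\<^sub>R real_matrix_apply (A i) w) $ r" .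
qed

abbreviation monomial :: "('d::finite \<Rightarrow> nat) \<Rightarrow> real^'d \<Rightarrow> complex" where
  "monomial m x \<equiv> \<Prod>i\<in>UNIV. complex_of_real (x $ i) ^ m i"

section \<open>Polynomials of degree at most two\<close>

lemma finite_multi_indices: "finite {m :: 'd::finite \<Rightarrow> nat. (\<Sum>i\<in>UNIV. m i) \<le> q}"
proof (rule finite_subset)
  show "{m :: 'd \<Rightarrow> nat. (\<Sum>i\<in>UNIV. m i) \<le> q} \<subseteq> PiE UNIV (\<lambda>_. {..q})"
    using member_le_sum[of _ UNIV "_ :: 'd \<Rightarrow> nat"] by (auto intro: order_trans)
  show "finite (PiE (UNIV :: 'd set) (\<lambda>_. {..q}))" by (intro finite_PiE) auto
qed

lemma poly_deg_add: "f \<in> poly_deg q \<Longrightarrow> g \<in> poly_deg q \<Longrightarrow> (\<lambda>x. f x + g x) \<in> poly_deg q"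
proof -
  assume "f \<in> poly_deg q" "g \<in> poly_deg q"
  then obtain c d where "f = (\<lambda>x. \<Sum>m\<in>{m. (\<Sum>i\<in>UNIV. m i) \<le> q}. c m * monomial m x)"
    "g = (\<lambda>x. \<Sum>m\<in>{m. (\<Sum>i\<in>UNIV. m i) \<le> q}. d m * monomial m x)"
    by (auto simp: poly_deg_def)
  then show ?thesis unfolding poly_deg_def
    by (intro CollectI exI[of _ "\<lambda>m. c m + d m"]) (simp add: sum.distrib distrib_right)
qed

lemma poly_deg_cmult: "f \<in> poly_deg q \<Longrightarrow> (\<lambda>x. a * f x) \<in> poly_deg q"
proof -
  assume "f \<in> poly_deg q"
  then obtain c where "f = (\<lambda>x. \<Sum>m\<in>{m. (\<Sum>i\<in>UNIV. m i) \<le> q}. c m * monomial m x)"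
    by (auto simp: poly_deg_def)
  then show ?thesis unfolding poly_deg_def
    by (intro CollectI exI[of _ "\<lambda>m. a * c m"]) (simp add: sum_distrib_left mult.assoc)
qed

lemma monomial_poly_deg:
  assumes "(\<Sum>i\<in>UNIV. m i) \<le> q"
  shows "monomial m \<in> poly_deg q"
  unfolding poly_deg_def
proof (intro CollectI exI ext)
  fix x
  show "monomial m x = (\<Sum>m'\<in>{m'. (\<Sum>i\<in>UNIV. m' i) \<le> q}. (if m' = m then 1 else 0) * monomial m' x)"
    using assms by (simp add: if_distrib[of "\<lambda>c. c * _"] sum.delta[OF finite_multi_indices] cong: if_cong)
qed

lemma const_poly_deg: "(\<lambda>x. a) \<in> poly_deg q"
  using poly_deg_cmult[OF monomial_poly_deg[of "\<lambda>_. 0" q], of a] by simp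

lemma coordinate_poly_deg: "(\<lambda>x. complex_of_real (x $ i)) \<in> poly_deg 1"
proof -
  have "monomial (\<lambda>j. if j = i then 1 else 0) x = complex_of_real (x $ i)" for x :: "real^'a"
    by (simp add: if_distrib[of "\<lambda>n. _ ^ n"] cong: if_cong)
  moreover have "monomial (\<lambda>j. if j = i then 1 else 0) \<in> poly_deg 1"
    by (rule monomial_poly_deg) simp
  ultimately show ?thesis by (simp only:)
qed

lemma sum_poly_deg:
  assumes "finite I" "\<And>i. i \<in> I \<Longrightarrow> f i \<in> poly_deg q"
  shows "(\<lambda>x. \<Sum>i\<in>I. f i x) \<in> poly_deg q"
  using assms by (induction I) (auto intro: const_poly_deg poly_deg_add)

lemma linear_axis_expansion:
  fixes h :: "real^'d \<Rightarrow> 'b::real_vector"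
  assumes "linear h"
  shows "h x = (\<Sum>a\<in>UNIV. x $ a *\<^sub>R h (axis a 1))"
proof -
  have "h x = h (\<Sum>a\<in>UNIV. x $ a *\<^sub>R axis a 1)"
    using basis_expansion[of x] by (simp add: scalar_mult_eq_scaleR)
  then show ?thesis by (simp add: linear_sum[OF assms] linear_scale[OF assms])
qed

lemma affine_vec_poly_deg:
  fixes h :: "real^'d \<Rightarrow> complex^'n"
  assumes "linear h"
  shows "(\<lambda>x. c + h x) \<in> vec_poly_deg 1"
  unfolding vec_poly_deg_def
proof (intro CollectI allI)
  fix i
  have "(c + h x) $ i = c $ i + (\<Sum>a\<in>UNIV. h (axis a 1) $ i * complex_of_real (x $ a))" for x
    by (subst linear_axis_expansion[OF assms]) (simp, simp add: scaleR_conv_of_real mult.commute)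
  then show "(\<lambda>x. (c + h x) $ i) \<in> poly_deg 1"
    by (simp only:) (intro poly_deg_add const_poly_deg sum_poly_deg poly_deg_cmult coordinate_poly_deg finite)
qed

definition quadratic :: "(real^'d \<Rightarrow> complex) \<Rightarrow> bool" where
  "quadratic p \<longleftrightarrow> (\<exists>c L H. \<forall>x. p x = c + (\<Sum>a\<in>UNIV. complex_of_real (x $ a) * L a) +
     (\<Sum>a\<in>UNIV. \<Sum>b\<in>UNIV. complex_of_real (x $ a) * complex_of_real (x $ b) * H a b))"

lemma quadratic_add:
  assumes "quadratic p" "quadratic q"
  shows "quadratic (\<lambda>x. p x + q x)"
proof -
  obtain c L H where p: "\<And>x. p x = c + (\<Sum>a\<in>UNIV. complex_of_real (x $ a) * L a) +
     (\<Sum>a\<in>UNIV. \<Sum>b\<in>UNIV. complex_of_real (x $ a) * complex_of_real (x $ b) * H a b)"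
    using assms(1) unfolding quadratic_def by blast
  obtain c' L' H' where q: "\<And>x. q x = c' + (\<Sum>a\<in>UNIV. complex_of_real (x $ a) * L' a) +
     (\<Sum>a\<in>UNIV. \<Sum>b\<in>UNIV. complex_of_real (x $ a) * complex_of_real (x $ b) * H' a b)"
    using assms(2) unfolding quadratic_def by blast
  show ?thesis unfolding quadratic_def
    by (rule exI[of _ "c + c'"], rule exI[of _ "\<lambda>a. L a + L' a"], rule exI[of _ "\<lambda>a b. H a b + H' a b"])
      (simp add: p q distrib_left sum.distrib)
qed

lemma quadratic_cmult:
  assumes "quadratic p"
  shows "quadratic (\<lambda>x. k * p x)"
proof -
  obtain c L H where p: "\<And>x. p x = c + (\<Sum>a\<in>UNIV. complex_of_real (x $ a) * L a) +
     (\<Sum>a\<in>UNIV. \<Sum>b\<in>UNIV. complex_of_real (x $ a) * complex_of_real (x $ b) * H a b)"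
    using assms(1) unfolding quadratic_def by blast
  show ?thesis unfolding quadratic_def
    by (rule exI[of _ "k * c"], rule exI[of _ "\<lambda>a. k * L a"], rule exI[of _ "\<lambda>a b. k * H a b"])
      (simp add: p distrib_left sum_distrib_left mult.left_commute)
qed

lemma quadratic_const: "quadratic (\<lambda>x. k)"
  unfolding quadratic_def
  by (rule exI[of _ k], rule exI[of _ "\<lambda>_. 0"], rule exI[of _ "\<lambda>_ _. 0"]) simp

lemma quadratic_coordinate: "quadratic (\<lambda>x. complex_of_real (x $ i))"
  unfolding quadratic_def
  by (rule exI[of _ 0], rule exI[of _ "\<lambda>a. if a = i then 1 else 0"], rule exI[of _ "\<lambda>_ _. 0"])
    (simp add: if_distrib[of "\<lambda>c. _ * c"] cong: if_cong)

lemma sum_if_const: "(\<Sum>b\<in>S. if P then g b else 0) = (if P then (\<Sum>b\<in>S. g b) else 0)"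
  by simp

lemma quadratic_coordinate_product: "quadratic (\<lambda>x. complex_of_real (x $ i) * complex_of_real (x $ j))"
  unfolding quadratic_def
  by (rule exI[of _ 0], rule exI[of _ "\<lambda>_. 0"], rule exI[of _ "\<lambda>a b. if a = i then if b = j then 1 else 0 else 0"])
    (simp add: if_distrib[of "\<lambda>c. _ * c"] sum_if_const cong: if_cong)

lemma monomial_0:
  assumes "(\<Sum>i\<in>UNIV. m i) = 0"
  shows "monomial m x = 1"
  using assms by simp

lemma monomial_Suc:
  assumes "(\<Sum>i\<in>UNIV. m i) = Suc n"
  obtains a m' where "(\<Sum>i\<in>UNIV. m' i) = n" "\<And>x. monomial m x = complex_of_real (x $ a) * monomial m' x"
proof -
  obtain a where a: "m a \<noteq> 0" using assms by fastforce
  define m' where "m' = m(a := m a - 1)"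
  have "(\<Sum>i\<in>UNIV. m i) = m a + (\<Sum>i\<in>UNIV - {a}. m i)" by (simp add: sum.remove[of _ a])
  moreover have "(\<Sum>i\<in>UNIV. m' i) = (m a - 1) + (\<Sum>i\<in>UNIV - {a}. m i)"
    by (simp add: sum.remove[of _ a] m'_def)
  ultimately have "(\<Sum>i\<in>UNIV. m' i) = n" using assms a by simp
  moreover have "monomial m x = complex_of_real (x $ a) * monomial m' x" for x
  proof -
    have "complex_of_real (x $ a) ^ m a = complex_of_real (x $ a) * complex_of_real (x $ a) ^ (m a - 1)"
      using a by (cases "m a") auto
    moreover have "monomial m x = complex_of_real (x $ a) ^ m a * (\<Prod>i\<in>UNIV - {a}. complex_of_real (x $ i) ^ m i)"
      by (rule prod.remove) auto
    moreover have "monomial m' x = complex_of_real (x $ a) ^ m' a * (\<Prod>i\<in>UNIV - {a}. complex_of_real (x $ i) ^ m' i)"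
      by (rule prod.remove) auto
    moreover have "(\<Prod>i\<in>UNIV - {a}. complex_of_real (x $ i) ^ m' i) = (\<Prod>i\<in>UNIV - {a}. complex_of_real (x $ i) ^ m i)"
      by (intro prod.cong) (auto simp: m'_def)
    ultimately show ?thesis by (simp add: m'_def mult.assoc)
  qed
  ultimately show ?thesis using that by blast
qed

lemma quadratic_monomial:
  assumes "(\<Sum>i\<in>UNIV. m i) \<le> 2"
  shows "quadratic (monomial m)"
proof -
  consider "(\<Sum>i\<in>UNIV. m i) = 0" | "(\<Sum>i\<in>UNIV. m i) = Suc 0" | "(\<Sum>i\<in>UNIV. m i) = Suc (Suc 0)"
    using assms by linarith
  then show ?thesis
  proof cases
    case 1
    then have "monomial m = (\<lambda>x. 1)" using monomial_0 by blast
    then show ?thesis using quadratic_const by simp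
  next
    case 2
    then obtain a m' where "(\<Sum>i\<in>UNIV. m' i) = 0" "\<And>x. monomial m x = complex_of_real (x $ a) * monomial m' x"
      using monomial_Suc by blast
    then have "monomial m = (\<lambda>x. complex_of_real (x $ a))" using monomial_0 by fastforce
    then show ?thesis using quadratic_coordinate by simp
  next
    case 3
    then obtain a m' where 1: "(\<Sum>i\<in>UNIV. m' i) = Suc 0" "\<And>x. monomial m x = complex_of_real (x $ a) * monomial m' x"
      using monomial_Suc by blast
    obtain b m'' where 2: "(\<Sum>i\<in>UNIV. m'' i) = 0" "\<And>x. monomial m' x = complex_of_real (x $ b) * monomial m'' x"
      using monomial_Suc[OF 1(1)] by blast
    have "monomial m = (\<lambda>x. complex_of_real (x $ a) * complex_of_real (x $ b))"
      by (rule ext) (simp only: 1(2) 2(2) monomial_0[OF 2(1)] mult_1_right)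
    then show ?thesis using quadratic_coordinate_product by simp
  qed
qed

text \<open>
  Stripping one variable at a time from a monomial of degree at most two leaves a product of at
  most two coordinates.
\<close>

lemma poly_deg_2_quadratic:
  assumes "p \<in> poly_deg 2"
  shows "quadratic p"
proof -
  obtain c where p: "p = (\<lambda>x. \<Sum>m\<in>{m. (\<Sum>i\<in>UNIV. m i) \<le> 2}. c m * monomial m x)"
    using assms by (auto simp: poly_deg_def)
  have "quadratic (\<lambda>x. \<Sum>m\<in>S. c m * monomial m x)" if "finite S" "S \<subseteq> {m. (\<Sum>i\<in>UNIV. m i) \<le> 2}" for S
    using that
  proof (induction S)
    case empty
    show ?case using quadratic_const[of 0] by simp
  next
    case (insert m S)
    then have "quadratic (\<lambda>x. c m * monomial m x + (\<Sum>m\<in>S. c m * monomial m x))"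
      by (intro quadratic_add quadratic_cmult quadratic_monomial) auto
    then show ?case using insert by simp
  qed
  then show ?thesis unfolding p using finite_multi_indices by blast
qed

lemma vec_poly_deg_2_form:
  fixes f :: "real^'d \<Rightarrow> complex^'n"
  assumes "f \<in> vec_poly_deg 2"
  shows "\<exists>c l B. linear l \<and> bilinear B \<and> (\<forall>x. f x = c + l x + B x x)"
proof -
  have "\<exists>t. \<forall>x. f x $ i = fst t + (\<Sum>a\<in>UNIV. complex_of_real (x $ a) * fst (snd t) a) +
     (\<Sum>a\<in>UNIV. \<Sum>b\<in>UNIV. complex_of_real (x $ a) * complex_of_real (x $ b) * snd (snd t) a b)" for i
  proof -
    have "quadratic (\<lambda>x. f x $ i)"
      using assms poly_deg_2_quadratic unfolding vec_poly_deg_def by blast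
    then obtain c L H where "\<And>x. f x $ i = c + (\<Sum>a\<in>UNIV. complex_of_real (x $ a) * L a) +
     (\<Sum>a\<in>UNIV. \<Sum>b\<in>UNIV. complex_of_real (x $ a) * complex_of_real (x $ b) * H a b)"
      unfolding quadratic_def by blast
    then show ?thesis by (intro exI[of _ "(c, L, H)"]) simp
  qed
  then have "\<exists>t. \<forall>i x. f x $ i = fst (t i) + (\<Sum>a\<in>UNIV. complex_of_real (x $ a) * fst (snd (t i)) a) +
     (\<Sum>a\<in>UNIV. \<Sum>b\<in>UNIV. complex_of_real (x $ a) * complex_of_real (x $ b) * snd (snd (t i)) a b)"
    by (intro choice allI)
  then obtain t where t: "\<forall>i x. f x $ i = fst (t i) + (\<Sum>a\<in>UNIV. complex_of_real (x $ a) * fst (snd (t i)) a) +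
     (\<Sum>a\<in>UNIV. \<Sum>b\<in>UNIV. complex_of_real (x $ a) * complex_of_real (x $ b) * snd (snd (t i)) a b)"
    by (rule exE)
  define c where "c i = fst (t i)" for i
  define L where "L i = fst (snd (t i))" for i
  define H where "H i = snd (snd (t i))" for i
  have f: "f x $ i = c i + (\<Sum>a\<in>UNIV. complex_of_real (x $ a) * L i a) +
     (\<Sum>a\<in>UNIV. \<Sum>b\<in>UNIV. complex_of_real (x $ a) * complex_of_real (x $ b) * H i a b)" for i x
    unfolding c_def L_def H_def by (rule t[rule_format])
  define l where "l x = (\<Sum>a\<in>UNIV. x $ a *\<^sub>R (\<chi> i. L i a))" for x :: "real^'d"
  define B where "B x y = (\<Sum>a\<in>UNIV. x $ a *\<^sub>R (\<Sum>b\<in>UNIV. y $ b *\<^sub>R (\<chi> i. H i a b)))" for x y :: "real^'d"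
  show ?thesis
  proof (intro exI conjI allI)
    show "linear l" unfolding l_def
      by (rule linearI) (auto simp: scaleR_add_left sum.distrib scaleR_sum_right)
    have "linear (\<lambda>x. B x y)" for y unfolding B_def
      by (rule linearI, simp add: scaleR_add_left sum.distrib, simp add: scaleR_sum_right mult.assoc)
    moreover have "linear (B x)" for x unfolding B_def
      by (rule linearI) (simp_all add: scaleR_add_left scaleR_add_right sum.distrib scaleR_sum_right mult.left_commute)
    ultimately show "bilinear B" unfolding bilinear_def by blast
    show "f x = (\<chi> i. c i) + l x + B x x" for x
      by (simp add: vec_eq_iff f l_def B_def) (simp add: scaleR_conv_of_real sum_distrib_left mult.assoc)
  qed
qed

lemma A_grad_quadratic:
  fixes f :: "real^'d \<Rightarrow> complex^'n"
  assumes l: "linear l" and B: "bilinear B" and f: "\<And>x. f x = c + l x + B x x"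
  shows "A_grad A f x = (\<Sum>i\<in>UNIV. real_matrix_apply (A i) (l (axis i 1) + (B x (axis i 1) + B (axis i 1) x)))"
proof -
  have bl: "bounded_linear l" using l by (simp add: linear_conv_bounded_linear)
  have bB: "bounded_bilinear B" using B by (simp add: bilinear_conv_bounded_bilinear)
  have "((\<lambda>x. c + l x + B x x) has_derivative (\<lambda>h. 0 + l h + (B x h + B h x))) (at x)"
    by (intro has_derivative_add has_derivative_const bounded_linear.has_derivative[OF bl]
        bounded_bilinear.FDERIV[OF bB] has_derivative_ident)
  then have "(f has_derivative (\<lambda>h. l h + (B x h + B h x))) (at x)" by (simp add: f[abs_def])
  then have "frechet_derivative f (at x) = (\<lambda>h. l h + (B x h + B h x))"
    by (rule frechet_derivative_at[symmetric])
  then show ?thesis by (simp add: A_grad_def)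
qed

section \<open>Cancellation over the edges modulo translations\<close>

lemma sum_eq_0_by_sign_reversing_involution:
  fixes g :: "'a \<Rightarrow> 'b::real_vector"
  assumes "\<And>p. p \<in> E \<Longrightarrow> \<sigma> p \<in> E" "\<And>p. p \<in> E \<Longrightarrow> \<sigma> (\<sigma> p) = p" "\<And>p. p \<in> E \<Longrightarrow> g (\<sigma> p) = - g p"
  shows "(\<Sum>p\<in>E. g p) = 0"
proof -
  have "(\<Sum>p\<in>E. g p) = (\<Sum>p\<in>E. g (\<sigma> p))"
    by (rule sum.reindex_bij_witness[of _ \<sigma> \<sigma>]) (use assms in auto)
  also have "\<dots> = - (\<Sum>p\<in>E. g p)" using assms(3) by (simp add: sum_negf)
  finally have "2 *\<^sub>R (\<Sum>p\<in>E. g p) = 0" by (simp add: scaleR_2 eq_neg_iff_add_eq_0)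
  then show ?thesis by simp
qed

context periodic_mesh
begin

lemma integer_translation_nodes: "integer_vector z \<Longrightarrow> j + z \<in> nodes M \<longleftrightarrow> j \<in> nodes M"
proof -
  have 1: "j + z \<in> nodes M" if "integer_vector z" "j \<in> nodes M" for j z
    using that translate_simplex[of z] unfolding nodes_def by blast
  assume z: "integer_vector z"
  then have "integer_vector (- z)" by (simp add: integer_vector_def)
  then show ?thesis using 1[OF z, of j] 1[of "- z" "j + z"] by auto
qed

lemma neighbours_translate: "integer_vector z \<Longrightarrow> k \<in> neighbours M j \<Longrightarrow> k + z \<in> neighbours M (j + z)"
  using translate_simplex[of z] unfolding neighbours_def by (auto intro!: bexI[of _ "(\<lambda>x. x + z) ` _"])

lemma neighbours_sym: "k \<in> neighbours M j \<Longrightarrow> j \<in> neighbours M k"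
  by (auto simp: neighbours_def)

lemma neighbours_nodes: "k \<in> neighbours M j \<Longrightarrow> k \<in> nodes M \<and> j \<in> nodes M"
  by (auto simp: neighbours_def nodes_def)

lemma preserves_mesh_integer: "integer_vector z \<Longrightarrow> preserves_mesh M z"
  using periodic by (simp add: periodic_simplicial_mesh_def)

text \<open>
  Reversing an edge and translating it so that its new origin is again a representative is an
  involution on the edges issuing from the representatives. By antisymmetry and translation
  invariance it changes the sign of \<open>W\<close>.
\<close>

lemma sum_edges_mod_translation_zero:
  fixes W :: "real^'d \<Rightarrow> real^'d \<Rightarrow> 'b::real_vector"
  assumes \<rho>: "\<forall>c\<in>nodes_mod M. \<rho> c \<in> c"
    and anti: "\<And>j k. k \<in> neighbours M j \<Longrightarrow> W k j = - W j k"
    and inv: "\<And>j k z. k \<in> neighbours M j \<Longrightarrow> integer_vector z \<Longrightarrow> W (j + z) (k + z) = W j k"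
  shows "(\<Sum>c\<in>nodes_mod M. \<Sum>k\<in>neighbours M (\<rho> c). W (\<rho> c) k) = 0"
proof (cases "finite (nodes_mod M)")
  case True
  define r where "r = {(x, y). x \<in> nodes M \<and> y \<in> nodes M \<and> integer_vector (x - y)}"
  have iv: "integer_vector (- z)" "integer_vector (z + w)" if "integer_vector z" "integer_vector w" for z w :: "real^'d"
    using that by (auto simp: integer_vector_def)
  have r: "equiv (nodes M) r"
  proof (rule equivI)
    show "r \<subseteq> nodes M \<times> nodes M" "refl_on (nodes M) r" by (auto simp: r_def refl_on_def integer_vector_def)
    show "sym r" unfolding sym_def r_def using iv(1) by fastforce
    show "trans r" unfolding trans_def r_def using iv(2) by fastforce
  qed
  have NM: "nodes_mod M = nodes M // r" by (simp add: nodes_mod_def r_def)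
  have cl: "r `` {k} \<in> nodes_mod M" "\<rho> (r `` {k}) \<in> nodes M" "integer_vector (\<rho> (r `` {k}) - k)" if "k \<in> nodes M" for k
  proof -
    show 1: "r `` {k} \<in> nodes_mod M" unfolding NM using that by (rule quotientI)
    have "(k, \<rho> (r `` {k})) \<in> r" using \<rho> 1 by blast
    then show "\<rho> (r `` {k}) \<in> nodes M" "integer_vector (\<rho> (r `` {k}) - k)"
      using iv(1)[of "k - \<rho> (r `` {k})"] by (auto simp: r_def)
  qed
  have cl\<rho>: "r `` {\<rho> c} = c" if c: "c \<in> nodes_mod M" for c
  proof -
    obtain k where k: "c = r `` {k}" using c unfolding NM by (rule quotientE)
    moreover have "\<rho> c \<in> c" using \<rho> c by blast
    ultimately have "(k, \<rho> c) \<in> r" by blast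
    from equiv_class_eq[OF r this] show ?thesis using k by simp
  qed
  define E where "E = (SIGMA c:nodes_mod M. neighbours M (\<rho> c))"
  \<comment> \<open>The edge from \<open>k\<close> to \<open>\<rho> c\<close>, translated so that it starts at the representative of the class of \<open>k\<close>.\<close>
  define \<sigma> where "\<sigma> = (\<lambda>(c, k). (r `` {k}, \<rho> c + (\<rho> (r `` {k}) - k)))"
  have "(\<Sum>c\<in>nodes_mod M. \<Sum>k\<in>neighbours M (\<rho> c). W (\<rho> c) k) = (\<Sum>p\<in>E. W (\<rho> (fst p)) (snd p))"
    unfolding E_def using True finite_neighbours by (simp add: sum.Sigma split_def)
  also have "\<dots> = 0"
  proof (rule sum_eq_0_by_sign_reversing_involution)
    fix p assume "p \<in> E"
    then obtain c k where p: "p = (c, k)" "c \<in> nodes_mod M" "k \<in> neighbours M (\<rho> c)" by (auto simp: E_def)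
    define z where "z = \<rho> (r `` {k}) - k"
    have k: "k \<in> nodes M" "\<rho> c \<in> nodes M" using neighbours_nodes[OF p(3)] by auto
    have z: "integer_vector z" unfolding z_def by (rule cl(3)[OF k(1)])
    have kz: "\<rho> (r `` {k}) = k + z" by (simp add: z_def)
    have \<sigma>p: "\<sigma> p = (r `` {k}, \<rho> c + z)" by (simp add: \<sigma>_def p z_def)
    show "\<sigma> p \<in> E"
      unfolding \<sigma>p E_def using cl(1)[OF k(1)] neighbours_translate[OF z neighbours_sym[OF p(3)]] kz by simp
    have "(\<rho> c + z, \<rho> c) \<in> r" using k z integer_translation_nodes[OF z] by (simp add: r_def)
    then have "r `` {\<rho> c + z} = c" using equiv_class_eq[OF r] cl\<rho>[OF p(2)] by simp
    then show "\<sigma> (\<sigma> p) = p" unfolding \<sigma>p by (simp add: \<sigma>_def p kz)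
    show "W (\<rho> (fst (\<sigma> p))) (snd (\<sigma> p)) = - W (\<rho> (fst p)) (snd p)"
      unfolding \<sigma>p by (simp add: kz p inv[OF neighbours_sym[OF p(3)] z] anti[OF p(3)])
  qed
  finally show ?thesis .
next
  case False
  then show ?thesis by simp
qed

lemma sum_interface_normal_nth: "(\<Sum>k\<in>neighbours M j. interface_normal M j k $ i) = 0"
  using sum_interface_normal_zero[of j "axis i 1"] by (simp add: inner_axis)

lemma sum_interface_normal_edge_nth:
  "(\<Sum>k\<in>neighbours M j. interface_normal M j k $ i *\<^sub>R (k - j)) = (2 * cell_volume M j) *\<^sub>R axis i 1"
proof (subst vec_eq_iff, rule allI)
  fix a
  show "(\<Sum>k\<in>neighbours M j. interface_normal M j k $ i *\<^sub>R (k - j)) $ a = ((2 * cell_volume M j) *\<^sub>R axis i 1) $ a"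
    using sum_interface_normal_edge[of j "axis i 1" "axis a 1"]
    by (simp add: inner_axis)
qed

text \<open>
  Evaluation of an affine function at the edge midpoints gives the exact balance of fluxes. The
  value \<open>p\<close> at the node drops out because the normals sum to zero, and the linear
  part is handled by the second identity for the normals.
\<close>

lemma midpoint_flux_exact:
  fixes A :: "'d \<Rightarrow> real^'n^'n" and h :: "real^'d \<Rightarrow> complex^'n"
  assumes h: "linear h"
  shows "(\<Sum>k\<in>neighbours M j. real_matrix_apply (matrix_dot A (interface_normal M j k)) (p + h ((1/2) *\<^sub>R (k - j))))
    = cell_volume M j *\<^sub>R (\<Sum>i\<in>UNIV. real_matrix_apply (A i) (h (axis i 1)))"
proof -
  have "(\<Sum>k\<in>neighbours M j. real_matrix_apply (matrix_dot A (interface_normal M j k)) (p + h ((1/2) *\<^sub>R (k - j))))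
     = (\<Sum>i\<in>UNIV. \<Sum>k\<in>neighbours M j. interface_normal M j k $ i *\<^sub>R real_matrix_apply (A i) (p + h ((1/2) *\<^sub>R (k - j))))"
    unfolding real_matrix_apply_matrix_dot by (rule sum.swap)
  also have "\<dots> = (\<Sum>i\<in>UNIV. cell_volume M j *\<^sub>R real_matrix_apply (A i) (h (axis i 1)))"
  proof (intro sum.cong refl)
    fix i
    have "(\<Sum>k\<in>neighbours M j. interface_normal M j k $ i *\<^sub>R real_matrix_apply (A i) (p + h ((1/2) *\<^sub>R (k - j))))
      = real_matrix_apply (A i) ((\<Sum>k\<in>neighbours M j. interface_normal M j k $ i) *\<^sub>R p
          + h ((1/2) *\<^sub>R (\<Sum>k\<in>neighbours M j. interface_normal M j k $ i *\<^sub>R (k - j))))"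
      unfolding scaleR_sum_left scaleR_sum_right linear_sum[OF h] sum.distrib[symmetric] linear_sum[OF linear_real_matrix_apply]
      by (intro sum.cong refl)
        (simp add: real_matrix_apply_scaleR[symmetric] scaleR_add_right linear_scale[OF h] mult.commute)
    then show "(\<Sum>k\<in>neighbours M j. interface_normal M j k $ i *\<^sub>R real_matrix_apply (A i) (p + h ((1/2) *\<^sub>R (k - j))))
      = cell_volume M j *\<^sub>R real_matrix_apply (A i) (h (axis i 1))"
      unfolding sum_interface_normal_nth sum_interface_normal_edge_nth
      by (simp add: linear_scale[OF h] real_matrix_apply_scaleR)
  qed
  finally show ?thesis by (simp add: scaleR_sum_right)
qed

end

theorem proposition7p5:
  fixes M :: "(real^'d) set set"
    and A :: "'d \<Rightarrow> real^'n^'n"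
    and F :: "('d::finite, 'n::finite) flux"
    and f :: "real^'d \<Rightarrow> complex^'n"
    and \<rho> :: "(real^'d) set \<Rightarrow> real^'d"
  assumes "periodic_simplicial_mesh M"
    and "edge_based_scheme M A F"
    and "f \<in> vec_poly_deg 2"
    and "\<forall>c\<in>nodes_mod M. \<rho> c \<in> c"
  shows "(\<Sum>c\<in>nodes_mod M. cell_volume M (\<rho> c) *\<^sub>R truncation_error M A F f (\<rho> c)) = 0"
proof -
  interpret periodic_mesh M by unfold_locales (rule assms(1))
  obtain c l B where l: "linear l" and B: "bilinear B" and f: "\<And>x. f x = c + l x + B x x"
    using vec_poly_deg_2_form[OF assms(3)] by blast
  have scheme:
    "F j k (\<lambda>l. u l + v l) = F j k u + F j k v"
    "F j k u = - F k j u"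
    "integer_vector z \<Longrightarrow> F (j + z) (k + z) (\<lambda>l. u (l - z)) = F j k u"
    "g \<in> vec_poly_deg 1 \<Longrightarrow> F j k (nodal_values M g) =
        real_matrix_apply (matrix_dot A (interface_normal M j k)) (g ((1/2) *\<^sub>R (j + k)))"
    if "k \<in> neighbours M j" for j k u v z g
    using assms(2) that neighbours_nodes[OF that] preserves_mesh_integer[of z] unfolding edge_based_scheme_def by blast+
  have additive: "F j k (nodal_values M (\<lambda>x. g x + h x)) = F j k (nodal_values M g) + F j k (nodal_values M h)"
    if "k \<in> neighbours M j" for j k g h
  proof -
    have "nodal_values M (\<lambda>x. g x + h x) = (\<lambda>x. nodal_values M g x + nodal_values M h x)"
      by (auto simp: nodal_values_def)
    then show ?thesis using scheme(1)[OF that] by simp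
  qed
  have Bl: "linear (\<lambda>x. B x y)" "linear (B x)" for x y using B by (auto simp: bilinear_def)
  note Bs = bilinear_ladd[OF B] bilinear_radd[OF B] bilinear_lsub[OF B] bilinear_rsub[OF B]
  define Q where "Q j x = B (x - j) (x - j)" for j x
  define W where "W j k = F j k (nodal_values M (Q j))" for j k
  have node: "cell_volume M j *\<^sub>R truncation_error M A F f j = (\<Sum>k\<in>neighbours M j. W j k)"
    if j: "j \<in> nodes M" for j
  proof -
    \<comment> \<open>The derivative of \<open>f\<close> at \<open>j\<close>.\<close>
    define h where "h x = l x + (B j x + B x j)" for x
    have h: "linear h" unfolding h_def by (intro linear_compose_add l Bl)
    have fT: "f x = ((f j - h j) + h x) + Q j x" for x
      by (simp add: f h_def Q_def Bs)
    have F: "F j k (nodal_values M f) =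
        real_matrix_apply (matrix_dot A (interface_normal M j k)) (f j + h ((1/2) *\<^sub>R (k - j))) + W j k"
      if k: "k \<in> neighbours M j" for k
    proof -
      have "F j k (nodal_values M f) = F j k (nodal_values M (\<lambda>x. (f j - h j) + h x)) + W j k"
        using additive[OF k, of "\<lambda>x. (f j - h j) + h x" "Q j"] by (simp add: W_def fT[symmetric])
      also have "F j k (nodal_values M (\<lambda>x. (f j - h j) + h x)) =
          real_matrix_apply (matrix_dot A (interface_normal M j k)) ((f j - h j) + h ((1/2) *\<^sub>R (j + k)))"
        by (rule scheme(4)[OF k affine_vec_poly_deg[OF h]])
      also have "(f j - h j) + h ((1/2) *\<^sub>R (j + k)) = f j + h ((1/2) *\<^sub>R (k - j))"
      proof -
        have "(1/2) *\<^sub>R (j + k) = j + (1/2) *\<^sub>R (k - j)"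
          by (simp add: vec_eq_iff field_simps)
        then show ?thesis by (simp add: linear_add[OF h])
      qed
      finally show ?thesis .
    qed
    have "A_grad A f j = (\<Sum>i\<in>UNIV. real_matrix_apply (A i) (h (axis i 1)))"
      unfolding A_grad_quadratic[OF l B f] h_def ..
    then have "(\<Sum>k\<in>neighbours M j. F j k (nodal_values M f)) = cell_volume M j *\<^sub>R A_grad A f j + (\<Sum>k\<in>neighbours M j. W j k)"
      using F midpoint_flux_exact[OF h, where j = j and A = A and p = "f j"] by (simp add: sum.distrib)
    then show ?thesis
      using cell_volume_pos[OF j] by (simp add: truncation_error_def scaleR_add_right)
  qed
  have anti: "W k j = - W j k" if k: "k \<in> neighbours M j" for j k
  proof -
    \<comment> \<open>The linear part of \<open>Q j - Q k\<close>: the quadratic terms \<open>B x x\<close> cancel.\<close>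
    define h where "h x = (B x k + B k x) - (B x j + B j x)" for x
    have h: "linear h" unfolding h_def by (intro linear_compose_sub linear_compose_add Bl)
    define p where "p = B j j - B k k"
    have Qj: "Q j x = Q k x + (p + h x)" for x by (simp add: Q_def h_def p_def Bs)
    have "p + h ((1/2) *\<^sub>R (j + k)) = Q j ((1/2) *\<^sub>R (j + k)) - Q k ((1/2) *\<^sub>R (j + k))"
      by (simp add: Qj)
    also have "\<dots> = 0"
    proof -
      have opposite: "(1/2) *\<^sub>R (j + k) - j = - ((1/2) *\<^sub>R (j + k) - k)" by (simp add: vec_eq_iff field_simps)
      show ?thesis
        unfolding Q_def opposite by (simp only: bilinear_lneg[OF B] bilinear_rneg[OF B] minus_minus diff_self)
    qed
    finally have mid: "p + h ((1/2) *\<^sub>R (j + k)) = 0" .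
    have "Q j = (\<lambda>x. Q k x + (p + h x))" by (rule ext) (rule Qj)
    then have "W j k = F j k (nodal_values M (\<lambda>x. Q k x + (p + h x)))"
      unfolding W_def by (rule arg_cong)
    also have "\<dots> = F j k (nodal_values M (Q k)) + F j k (nodal_values M (\<lambda>x. p + h x))"
      by (rule additive[OF k])
    also have "F j k (nodal_values M (\<lambda>x. p + h x)) = 0"
      using scheme(4)[OF k affine_vec_poly_deg[OF h]] mid linear_0[OF linear_real_matrix_apply] by simp
    finally show ?thesis using scheme(2)[OF k, of "nodal_values M (Q k)"] by (simp add: W_def)
  qed
  have inv: "W (j + z) (k + z) = W j k" if k: "k \<in> neighbours M j" and z: "integer_vector z" for j k z
  proof -
    have "nodal_values M (Q (j + z)) = (\<lambda>x. nodal_values M (Q j) (x - z))"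
    proof
      fix x
      show "nodal_values M (Q (j + z)) x = nodal_values M (Q j) (x - z)"
        using integer_translation_nodes[OF z, of "x - z"] by (simp add: nodal_values_def Q_def algebra_simps)
    qed
    then show ?thesis using scheme(3)[OF k z] by (simp add: W_def)
  qed
  have "\<rho> c \<in> nodes M" if "c \<in> nodes_mod M" for c
    using that assms(4) unfolding nodes_mod_def quotient_def by fastforce
  then have "(\<Sum>c\<in>nodes_mod M. cell_volume M (\<rho> c) *\<^sub>R truncation_error M A F f (\<rho> c))
      = (\<Sum>c\<in>nodes_mod M. \<Sum>k\<in>neighbours M (\<rho> c). W (\<rho> c) k)"
    by (intro sum.cong refl node)
  also have "\<dots> = 0" by (rule sum_edges_mod_translation_zero[where W = W and \<rho> = \<rho>, OF assms(4) anti inv])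
  finally show ?thesis .
qed

end
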